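(* Let $X$ be a complex Hilbert space and let $A$ be the generator of a bounded $C_0$-semigroup $(T(t))_{t\ge0}$ on $X$ with $\sigma(A)\cap i\mathbb{R}=\emptyset$. Let $M,N\colon\mathbb{R}_+\to(0,\infty)$ be continuous non-decreasing functions and suppose that $M(s)\to\infty$ as $s\to\infty$, that $N(s)=O(\log s)$ as $s\to\infty$, and that $M$ has quasi-positive increase with auxiliary function $N$, that is, there exist constants $c\in(0,1]$ and $s_0>0$ such that $$\frac{M(\lambda s)}{M(s)}\ge c\lambda^{1/N(\lambda s)},\quad \lambda\ge1,\ s\ge s_0.$$ Suppose further that $\|R(is,A)\|\le M(|s|)$ for all $s\in\mathbb{R}$. Then, with this constant $c$, $$\|T(t)A^{-1}\|=O\left(\frac{1}{M_K^{-1}(c e t)}\right),\quad t\to\infty,$$ where $M_K(s)=M(s)K(s)$ and $$K(s)=N(s)\left(1+\frac{3\log N(s)}{2N(s)}\right),\quad s\ge N^{-1}(1).$$ In particular, given any $\varepsilon\in(0,1)$ we have $$\|T(t)A^{-1}\|=O\left(\frac{1}{M_{N}^{-1}\big(ce(1-\varepsilon)t\big)}\right),\quad t\to\infty,$$ where $M_N(s)=M(s)N(s)$, $s\ge0$.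
   Context: $\mathbb{R}_+=[0,\infty)$; $e$ is Euler's number. A $C_0$-semigroup is bounded if $\sup_{t\ge0}\|T(t)\|<\infty$. For a closed operator $A$, $\sigma(A)$ is its spectrum and $R(z,A)=(zI-A)^{-1}$ for $z\notin\sigma(A)$. For a continuous non-decreasing function $F\colon[a,\infty)\to(0,\infty)$, $a\ge0$, with $F(s)\to\infty$ as $s\to\infty$, $F^{-1}$ denotes its right-continuous right-inverse $F^{-1}(t)=\sup\{r\ge a: F(r)\le t\}$, $t\ge F(a)$. The number $N^{-1}(1)$ is $\sup\{r\ge0:N(r)\le1\}$, understood as $0$ if $N(0)>1$; the function $M_K$ has domain $[N^{-1}(1),\infty)$, and the first estimate is understood for those $N$ which take some value larger than $1$ (so that $N^{-1}(1)<\infty$). On this domain $M_K$ is continuous, non-decreasing and unbounded. $f(t)=O(g(t))$, $t\to\infty$, means there is a constant $C>0$ with $f(t)\le Cg(t)$ for all sufficiently large $t$. *)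

theory Defs
  imports "HOL-Analysis.Analysis" "HOL-Library.Landau_Symbols"
begin

text \<open>
  Complex Hilbert spaces. The real scalar multiplication inherited from \<^class>\<open>banach\<close> is
  required to be the restriction of the complex one, so that the real notions
  \<^const>\<open>bounded_linear\<close> and \<^const>\<open>onorm\<close> apply; for a complex-linear map, \<^const>\<open>onorm\<close> is
  the usual operator norm. The inner product is linear in its first argument.
\<close>

class complex_hilbert_space = banach +
  fixes scaleC :: "complex \<Rightarrow> 'a \<Rightarrow> 'a"  (infixr \<open>*\<^sub>C\<close> 75)
    and cinner :: "'a \<Rightarrow> 'a \<Rightarrow> complex"
  assumes scaleC_add_right: "a *\<^sub>C (x + y) = a *\<^sub>C x + a *\<^sub>C y"
    and scaleC_add_left: "(a + b) *\<^sub>C x = a *\<^sub>C x + b *\<^sub>C x"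
    and scaleC_scaleC: "a *\<^sub>C (b *\<^sub>C x) = (a * b) *\<^sub>C x"
    and scaleC_of_real: "complex_of_real r *\<^sub>C x = r *\<^sub>R x"
    and cinner_commute: "cinner x y = cnj (cinner y x)"
    and cinner_add_left: "cinner (x + y) z = cinner x z + cinner y z"
    and cinner_scaleC_left: "cinner (a *\<^sub>C x) y = a * cinner x y"
    and cinner_self: "cinner x x = complex_of_real ((norm x)\<^sup>2)"

definition bounded_clinear ::
  "('a::complex_hilbert_space \<Rightarrow> 'b::complex_hilbert_space) \<Rightarrow> bool" where
  "bounded_clinear f \<longleftrightarrow> bounded_linear f \<and> (\<forall>a x. f (a *\<^sub>C x) = a *\<^sub>C f x)"

text \<open>Only the values \<open>T t\<close> for \<open>t \<ge> 0\<close> matter.\<close>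

definition C0_semigroup :: "(real \<Rightarrow> 'a::complex_hilbert_space \<Rightarrow> 'a) \<Rightarrow> bool" where
  "C0_semigroup T \<longleftrightarrow>
     (\<forall>t\<ge>0. bounded_clinear (T t)) \<and>
     (\<forall>x. T 0 x = x) \<and>
     (\<forall>s\<ge>0. \<forall>t\<ge>0. \<forall>x. T (s + t) x = T s (T t x)) \<and>
     (\<forall>x. ((\<lambda>t. T t x) \<longlongrightarrow> x) (at_right 0))"

definition bounded_C0_semigroup :: "(real \<Rightarrow> 'a::complex_hilbert_space \<Rightarrow> 'a) \<Rightarrow> bool" where
  "bounded_C0_semigroup T \<longleftrightarrow> C0_semigroup T \<and> bdd_above ((\<lambda>t. onorm (T t)) ` {0..})"

text \<open>
  An unbounded operator is given by its domain \<open>D\<close> and a function \<open>A\<close> whose values outside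
  \<open>D\<close> are irrelevant.
\<close>

definition is_generator ::
  "(real \<Rightarrow> 'a::complex_hilbert_space \<Rightarrow> 'a) \<Rightarrow> 'a set \<Rightarrow> ('a \<Rightarrow> 'a) \<Rightarrow> bool" where
  "is_generator T D A \<longleftrightarrow>
     D = {x. \<exists>y. ((\<lambda>h. (T h x - x) /\<^sub>R h) \<longlongrightarrow> y) (at_right 0)} \<and>
     (\<forall>x\<in>D. ((\<lambda>h. (T h x - x) /\<^sub>R h) \<longlongrightarrow> A x) (at_right 0))"

definition op_inverse :: "'a set \<Rightarrow> ('a \<Rightarrow> 'a) \<Rightarrow> 'a::complex_hilbert_space \<Rightarrow> 'a" where
  "op_inverse D A = inv_into D A"

definition resolvent ::
  "'a set \<Rightarrow> ('a \<Rightarrow> 'a) \<Rightarrow> complex \<Rightarrow> 'a::complex_hilbert_space \<Rightarrow> 'a" where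
  "resolvent D A z = op_inverse D (\<lambda>x. z *\<^sub>C x - A x)"

definition spectrum :: "'a set \<Rightarrow> ('a \<Rightarrow> 'a::complex_hilbert_space) \<Rightarrow> complex set" where
  "spectrum D A =
     - {z. bij_betw (\<lambda>x. z *\<^sub>C x - A x) D UNIV \<and> bounded_clinear (resolvent D A z)}"

text \<open>
  The right-continuous right-inverse of a function on \<open>[a, \<infinity>)\<close>; meaningful for
  \<open>t \<ge> F a\<close> only, since otherwise the supremum is over the empty set.
\<close>

definition right_inverse :: "real \<Rightarrow> (real \<Rightarrow> real) \<Rightarrow> real \<Rightarrow> real" where
  "right_inverse a F t = Sup {r. r \<ge> a \<and> F r \<le> t}"

text \<open>\<open>N\<^sup>-\<^sup>1(1)\<close>, with the convention that it is \<open>0\<close> if \<open>N 0 > 1\<close>.\<close>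

definition Ninv1 :: "(real \<Rightarrow> real) \<Rightarrow> real" where
  "Ninv1 N = (if N 0 > 1 then 0 else right_inverse 0 N 1)"

definition K_fun :: "(real \<Rightarrow> real) \<Rightarrow> real \<Rightarrow> real" where
  "K_fun N s = N s * (1 + 3 * ln (N s) / (2 * N s))"

definition M_K :: "(real \<Rightarrow> real) \<Rightarrow> (real \<Rightarrow> real) \<Rightarrow> real \<Rightarrow> real" where
  "M_K M N s = M s * K_fun N s"

definition M_N :: "(real \<Rightarrow> real) \<Rightarrow> (real \<Rightarrow> real) \<Rightarrow> real \<Rightarrow> real" where
  "M_N M N s = M s * N s"

definition quasi_positive_increase ::
  "(real \<Rightarrow> real) \<Rightarrow> (real \<Rightarrow> real) \<Rightarrow> real \<Rightarrow> real \<Rightarrow> bool" where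
  "quasi_positive_increase M N c s0 \<longleftrightarrow>
     0 < c \<and> c \<le> 1 \<and> s0 > 0 \<and>
     (\<forall>\<mu>\<ge>1. \<forall>s\<ge>s0. M (\<mu> * s) / M s \<ge> c * \<mu> powr (1 / N (\<mu> * s)))"

end

theory Submission
  imports Defs
begin

text \<open>
  Write \<open>B = A\<^sup>-\<^sup>1\<close> and \<open>y = B x\<close>, let \<open>K\<close> bound the semigroup, and fix a bandwidth \<open>R\<close>, a power \<open>n \<ge> 1\<close>
  and a damping \<open>\<alpha>\<close> of order \<open>1 / t\<close>. The weighted orbit \<open>G(r) = r\<^sup>n / n! e\<^sup>-\<^sup>\<alpha>\<^sup>r T(r) y\<close>, \<open>r \<ge> 0\<close>, has the
  Fourier transform \<open>(\<alpha> + i s - A)\<^sup>-\<^sup>n\<^sup>-\<^sup>1 y\<close>. It is smoothed by convolution with a kernel of bandwidth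
  \<open>R\<close>, and the smoothed orbit \<open>Z\<close> is compared with \<open>G\<close> near the time \<open>t\<close>.

  High frequencies. The orbit \<open>T(r) y\<close> has the bounded derivative \<open>T(r) x\<close>, so smoothing at the
  scale \<open>1 / R\<close> changes \<open>G\<close> near \<open>t\<close> by at most a constant times \<open>t\<^sup>n / n! \<parallel>x\<parallel> / R\<close>
  (\<open>norm_orbit_le_filtered\<close>). Since the weight grows like \<open>r\<^sup>n\<close> and \<open>n\<close> is not bounded, the kernel
  has to absorb polynomial growth of degree \<open>n\<close> uniformly in \<open>n\<close>. It is therefore a product of
  sinc functions whose number depends on \<open>n\<close> (\<open>cutoff_kernel_moment\<close>).

  Low frequencies. Only the resolvents with \<open>\<bar>s\<bar> \<le> R\<close> enter \<open>Z\<close>. A Plancherel inequality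
  (\<open>plancherel_bound\<close>) is used once to pass from the damped orbit of \<open>x\<close> to \<open>(\<alpha> + i s - A)\<^sup>-\<^sup>1 x\<close>
  and once to pass from \<open>(\<alpha> + i s - A)\<^sup>-\<^sup>n\<^sup>-\<^sup>1 y\<close> back to \<open>Z\<close>. This bounds the square mean of \<open>Z\<close> by
  the supremum over \<open>\<bar>s\<bar> \<le> R\<close> of \<open>\<parallel>(\<alpha> + i s - A)\<^sup>-\<^sup>n B\<parallel>\<close>
  (\<open>filtered_square_integral_le\<close>), and the Hilbert space structure enters only through the Plancherel
  inequality. One power of the resolvent combined with \<open>B\<close> gains a factor \<open>1 / \<bar>s\<bar>\<close>, so the supremum is
  controlled by \<open>M(s)\<^sup>n / s\<close>. For \<open>n \<ge> N(R)\<close>, quasi-positive increase shows that this is at most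
  \<open>(M(R) / c)\<^sup>n / R\<close>: the worst frequency is \<open>R\<close> itself.

  Together the two estimates give (\<open>decay_estimate\<close>)
  \<open>\<parallel>T(t) B\<parallel> \<le> C / R (1 + \<surd>n n! (M(R) / (c t))\<^sup>n)\<close>.
  If \<open>N\<close> is unbounded, take \<open>n = \<lceil>N(R)\<rceil>\<close>. By Stirling's formula the second term in the bracket is
  at most of order \<open>n\<^sup>3\<^sup>/\<^sup>2 (n M(R) / (c e t))\<^sup>n\<close>, and the summand \<open>3/2 log N\<close> in \<open>K\<close> compensates
  for the factor \<open>n\<^sup>3\<^sup>/\<^sup>2\<close> when \<open>M\<^sub>K(R) \<le> c e t\<close> (\<open>factorial_power_bound\<close>). If \<open>N\<close> is bounded, a fixed \<open>n\<close>
  works, and constant factors in front of \<open>t\<close> do not matter. The largest admissible \<open>R\<close> is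
  \<open>M\<^sub>K\<^sup>-\<^sup>1(c e t)\<close>. The estimate in terms of \<open>M\<^sub>N\<close> follows since \<open>K \<le> (1 + \<epsilon>) N\<close> far out when \<open>N\<close> is
  unbounded.
\<close>

section \<open>The complex Hilbert space as a real inner product space\<close>

lemma norm_scaleC: "norm (a *\<^sub>C x) = cmod a * norm x"
  for x :: "'a::complex_hilbert_space"
proof -
  have "complex_of_real ((norm (a *\<^sub>C x))\<^sup>2) = a * cinner x (a *\<^sub>C x)"
    by (metis cinner_self cinner_scaleC_left)
  also have "cinner x (a *\<^sub>C x) = cnj (a * cinner x x)"
    by (metis cinner_commute cinner_scaleC_left)
  also have "a * cnj (a * cinner x x) = complex_of_real ((cmod a * norm x)\<^sup>2)"
    using complex_norm_square[of a] by (simp add: cinner_self power_mult_distrib)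
  finally show ?thesis
    by (metis norm_ge_zero of_real_eq_iff power2_eq_imp_eq mult_nonneg_nonneg)
qed

lemma scaleR_scaleC_commute: "a *\<^sub>C (r *\<^sub>R x) = r *\<^sub>R (a *\<^sub>C x)"
  for x :: "'a::complex_hilbert_space"
  by (simp add: scaleC_of_real[symmetric] scaleC_scaleC mult.commute)

interpretation scaleC: bounded_bilinear "scaleC :: complex \<Rightarrow> 'a::complex_hilbert_space \<Rightarrow> 'a"
proof
  show "\<exists>K. \<forall>a (b::'a). norm (a *\<^sub>C b) \<le> norm a * norm b * K"
    by (rule exI[of _ 1]) (simp add: norm_scaleC)
qed (simp_all add: scaleC_add_left scaleC_add_right scaleR_scaleC_commute
       scaleC_scaleC[symmetric] scaleC_of_real scaleR_conv_of_real)

lemma scaleC_one [simp]: "1 *\<^sub>C x = x" for x :: "'a::complex_hilbert_space"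
  by (metis of_real_1 scaleC_of_real scaleR_one)

text \<open>
  Integrals of vector-valued functions commute with real bounded bilinear maps. The real part of
  the inner product is one, and it already determines the norm.
\<close>

definition rinner :: "'a::complex_hilbert_space \<Rightarrow> 'a \<Rightarrow> real" where
  "rinner x y = Re (cinner x y)"

lemma rinner_self: "rinner x x = (norm x)\<^sup>2"
  by (simp add: rinner_def cinner_self)

lemma rinner_commute: "rinner x y = rinner y x"
  unfolding rinner_def by (subst cinner_commute) simp

lemma rinner_add_left: "rinner (x + y) z = rinner x z + rinner y z"
  by (simp add: rinner_def cinner_add_left)

lemma rinner_scaleR_left: "rinner (r *\<^sub>R x) y = r * rinner x y"
  by (simp add: rinner_def scaleC_of_real[symmetric] cinner_scaleC_left)

text \<open>
  The Cauchy-Schwarz inequality is the triangle inequality for \<open>x + y\<close>, squared.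
\<close>

lemma rinner_le: "rinner x y \<le> norm x * norm y"
proof -
  have "(norm (x + y))\<^sup>2 = rinner (x + y) (x + y)"
    by (simp add: rinner_self)
  also have "\<dots> = (norm x)\<^sup>2 + 2 * rinner x y + (norm y)\<^sup>2"
    using rinner_add_left[of x y "x + y"] rinner_add_left[of x y x] rinner_add_left[of x y y]
      rinner_commute[of x "x + y"] rinner_commute[of y "x + y"] rinner_commute[of x y]
    by (simp add: rinner_self)
  finally have "(norm x)\<^sup>2 + 2 * rinner x y + (norm y)\<^sup>2 \<le> (norm x + norm y)\<^sup>2"
    by (metis norm_ge_zero norm_triangle_ineq power_mono)
  then show ?thesis by (simp add: power2_sum)
qed

lemma abs_rinner_le: "\<bar>rinner x y\<bar> \<le> norm x * norm y"
  using rinner_le[of x y] rinner_le[of "(-1) *\<^sub>R x" y] rinner_scaleR_left[of "-1" x y]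
  by simp

interpretation rinner: bounded_bilinear "rinner :: 'a::complex_hilbert_space \<Rightarrow> 'a \<Rightarrow> real"
proof
  show "\<exists>K. \<forall>a (b::'a). norm (rinner a b) \<le> norm a * norm b * K"
    by (rule exI[of _ 1]) (simp add: abs_rinner_le)
  show "rinner a (b + b') = rinner a b + rinner a b'" for a b b' :: 'a
    by (metis rinner_add_left rinner_commute)
  show "rinner a (r *\<^sub>R b) = r *\<^sub>R rinner a b" for a b :: 'a and r
    by (metis rinner_scaleR_left rinner_commute real_scaleR_def)
qed (simp_all add: rinner_add_left rinner_scaleR_left)

lemma rinner_scaleC_left: "rinner (a *\<^sub>C x) y = rinner x (cnj a *\<^sub>C y)"
  unfolding rinner_def
  by (subst (2) cinner_commute) (simp add: cinner_scaleC_left cinner_commute[of y x])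

section \<open>A Plancherel inequality on bounded intervals\<close>

lemma integral_bounded_linear:
  assumes "bounded_linear h" "f integrable_on S"
  shows "h (integral S f) = integral S (\<lambda>x. h (f x))"
  using integral_linear[OF assms(2,1)] by (simp add: o_def)

lemma integral_swap_real:
  fixes f :: "real \<Rightarrow> real \<Rightarrow> 'c::banach"
  assumes "continuous_on ({a..b} \<times> {c..d}) (\<lambda>(x,y). f x y)"
  shows "integral {a..b} (\<lambda>x. integral {c..d} (f x)) = integral {c..d} (\<lambda>y. integral {a..b} (\<lambda>x. f x y))"
  using integral_swap_continuous[of a c b d f] assms
  by (simp add: cbox_Pair_eq)

lemma continuous_on_integral_param:
  fixes f :: "real \<Rightarrow> real \<Rightarrow> 'c::banach"
  assumes "continuous_on (U \<times> {a..b}) (\<lambda>(x,y). f x y)"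
  shows "continuous_on U (\<lambda>x. integral {a..b} (f x))"
  using integral_continuous_on_param[of U a b f] assms by simp

lemma integral_rational_le:
  assumes c: "c > 0"
  shows "integral {a..b} (\<lambda>s. c / (1 + c\<^sup>2 * (s - x)\<^sup>2)) \<le> pi"
proof (cases "a \<le> b")
  case True
  have pos: "1 + (c * (s - x))\<^sup>2 > 0" for s
    by (smt (verit) zero_le_power2)
  have "((\<lambda>s. c / (1 + c\<^sup>2 * (s - x)\<^sup>2)) has_integral
      (arctan (c * (b - x)) - arctan (c * (a - x)))) {a..b}"
  proof (rule fundamental_theorem_of_calculus[OF True])
    fix s
    have "((\<lambda>s. arctan (c * (s - x))) has_real_derivative (c / (1 + c\<^sup>2 * (s - x)\<^sup>2))) (at s within {a..b})"
      by (rule derivative_eq_intros refl)+ (simp add: power_mult_distrib divide_inverse mult.commute)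
    then show "((\<lambda>s. arctan (c * (s - x))) has_vector_derivative (c / (1 + c\<^sup>2 * (s - x)\<^sup>2))) (at s within {a..b})"
      by (simp add: has_real_derivative_iff_has_vector_derivative)
  qed
  then have "integral {a..b} (\<lambda>s. c / (1 + c\<^sup>2 * (s - x)\<^sup>2)) = arctan (c * (b - x)) - arctan (c * (a - x))"
    by (rule integral_unique)
  also have "\<dots> \<le> pi"
    using arctan_bounded[of "c * (b - x)"] arctan_bounded[of "c * (a - x)"] by linarith
  finally show ?thesis .
qed simp

text \<open>
  The parabola is a majorant, up to a constant, of the indicator function of \<open>{-c/2..c/2}\<close>. Since it
  vanishes at \<open>-c\<close> and \<open>c\<close>, its transform decays quadratically, and the bound has an integral
  independent of \<open>c\<close>.
\<close>

lemma parabola_transform_bound: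
  assumes c: "c > 0"
  shows "cmod (integral {-c..c} (\<lambda>r. of_real (1 - r\<^sup>2 / c\<^sup>2) * cis (r * v)))
           \<le> 16 * c / (1 + c\<^sup>2 * v\<^sup>2)"
proof -
  let ?I = "integral {-c..c} (\<lambda>r. of_real (1 - r\<^sup>2 / c\<^sup>2) * cis (r * v))"
  have D: "1 + c\<^sup>2 * v\<^sup>2 > 0" by (smt (verit) mult_nonneg_nonneg zero_le_power2)
  show ?thesis
  proof (cases "\<bar>c * v\<bar> \<le> 1")
    case True
    have "cmod ?I \<le> integral {-c..c} (\<lambda>r. 1)"
    proof (rule integral_norm_bound_integral)
      show "(\<lambda>r. of_real (1 - r\<^sup>2 / c\<^sup>2) * cis (r * v)) integrable_on {-c..c}"
        by (intro integrable_continuous_interval continuous_intros) (use c in auto)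
      fix r assume "r \<in> {-c..c}"
      then have "r\<^sup>2 \<le> c\<^sup>2" using c by (auto simp: abs_le_square_iff[symmetric])
      then have "\<bar>1 - r\<^sup>2 / c\<^sup>2\<bar> \<le> 1" using c by (simp add: abs_if field_simps)
      then show "cmod (of_real (1 - r\<^sup>2 / c\<^sup>2) * cis (r * v)) \<le> 1"
        unfolding norm_mult norm_of_real by simp
    qed auto
    also have "\<dots> = 2 * c" using c by simp
    also have "\<dots> \<le> 16 * c / (1 + c\<^sup>2 * v\<^sup>2)"
    proof -
      have "(c * v)\<^sup>2 \<le> 1" using True by (simp add: abs_square_le_1)
      then have "2 * (1 + c\<^sup>2 * v\<^sup>2) \<le> 16" by (simp add: power_mult_distrib)
      then have "c * (2 * (1 + c\<^sup>2 * v\<^sup>2)) \<le> c * 16" using c by (intro mult_left_mono) auto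
      then show ?thesis using D by (simp add: pos_le_divide_eq mult_ac)
    qed
    finally show ?thesis .
  next
    case False
    then have v: "v \<noteq> 0" by auto
    define w where "w = \<i> * complex_of_real v"
    have w: "w \<noteq> 0" "cmod w = \<bar>v\<bar>" using v by (auto simp: w_def norm_mult)
    \<comment> \<open>Antiderivative of the parabola times \<open>exp (w z)\<close>, found by integrating by parts twice. At \<open>-c\<close> and \<open>c\<close> the term of order \<open>1 / w\<close> vanishes.\<close>
    define p k where "p = 1 / w" and "k = complex_of_real (1 / c\<^sup>2)"
    have wp: "w * p = 1" using w by (simp add: p_def)
    have cw: "cis (r * v) = exp (w * of_real r)" for r by (simp add: w_def cis_conv_exp mult_ac)
    define G where "G z = ((1 - z\<^sup>2 * k) * p + 2 * z * k * p\<^sup>2 - 2 * k * p ^ 3) * exp (w * z)" for z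
    have dG: "(G has_field_derivative (1 - z\<^sup>2 * k) * exp (w * z)) (at z)" for z
    proof -
      have "(G has_field_derivative (- (2 * z * k) * p + 2 * k * p\<^sup>2) * exp (w * z)
           + ((1 - z\<^sup>2 * k) * p + 2 * z * k * p\<^sup>2 - 2 * k * p ^ 3) * (w * exp (w * z))) (at z)"
        unfolding G_def by (rule derivative_eq_intros refl)+ (simp add: algebra_simps)
      also have "(- (2 * z * k) * p + 2 * k * p\<^sup>2) * exp (w * z)
           + ((1 - z\<^sup>2 * k) * p + 2 * z * k * p\<^sup>2 - 2 * k * p ^ 3) * (w * exp (w * z))
         = (1 - z\<^sup>2 * k) * exp (w * z)"
        using wp by algebra
      finally show ?thesis .
    qed
    have "((\<lambda>r. of_real (1 - r\<^sup>2 / c\<^sup>2) * cis (r * v)) has_integral (G (of_real c) - G (of_real (-c)))) {-c..c}"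
    proof (rule fundamental_theorem_of_calculus)
      show "- c \<le> c" using c by simp
      fix r
      show "((\<lambda>r. G (of_real r)) has_vector_derivative of_real (1 - r\<^sup>2 / c\<^sup>2) * cis (r * v)) (at r within {-c..c})"
        using has_vector_derivative_real_field[OF dG, of r "{-c..c}"]
        by (simp add: cw k_def)
    qed
    then have I: "?I = G (of_real c) - G (of_real (-c))" by (rule integral_unique)
    have Gb: "cmod (G (of_real r)) \<le> 4 / (c * v\<^sup>2)" if "r\<^sup>2 = c\<^sup>2" for r
    proof -
      have rc: "\<bar>r\<bar> = c" using that c by (metis abs_of_pos power2_eq_iff abs_minus)
      have 1: "1 - (of_real r)\<^sup>2 * k = 0"
        using that c by (simp add: k_def flip: of_real_power)
      have "cmod (G (of_real r)) = cmod (2 * of_real r * k * p\<^sup>2 - 2 * k * p ^ 3)"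
        unfolding G_def 1 norm_mult cw[symmetric] norm_cis by simp
      also have "\<dots> \<le> cmod (2 * of_real r * k * p\<^sup>2) + cmod (2 * k * p ^ 3)"
        by (rule norm_triangle_ineq4)
      also have "cmod (2 * of_real r * k * p\<^sup>2) = 2 / (c * v\<^sup>2)"
        unfolding norm_mult norm_power norm_divide norm_of_real norm_one norm_numeral p_def k_def w(2) rc
        using c v by (simp add: power2_eq_square divide_simps)
      also have "cmod (2 * k * p ^ 3) = 2 / (c * v\<^sup>2) * (1 / (c * \<bar>v\<bar>))"
        unfolding norm_mult norm_power norm_divide norm_of_real norm_one norm_numeral p_def k_def w(2)
        using c v by (simp add: power2_eq_square power3_eq_cube divide_simps)
      also have "\<dots> \<le> 2 / (c * v\<^sup>2) * 1"
      proof (rule mult_left_mono)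
        have "1 \<le> c * \<bar>v\<bar>" using False c by (simp add: abs_mult)
        then show "1 / (c * \<bar>v\<bar>) \<le> 1" by (simp add: divide_le_eq_1)
      qed (use c in auto)
      finally show ?thesis by (simp add: add_divide_distrib[symmetric])
    qed
    have "cmod ?I \<le> cmod (G (of_real c)) + cmod (G (of_real (-c)))"
      unfolding I by (rule norm_triangle_ineq4)
    also have "\<dots> \<le> 8 / (c * v\<^sup>2)" using Gb[of c] Gb[of "-c"] by simp
    also have "\<dots> \<le> 16 * c / (1 + c\<^sup>2 * v\<^sup>2)"
    proof -
      have "1 \<le> (c * v)\<^sup>2" using False abs_square_le_1[of "c * v"] by linarith
      then have 1: "1 \<le> c\<^sup>2 * v\<^sup>2" by (simp add: power_mult_distrib)
      have "8 * (1 + c\<^sup>2 * v\<^sup>2) \<le> 16 * c * (c * v\<^sup>2)"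
        using 1 by (simp add: power2_eq_square mult_ac)
      moreover have "c * v\<^sup>2 > 0" using c v by simp
      ultimately show ?thesis using D by (simp add: divide_simps mult_ac)
    qed
    finally show ?thesis .
  qed
qed

text \<open>
  An inequality with some constant is all that is used later, so no inversion theorem is involved.
  The square integral is bounded by one with a parabolic weight; expanding the square turns it into
  the quadratic form of a convolution kernel with uniformly bounded integral, to which Schur's
  test applies. Both the variable and its dual run through bounded intervals.
\<close>

lemma plancherel_bound:
  fixes F :: "real \<Rightarrow> 'a::complex_hilbert_space"
  assumes F: "continuous_on {a..b} F" and L: "L > 0"
  shows "integral {-L..L} (\<lambda>r. (norm (integral {a..b} (\<lambda>s. cis (s * r) *\<^sub>C F s)))\<^sup>2)
           \<le> 22 * pi * integral {a..b} (\<lambda>s. (norm (F s))\<^sup>2)"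
proof -
  define c where "c = 2 * L"
  have c: "c > 0" using L by (simp add: c_def)
  define g where "g r = integral {a..b} (\<lambda>s. cis (s * r) *\<^sub>C F s)" for r
  define k :: "real \<Rightarrow> real" where "k r = 1 - r\<^sup>2 / c\<^sup>2" for r
  define kb where "kb u = 16 * c / (1 + c\<^sup>2 * u\<^sup>2)" for u
  have D: "1 + c\<^sup>2 * v\<^sup>2 > 0" for v by (smt (verit) mult_nonneg_nonneg zero_le_power2)
  have kb16: "kb u * y / 2 = c / (1 + c\<^sup>2 * u\<^sup>2) * (8 * y)" for u y
  proof -
    have "kb u = 16 * (c / (1 + c\<^sup>2 * u\<^sup>2))" by (simp add: kb_def)
    then show ?thesis by (simp only: times_divide_eq_left[symmetric]) (simp only: mult.assoc mult.commute[of _ y], simp)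
  qed
  have kb0: "kb u \<ge> 0" for u unfolding kb_def using c D[of u] by simp
  have kb_sym: "kb (s - s') = kb (s' - s)" for s s' by (simp add: kb_def power2_commute)
  have kcont: "continuous_on S k" for S unfolding k_def by (intro continuous_intros) (use c in auto)
  have kbcont: "continuous_on S kb" for S unfolding kb_def
    by (intro continuous_intros) (metis D less_irrefl)
  have Fc: "continuous_on S (\<lambda>x. F (p x))" if "continuous_on S p" "p ` S \<subseteq> {a..b}"
    for S :: "'z::topological_space set" and p
    using continuous_on_compose2[OF F that] .
  have gcont: "continuous_on S g" for S
    unfolding g_def
    by (rule continuous_on_integral_param)
       (auto simp: case_prod_unfold intro!: continuous_intros Fc scaleC.continuous_on)
  have gc: "continuous_on S (\<lambda>x. g (p x))" if "continuous_on S p"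
    for S :: "'z::topological_space set" and p
    using continuous_on_compose2[OF gcont[of UNIV] that] by simp
  have kc: "continuous_on S (\<lambda>x. k (p x))" if "continuous_on S p"
    for S :: "'z::topological_space set" and p
    using continuous_on_compose2[OF kcont[of UNIV] that] by simp
  have kbc: "continuous_on S (\<lambda>x. kb (p x))" if "continuous_on S p"
    for S :: "'z::topological_space set" and p
    using continuous_on_compose2[OF kbcont[of UNIV] that] by simp
  note ci = continuous_intros Fc gc kc kbc rinner.continuous_on scaleC.continuous_on
  have k0: "k r \<ge> 0" if "r \<in> {-c..c}" for r
  proof -
    have "r\<^sup>2 \<le> c\<^sup>2" using c that by (auto simp: abs_le_square_iff[symmetric])
    then show ?thesis using c by (simp add: k_def)
  qed
  \<comment> \<open>The interval is doubled so that the weight is at least \<open>3/4\<close> on the original one.\<close>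
  have k34: "k r \<ge> 3/4" if "r \<in> {-L..L}" for r
  proof -
    have "r\<^sup>2 \<le> L\<^sup>2" using L that by (auto simp: abs_le_square_iff[symmetric])
    then show ?thesis using L by (simp add: k_def c_def power_mult_distrib field_simps)
  qed
  define H where "H s = integral {-c..c} (\<lambda>r. k r *\<^sub>R (cis (- (s * r)) *\<^sub>C g r))" for s
  define \<kappa> where "\<kappa> u = integral {-c..c} (\<lambda>r. of_real (k r) * cis (r * u))" for u
  have \<kappa>b: "cmod (\<kappa> u) \<le> kb u" for u
    unfolding \<kappa>_def k_def kb_def by (rule parabola_transform_bound[OF c])
  have \<kappa>cont: "continuous_on S \<kappa>" for S
    unfolding \<kappa>_def
    by (rule continuous_on_integral_param)
       (auto simp: case_prod_unfold intro!: ci)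
  have \<kappa>c: "continuous_on S (\<lambda>x. \<kappa> (p x))" if "continuous_on S p"
    for S :: "'z::topological_space set" and p
    using continuous_on_compose2[OF \<kappa>cont[of UNIV] that] by simp
  have Hcont: "continuous_on S H" for S
    unfolding H_def
    by (rule continuous_on_integral_param)
       (auto simp: case_prod_unfold intro!: ci)
  have Hk: "H s = integral {a..b} (\<lambda>s'. \<kappa> (s' - s) *\<^sub>C F s')" for s
  proof -
    have "H s = integral {-c..c} (\<lambda>r. integral {a..b} (\<lambda>s'. (of_real (k r) * cis (r * (s' - s))) *\<^sub>C F s'))"
      unfolding H_def
    proof (rule integral_cong)
      fix r assume "r \<in> {-c..c}"
      have "k r *\<^sub>R (cis (- (s * r)) *\<^sub>C g r) = (of_real (k r) * cis (-(s * r))) *\<^sub>C g r"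
        by (simp add: scaleC_of_real[symmetric] scaleC_scaleC)
      also have "\<dots> = integral {a..b} (\<lambda>s'. (of_real (k r) * cis (-(s * r))) *\<^sub>C (cis (s' * r) *\<^sub>C F s'))"
        unfolding g_def
        by (rule integral_bounded_linear[OF scaleC.bounded_linear_right])
           (auto intro!: integrable_continuous_interval ci)
      also have "\<dots> = integral {a..b} (\<lambda>s'. (of_real (k r) * cis (r * (s' - s))) *\<^sub>C F s')"
        by (simp add: scaleC_scaleC mult.assoc cis_mult algebra_simps)
      finally show "k r *\<^sub>R (cis (- (s * r)) *\<^sub>C g r) = \<dots>" .
    qed
    also have "\<dots> = integral {a..b} (\<lambda>s'. integral {-c..c} (\<lambda>r. (of_real (k r) * cis (r * (s' - s))) *\<^sub>C F s'))"
      by (rule integral_swap_real) (auto simp: case_prod_unfold intro!: ci)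
    also have "\<dots> = integral {a..b} (\<lambda>s'. \<kappa> (s' - s) *\<^sub>C F s')"
      unfolding \<kappa>_def
      by (intro integral_cong integral_bounded_linear[OF scaleC.bounded_linear_left, symmetric])
         (auto intro!: integrable_continuous_interval ci)
    finally show ?thesis .
  qed
  have Hb: "norm (H s) \<le> integral {a..b} (\<lambda>s'. kb (s' - s) * norm (F s'))" for s
    unfolding Hk
    by (rule integral_norm_bound_integral)
       (auto simp: norm_scaleC intro!: integrable_continuous_interval ci \<kappa>c mult_right_mono \<kappa>b)
  let ?u = "\<lambda>s s'. kb (s' - s) * (norm (F s))\<^sup>2 / 2" and ?v = "\<lambda>s s'. kb (s' - s) * (norm (F s'))\<^sup>2 / 2"
  let ?w = "\<lambda>s r. k r * rinner (F s) (cis (- (s * r)) *\<^sub>C g r)"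
  have "integral {-L..L} (\<lambda>r. (norm (g r))\<^sup>2) \<le> integral {-L..L} (\<lambda>r. 4/3 * (k r * (norm (g r))\<^sup>2))"
  proof (rule integral_le)
    fix r assume "r \<in> {-L..L}"
    then show "(norm (g r))\<^sup>2 \<le> 4/3 * (k r * (norm (g r))\<^sup>2)"
      using mult_right_mono[OF k34, of r "(norm (g r))\<^sup>2"] by simp
  qed (auto intro!: integrable_continuous_interval ci)
  also have "\<dots> \<le> integral {-c..c} (\<lambda>r. 4/3 * (k r * (norm (g r))\<^sup>2))"
    by (rule integral_subset_le) (use L in \<open>auto simp: c_def[symmetric] intro!: integrable_continuous_interval ci k0 mult_nonneg_nonneg, auto simp: c_def\<close>)
  also have "\<dots> = 4/3 * integral {-c..c} (\<lambda>r. k r * (norm (g r))\<^sup>2)"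
    by (rule integral_mult_right)
  also have "integral {-c..c} (\<lambda>r. k r * (norm (g r))\<^sup>2)
      = integral {-c..c} (\<lambda>r. integral {a..b} (\<lambda>s. ?w s r))"
  proof (rule integral_cong)
    fix r
    have "(norm (g r))\<^sup>2 = rinner (integral {a..b} (\<lambda>s. cis (s * r) *\<^sub>C F s)) (g r)"
      by (simp add: rinner_self g_def)
    also have "\<dots> = integral {a..b} (\<lambda>s. rinner (cis (s * r) *\<^sub>C F s) (g r))"
      by (rule integral_bounded_linear[OF rinner.bounded_linear_left])
         (auto intro!: integrable_continuous_interval ci)
    finally show "k r * (norm (g r))\<^sup>2 = integral {a..b} (\<lambda>s. ?w s r)"
      by (simp add: rinner_scaleC_left cis_cnj)
  qed
  also have "\<dots> = integral {a..b} (\<lambda>s. integral {-c..c} (\<lambda>r. ?w s r))"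
    by (rule integral_swap_real) (auto simp: case_prod_unfold intro!: ci)
  also have "\<dots> = integral {a..b} (\<lambda>s. rinner (F s) (H s))"
  proof (rule integral_cong)
    fix s
    have "rinner (F s) (H s) = integral {-c..c} (\<lambda>r. rinner (F s) (k r *\<^sub>R (cis (- (s * r)) *\<^sub>C g r)))"
      unfolding H_def
      by (rule integral_bounded_linear[OF rinner.bounded_linear_right])
         (auto intro!: integrable_continuous_interval ci)
    then show "integral {-c..c} (\<lambda>r. ?w s r) = rinner (F s) (H s)"
      by (simp add: rinner.scaleR_right)
  qed
  also have "\<dots> \<le> integral {a..b} (\<lambda>s. integral {a..b} (\<lambda>s'. ?u s s' + ?v s s'))"
  proof (rule integral_le)
    show "(\<lambda>s. rinner (F s) (H s)) integrable_on {a..b}"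
      by (auto intro!: integrable_continuous_interval ci Hcont)
    show "(\<lambda>s. integral {a..b} (\<lambda>s'. ?u s s' + ?v s s')) integrable_on {a..b}"
      by (rule integrable_continuous_interval, rule continuous_on_integral_param)
         (auto simp: case_prod_unfold intro!: ci)
    fix s assume s: "s \<in> {a..b}"
    have "rinner (F s) (H s) \<le> norm (F s) * integral {a..b} (\<lambda>s'. kb (s' - s) * norm (F s'))"
      using rinner_le[of "F s" "H s"] mult_left_mono[OF Hb[of s], of "norm (F s)"] by simp
    also have "\<dots> = integral {a..b} (\<lambda>s'. norm (F s) * (kb (s' - s) * norm (F s')))"
      by simp
    also have "\<dots> \<le> integral {a..b} (\<lambda>s'. ?u s s' + ?v s s')"
    proof (rule integral_le)
      \<comment> \<open>Schur's test: the product is split symmetrically into squares.\<close>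
      fix s'
      have "2 * (norm (F s) * norm (F s')) \<le> (norm (F s))\<^sup>2 + (norm (F s'))\<^sup>2"
        using sum_squares_bound[of "norm (F s)" "norm (F s')"] by simp
      from mult_left_mono[OF this kb0[of "s' - s"]]
      show "norm (F s) * (kb (s' - s) * norm (F s')) \<le> ?u s s' + ?v s s'"
        by (simp add: algebra_simps)
    qed (auto intro!: integrable_continuous_interval ci)
    finally show "rinner (F s) (H s) \<le> \<dots>" .
  qed
  also have "\<dots> = integral {a..b} (\<lambda>s. integral {a..b} (\<lambda>s'. ?u s s'))
      + integral {a..b} (\<lambda>s. integral {a..b} (\<lambda>s'. ?v s s'))"
  proof -
    have "integral {a..b} (\<lambda>s'. ?u s s' + ?v s s')
      = integral {a..b} (\<lambda>s'. ?u s s') + integral {a..b} (\<lambda>s'. ?v s s')" for s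
      by (rule integral_add) (auto intro!: integrable_continuous_interval ci)
    then show ?thesis
      by (simp only:, intro integral_add integrable_continuous_interval continuous_on_integral_param)
         (auto simp: case_prod_unfold intro!: ci)
  qed
  also have "integral {a..b} (\<lambda>s. integral {a..b} (\<lambda>s'. ?v s s'))
     = integral {a..b} (\<lambda>s'. integral {a..b} (\<lambda>s. ?v s s'))"
    by (rule integral_swap_real) (auto simp: case_prod_unfold intro!: ci)
  also have "\<dots> = integral {a..b} (\<lambda>s. integral {a..b} (\<lambda>s'. ?u s s'))"
    by (simp add: kb_sym)
  also have "integral {a..b} (\<lambda>s. integral {a..b} (\<lambda>s'. ?u s s'))
    \<le> integral {a..b} (\<lambda>s. 8 * pi * (norm (F s))\<^sup>2)"
  proof (rule integral_le)
    show "(\<lambda>s. integral {a..b} (\<lambda>s'. ?u s s')) integrable_on {a..b}"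
      by (rule integrable_continuous_interval, rule continuous_on_integral_param)
         (auto simp: case_prod_unfold intro!: ci)
    fix s
    have "integral {a..b} (\<lambda>s'. ?u s s')
       = integral {a..b} (\<lambda>s'. c / (1 + c\<^sup>2 * (s' - s)\<^sup>2)) * (8 * (norm (F s))\<^sup>2)"
      unfolding integral_mult_left[symmetric]
      by (rule integral_cong) (simp only: kb16)
    also have "\<dots> \<le> pi * (8 * (norm (F s))\<^sup>2)"
      by (intro mult_right_mono integral_rational_le c) auto
    finally show "integral {a..b} (\<lambda>s'. ?u s s') \<le> 8 * pi * (norm (F s))\<^sup>2"
      by (simp add: mult_ac)
  qed (auto intro!: integrable_continuous_interval ci)
  also have "integral {a..b} (\<lambda>s. 8 * pi * (norm (F s))\<^sup>2) = 8 * pi * integral {a..b} (\<lambda>s. (norm (F s))\<^sup>2)"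
    by (rule integral_mult_right)
  finally have "integral {-L..L} (\<lambda>r. (norm (g r))\<^sup>2) \<le> 4/3 * (16 * pi * integral {a..b} (\<lambda>s. (norm (F s))\<^sup>2))"
    by simp
  also have "\<dots> \<le> 22 * pi * integral {a..b} (\<lambda>s. (norm (F s))\<^sup>2)"
  proof -
    have "0 \<le> pi * integral {a..b} (\<lambda>s. (norm (F s))\<^sup>2)"
      by (intro mult_nonneg_nonneg integral_nonneg) (auto intro!: integrable_continuous_interval ci)
    then show ?thesis by linarith
  qed
  finally show ?thesis by (simp add: g_def)
qed

lemma plancherel_bound_conj:
  fixes F :: "real \<Rightarrow> 'a::complex_hilbert_space"
  assumes F: "continuous_on {a..b} F" and L: "L > 0"
  shows "integral {-L..L} (\<lambda>r. (norm (integral {a..b} (\<lambda>s. cis (- (s * r)) *\<^sub>C F s)))\<^sup>2)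
           \<le> 22 * pi * integral {a..b} (\<lambda>s. (norm (F s))\<^sup>2)"
  using plancherel_bound[OF assms]
    Henstock_Kurzweil_Integration.integral_reflect_real[of L "-L" "\<lambda>r. (norm (integral {a..b} (\<lambda>s. cis (s * r) *\<^sub>C F s)))\<^sup>2"]
  by simp

section \<open>Band-limited kernels with controlled moments\<close>

definition sinc :: "real \<Rightarrow> real" where
  "sinc x = (if x = 0 then 1 else sin x / x)"

lemma sinc_mult: "x * sinc x = sin x"
  by (simp add: sinc_def)

lemma abs_sinc_le_1: "\<bar>sinc x\<bar> \<le> 1"
  by (simp add: sinc_def divide_le_eq_1 abs_sin_x_le_abs_x)

lemma abs_sinc_le_inverse: "\<bar>x\<bar> * \<bar>sinc x\<bar> \<le> 1"
  by (simp add: abs_mult[symmetric] sinc_mult)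

lemma cos_ge: "cos x \<ge> 1 - x\<^sup>2 / 2" for x :: real
proof -
  have "cos x = 1 - 2 * (sin (x / 2))\<^sup>2"
    using cos_double_sin[of "x / 2"] by simp
  moreover have "(sin (x / 2))\<^sup>2 \<le> (x / 2)\<^sup>2"
    using abs_sin_x_le_abs_x[of "x / 2"] by (simp only: abs_le_square_iff)
  ultimately show ?thesis by (simp add: power_divide)
qed

lemma sinc_ge: "sinc x \<ge> 1 - x\<^sup>2 / 2" if "x \<ge> 0"
proof (cases "x = 0")
  case False
  then have x: "x > 0" using that by simp
  have "\<exists>z. 0 < z \<and> z < x \<and> sin x - sin 0 = (x - 0) * cos z"
    by (rule MVT2[OF x]) (auto intro!: derivative_eq_intros)
  then obtain z where z: "0 < z" "z < x" "sin x = x * cos z" by auto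
  have "z\<^sup>2 \<le> x\<^sup>2" using z by (intro power_mono) auto
  then have "1 - x\<^sup>2 / 2 \<le> cos z" using cos_ge[of z] by simp
  then show ?thesis using x z(3) by (simp add: sinc_def)
qed (simp add: sinc_def)

text \<open>
  A function \<open>\<phi>\<close> is band-limited if it is the Fourier transform of a continuous function \<open>\<psi>\<close>
  supported in \<open>{-\<rho>..\<rho>}\<close>. The normalisation \<open>\<bar>\<psi>\<bar> \<le> 1\<close> is part of the notion because the Plancherel
  argument loses the supremum of \<open>\<psi>\<close>.
\<close>

definition bandlimited :: "real \<Rightarrow> (real \<Rightarrow> real) \<Rightarrow> bool" where
  "bandlimited \<rho> \<phi> \<longleftrightarrow>
     (\<exists>\<psi>::real \<Rightarrow> real. continuous_on UNIV \<psi> \<and> (\<forall>s. \<bar>\<psi> s\<bar> \<le> 1) \<and> (\<forall>s. \<bar>s\<bar> \<ge> \<rho> \<longrightarrow> \<psi> s = 0) \<and>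
        (\<forall>r. integral {-\<rho>..\<rho>} (\<lambda>s. of_real (\<psi> s) * cis (s * r)) = of_real (\<phi> r)))"

text \<open>
  A triangle is the simplest continuous function from which averaging can start.
\<close>

lemma bandlimited_triangle:
  assumes \<delta>: "\<delta> > 0"
  shows "bandlimited (2 * \<delta>) (\<lambda>r. 2 * \<delta> * (sinc (\<delta> * r))\<^sup>2)"
proof -
  define c where "c = 2 * \<delta>"
  have c: "c > 0" using \<delta> by (simp add: c_def)
  define J where "J r = integral {0..c} (\<lambda>s. of_real (1 - s / c) * cis (s * r))" for r
  define \<psi> where "\<psi> s = max 0 (1 - \<bar>s\<bar> / c)" for s
  have cont: "continuous_on S \<psi>" for S
    unfolding \<psi>_def by (intro continuous_intros) (use c in auto)
  have tr: "integral {-c..c} (\<lambda>s. of_real (\<psi> s) * cis (s * r)) = J r + J (-r)" for r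
  proof -
    have "integral {-c..c} (\<lambda>s. of_real (\<psi> s) * cis (s * r))
      = integral {-c..0} (\<lambda>s. of_real (\<psi> s) * cis (s * r)) + integral {0..c} (\<lambda>s. of_real (\<psi> s) * cis (s * r))"
      by (rule Henstock_Kurzweil_Integration.integral_combine[symmetric])
         (use c in \<open>auto intro!: integrable_continuous_interval continuous_intros cont\<close>)
    also have "integral {0..c} (\<lambda>s. of_real (\<psi> s) * cis (s * r)) = J r"
      unfolding J_def by (rule integral_cong) (use c in \<open>auto simp: \<psi>_def\<close>)
    also have "integral {-c..0} (\<lambda>s. of_real (\<psi> s) * cis (s * r))
       = integral {0..c} (\<lambda>s. of_real (\<psi> (-s)) * cis ((-s) * r))"
      using Henstock_Kurzweil_Integration.integral_reflect_real[of c 0 "\<lambda>s. of_real (\<psi> (-s)) * cis ((-s) * r)"]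
      by simp
    also have "\<dots> = J (-r)"
      unfolding J_def by (rule integral_cong) (use c in \<open>auto simp: \<psi>_def\<close>)
    finally show ?thesis by simp
  qed
  have J0: "J 0 = of_real (c / 2)"
  proof -
    define k where "k = complex_of_real (1 / (2 * c))"
    have "((\<lambda>s. complex_of_real (1 - s / c)) has_integral ((of_real c - (of_real c)\<^sup>2 * k) - (of_real 0 - (of_real 0)\<^sup>2 * k))) {0..c}"
    proof (rule fundamental_theorem_of_calculus)
      fix s
      have "((\<lambda>z. z - z\<^sup>2 * k) has_field_derivative (1 - 2 * of_real s * k)) (at (complex_of_real s))"
        by (rule derivative_eq_intros refl)+ simp
      from has_vector_derivative_real_field[OF this, of "{0..c}"]
      show "((\<lambda>s. of_real s - (of_real s)\<^sup>2 * k) has_vector_derivative complex_of_real (1 - s / c)) (at s within {0..c})"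
        by (simp add: k_def)
    qed (use c in auto)
    from integral_unique[OF this] show ?thesis
      using c by (simp add: J_def k_def power2_eq_square)
  qed
  have Jr: "J r = (1 / (\<i> * of_real r))\<^sup>2 / of_real c * (cis (r * c) - 1) - 1 / (\<i> * of_real r)" if r: "r \<noteq> 0" for r
  proof -
    define w where "w = \<i> * complex_of_real r"
    define p k where "p = 1 / w" and "k = complex_of_real (1 / c)"
    have wp: "w * p = 1" using r by (simp add: p_def w_def)
    have cw: "cis (s * r) = exp (w * of_real s)" for s by (simp add: w_def cis_conv_exp mult_ac)
    define G where "G z = ((1 - z * k) * p + k * p\<^sup>2) * exp (w * z)" for z
    have dG: "(G has_field_derivative (1 - z * k) * exp (w * z)) (at z)" for z
    proof -
      have "(G has_field_derivative (- k * p) * exp (w * z) + ((1 - z * k) * p + k * p\<^sup>2) * (w * exp (w * z))) (at z)"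
        unfolding G_def by (rule derivative_eq_intros refl)+ (simp add: algebra_simps)
      also have "(- k * p) * exp (w * z) + ((1 - z * k) * p + k * p\<^sup>2) * (w * exp (w * z)) = (1 - z * k) * exp (w * z)"
        using wp by algebra
      finally show ?thesis .
    qed
    have "((\<lambda>s. of_real (1 - s / c) * cis (s * r)) has_integral (G (of_real c) - G (of_real 0))) {0..c}"
    proof (rule fundamental_theorem_of_calculus)
      fix s
      show "((\<lambda>s. G (of_real s)) has_vector_derivative of_real (1 - s / c) * cis (s * r)) (at s within {0..c})"
        using has_vector_derivative_real_field[OF dG, of s "{0..c}"]
        by (simp add: cw k_def)
    qed (use c in auto)
    then have "J r = G (of_real c) - G (of_real 0)" unfolding J_def by (rule integral_unique)
    also have "G (of_real 0) = p + k * p\<^sup>2" by (simp add: G_def)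
    also have "G (of_real c) = k * p\<^sup>2 * cis (r * c)"
      using c cw[of c] by (simp add: G_def k_def mult.commute)
    finally show ?thesis by (simp add: p_def k_def w_def algebra_simps diff_divide_distrib)
  qed
  have JJ: "J r + J (-r) = of_real (c * (sinc (\<delta> * r))\<^sup>2)" for r
  proof (cases "r = 0")
    case True
    then show ?thesis by (simp add: J0 sinc_def)
  next
    case False
    have "J r + J (-r) = - (1 / (of_real (r\<^sup>2) * of_real c)) * (cis (r * c) + cis (- (r * c)) - 2)"
      using False c by (simp add: Jr power_divide power_mult_distrib field_simps)
    also have "cis (r * c) + cis (- (r * c)) - 2 = of_real (- (4 * (sin (\<delta> * r))\<^sup>2))"
    proof -
      have "cos (r * c) = 1 - 2 * (sin (\<delta> * r))\<^sup>2"
        using cos_double_sin[of "\<delta> * r"] by (simp add: c_def mult_ac)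
      then show ?thesis by (simp add: complex_eq_iff)
    qed
    also have "- (1 / (of_real (r\<^sup>2) * of_real c)) * of_real (- (4 * (sin (\<delta> * r))\<^sup>2))
        = complex_of_real (4 * (sin (\<delta> * r))\<^sup>2 / (r\<^sup>2 * c))" by simp
    also have "4 * (sin (\<delta> * r))\<^sup>2 / (r\<^sup>2 * c) = c * (sinc (\<delta> * r))\<^sup>2"
      using False \<delta> by (simp add: sinc_def c_def power_divide power_mult_distrib power2_eq_square divide_simps)
    finally show ?thesis .
  qed
  show ?thesis
    unfolding bandlimited_def c_def[symmetric]
  proof (intro exI[of _ \<psi>] conjI allI impI cont)
    show "\<bar>\<psi> s\<bar> \<le> 1" for s using c by (simp add: \<psi>_def)
    show "\<psi> s = 0" if "c \<le> \<bar>s\<bar>" for s using c that by (simp add: \<psi>_def)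
    show "integral {- c..c} (\<lambda>s. of_real (\<psi> s) * cis (s * r)) = of_real (c * (sinc (\<delta> * r))\<^sup>2)" for r
      by (simp only: tr JJ)
  qed
qed

lemma integral_cis: "integral {-\<delta>..\<delta>} (\<lambda>u. cis (u * r)) = of_real (2 * \<delta> * sinc (\<delta> * r))"
  if \<delta>: "\<delta> > 0"
proof (cases "r = 0")
  case True
  then show ?thesis using \<delta> by (simp add: sinc_def scaleR_conv_of_real)
next
  case False
  define w where "w = \<i> * complex_of_real r"
  have w: "w \<noteq> 0" using False by (simp add: w_def)
  have cw: "cis (s * r) = exp (w * of_real s)" for s by (simp add: w_def cis_conv_exp mult_ac)
  have d: "((\<lambda>z. exp (w * z) / w) has_field_derivative exp (w * z)) (at z)" for z
    by (rule derivative_eq_intros refl)+ (use w in auto)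
  have "((\<lambda>u. cis (u * r)) has_integral (exp (w * of_real \<delta>) / w - exp (w * of_real (-\<delta>)) / w)) {-\<delta>..\<delta>}"
  proof (rule fundamental_theorem_of_calculus)
    show "((\<lambda>u. exp (w * of_real u) / w) has_vector_derivative cis (s * r)) (at s within {-\<delta>..\<delta>})" for s
      using has_vector_derivative_real_field[OF d, of s "{-\<delta>..\<delta>}"] by (simp add: cw)
  qed (use \<delta> in auto)
  then have "integral {-\<delta>..\<delta>} (\<lambda>u. cis (u * r)) = (cis (\<delta> * r) - cis (- (\<delta> * r))) / w"
    using cw[of \<delta>] cw[of "-\<delta>"] by (simp add: integral_unique diff_divide_distrib)
  also have "cis (\<delta> * r) - cis (- (\<delta> * r)) = \<i> * of_real (2 * sin (\<delta> * r))"
    by (simp add: complex_eq_iff)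
  also have "\<i> * of_real (2 * sin (\<delta> * r)) / w = of_real (2 * \<delta> * sinc (\<delta> * r))"
    using False \<delta> by (simp add: w_def sinc_def)
  finally show ?thesis .
qed

text \<open>
  Averaging \<open>\<psi>\<close> over intervals of length \<open>2 \<delta>\<close> keeps the bound \<open>1\<close>, enlarges the support by \<open>\<delta>\<close> and
  multiplies the transform by the transform of the normalised interval.
\<close>

lemma bandlimited_mult_sinc:
  assumes "bandlimited \<rho> \<phi>" and \<delta>: "\<delta> > 0" and \<rho>: "\<rho> \<ge> 0"
  shows "bandlimited (\<rho> + \<delta>) (\<lambda>r. \<phi> r * sinc (\<delta> * r))"
proof -
  from assms(1) obtain \<psi> where \<psi>: "continuous_on UNIV \<psi>" "\<And>s. \<bar>\<psi> s\<bar> \<le> 1" "\<And>s. \<bar>s\<bar> \<ge> \<rho> \<Longrightarrow> \<psi> s = 0"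
    and tr: "\<And>r. integral {-\<rho>..\<rho>} (\<lambda>s. of_real (\<psi> s) * cis (s * r)) = complex_of_real (\<phi> r)"
    unfolding bandlimited_def by blast
  have pc: "continuous_on S (\<lambda>x. \<psi> (p x))" if "continuous_on S p"
    for S :: "'z::topological_space set" and p
    using continuous_on_compose2[OF \<psi>(1) that] by simp
  note ci = continuous_intros pc
  define av where "av s = integral {-\<delta>..\<delta>} (\<lambda>u. \<psi> (s + u)) / (2 * \<delta>)" for s
  have avc: "continuous_on S av" for S
    unfolding av_def
    by (intro continuous_intros continuous_on_integral_param)
       (use \<delta> in \<open>auto simp: case_prod_unfold intro!: ci\<close>)
  show ?thesis
    unfolding bandlimited_def
  proof (intro exI[of _ av] conjI allI impI avc)
    fix s
    have "norm (integral {-\<delta>..\<delta>} (\<lambda>u. \<psi> (s + u))) \<le> integral {-\<delta>..\<delta>} (\<lambda>u. 1)"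
      by (rule integral_norm_bound_integral) (use \<psi>(2) in \<open>auto intro!: integrable_continuous_interval ci\<close>)
    then show "\<bar>av s\<bar> \<le> 1" using \<delta> by (simp add: av_def abs_divide)
    assume s: "\<rho> + \<delta> \<le> \<bar>s\<bar>"
    have "integral {-\<delta>..\<delta>} (\<lambda>u. \<psi> (s + u)) = integral {-\<delta>..\<delta>} (\<lambda>u. 0)"
      by (rule integral_cong) (use s \<psi>(3) in auto)
    then show "av s = 0" by (simp add: av_def)
  next
    fix r
    let ?b = "\<rho> + \<delta>"
    have sh: "integral {-?b..?b} (\<lambda>s. of_real (\<psi> (s + u)) * cis ((s + u) * r)) = of_real (\<phi> r)"
      if u: "u \<in> {-\<delta>..\<delta>}" for u
    proof -
      have "integral {-?b..?b} (\<lambda>s. of_real (\<psi> (s + u)) * cis ((s + u) * r))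
          = integral {-?b+u..?b+u} (\<lambda>s. of_real (\<psi> s) * cis (s * r))"
        using integral_shift_real_ivl[of "-?b+u" u "?b+u" "\<lambda>s. of_real (\<psi> s) * cis (s * r)"] by simp
      also have "((\<lambda>s. of_real (\<psi> s) * cis (s * r)) has_integral (of_real (\<phi> r))) {-?b+u..?b+u}"
      proof (rule has_integral_on_superset)
        show "((\<lambda>s. of_real (\<psi> s) * cis (s * r)) has_integral (of_real (\<phi> r))) {-\<rho>..\<rho>}"
          unfolding tr[symmetric]
          by (intro integrable_integral integrable_continuous_interval ci)
      qed (use u \<psi>(3) in auto)
      then have "integral {-?b+u..?b+u} (\<lambda>s. of_real (\<psi> s) * cis (s * r)) = of_real (\<phi> r)"
        by (rule integral_unique)
      finally show ?thesis .
    qed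
    have "integral {-?b..?b} (\<lambda>s. of_real (av s) * cis (s * r))
      = integral {-?b..?b} (\<lambda>s. (1 / of_real (2 * \<delta>)) * integral {-\<delta>..\<delta>} (\<lambda>u. of_real (\<psi> (s + u)) * cis (s * r)))"
    proof (rule integral_cong)
      fix s
      have "complex_of_real (integral {-\<delta>..\<delta>} (\<lambda>u. \<psi> (s + u))) = integral {-\<delta>..\<delta>} (\<lambda>u. of_real (\<psi> (s + u)))"
        by (rule integral_bounded_linear[OF bounded_linear_of_real])
           (intro integrable_continuous_interval ci)
      then show "of_real (av s) * cis (s * r) = (1 / of_real (2 * \<delta>)) * integral {-\<delta>..\<delta>} (\<lambda>u. of_real (\<psi> (s + u)) * cis (s * r))"
        by (simp add: av_def)
    qed
    also have "\<dots> = (1 / of_real (2 * \<delta>)) * integral {-?b..?b} (\<lambda>s. integral {-\<delta>..\<delta>} (\<lambda>u. of_real (\<psi> (s + u)) * cis (s * r)))"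
      by (rule integral_mult_right)
    also have "integral {-?b..?b} (\<lambda>s. integral {-\<delta>..\<delta>} (\<lambda>u. of_real (\<psi> (s + u)) * cis (s * r)))
      = integral {-\<delta>..\<delta>} (\<lambda>u. integral {-?b..?b} (\<lambda>s. of_real (\<psi> (s + u)) * cis (s * r)))"
      by (rule integral_swap_real) (auto simp: case_prod_unfold intro!: ci)
    also have "\<dots> = integral {-\<delta>..\<delta>} (\<lambda>u. of_real (\<phi> r) * cis (u * (-r)))"
    proof (rule integral_cong)
      fix u assume u: "u \<in> {-\<delta>..\<delta>}"
      have "integral {-?b..?b} (\<lambda>s. of_real (\<psi> (s + u)) * cis (s * r))
        = integral {-?b..?b} (\<lambda>s. of_real (\<psi> (s + u)) * cis ((s + u) * r) * cis (u * (-r)))"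
        unfolding mult.assoc cis_mult by (simp add: algebra_simps)
      also have "\<dots> = of_real (\<phi> r) * cis (u * (-r))"
        unfolding integral_mult_left by (simp only: sh[OF u])
      finally show "integral {-?b..?b} (\<lambda>s. of_real (\<psi> (s + u)) * cis (s * r)) = of_real (\<phi> r) * cis (u * (-r))" .
    qed
    also have "\<dots> = of_real (\<phi> r) * of_real (2 * \<delta> * sinc (\<delta> * (-r)))"
      unfolding integral_mult_right integral_cis[OF \<delta>] ..
    also have "sinc (\<delta> * (-r)) = sinc (\<delta> * r)" by (simp add: sinc_def)
    finally show "integral {-?b..?b} (\<lambda>s. of_real (av s) * cis (s * r)) = of_real (\<phi> r * sinc (\<delta> * r))"
      using \<delta> by simp
  qed
qed

lemma bandlimited_mult_sinc_power:
  assumes "bandlimited \<rho> \<phi>" and "\<delta> > 0" and "\<rho> \<ge> 0"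
  shows "bandlimited (\<rho> + real m * \<delta>) (\<lambda>r. \<phi> r * sinc (\<delta> * r) ^ m)"
proof (induction m)
  case (Suc m)
  have "bandlimited (\<rho> + real m * \<delta> + \<delta>) (\<lambda>r. \<phi> r * sinc (\<delta> * r) ^ m * sinc (\<delta> * r))"
    by (rule bandlimited_mult_sinc[OF Suc]) (use assms in auto)
  then show ?case by (simp add: algebra_simps)
qed (use assms in simp)

lemma bandlimited_mono:
  assumes "bandlimited \<rho> \<phi>" "\<rho> \<le> R"
  shows "bandlimited R \<phi>"
proof -
  from assms(1) obtain \<psi> where \<psi>: "continuous_on UNIV \<psi>" "\<And>s. \<bar>\<psi> s\<bar> \<le> 1" "\<And>s. \<bar>s\<bar> \<ge> \<rho> \<Longrightarrow> \<psi> s = 0"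
    and tr: "\<And>r. integral {-\<rho>..\<rho>} (\<lambda>s. of_real (\<psi> s) * cis (s * r)) = complex_of_real (\<phi> r)"
    unfolding bandlimited_def by blast
  have "((\<lambda>s. of_real (\<psi> s) * cis (s * r)) has_integral (complex_of_real (\<phi> r))) {-R..R}" for r
  proof (rule has_integral_on_superset)
    show "((\<lambda>s. of_real (\<psi> s) * cis (s * r)) has_integral (of_real (\<phi> r))) {-\<rho>..\<rho>}"
      unfolding tr[symmetric]
      by (intro integrable_integral integrable_continuous_interval continuous_intros continuous_on_subset[OF \<psi>(1)]) auto
  qed (use assms(2) \<psi>(3) in auto)
  then show ?thesis
    unfolding bandlimited_def
    using \<psi> assms(2) by (intro exI[of _ \<psi>]) (auto simp: integral_unique)
qed

text \<open>
  The fourth power makes the kernel and its first moment integrable at the scale \<open>1 / R\<close>. The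
  remaining \<open>2 n\<close> factors absorb growth of order \<open>n\<close>; each has bandwidth \<open>R / (8 n)\<close> only, so that
  together they use a bandwidth independent of \<open>n\<close>. The even exponents make the kernel
  non-negative.
\<close>

definition cutoff_kernel :: "real \<Rightarrow> nat \<Rightarrow> real \<Rightarrow> real" where
  "cutoff_kernel R n v = R / 4 * sinc (R * v / 8) ^ 4 * sinc (R * v / (8 * real n)) ^ (2 * n)"

lemma bandlimited_cutoff_kernel:
  assumes R: "R > 0" and n: "n \<ge> 1"
  shows "bandlimited R (cutoff_kernel R n)"
proof -
  \<comment> \<open>The widths add up to \<open>R / 4 + 2 (R / 8) + 2 n R / (8 n) = 3 R / 4\<close>.\<close>
  have 1: "bandlimited (2 * (R / 8) + real 2 * (R / 8))
      (\<lambda>r. 2 * (R / 8) * (sinc (R / 8 * r))\<^sup>2 * sinc (R / 8 * r) ^ 2)"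
    by (rule bandlimited_mult_sinc_power[OF bandlimited_triangle]) (use R in auto)
  have "bandlimited (2 * (R / 8) + real 2 * (R / 8) + real (2 * n) * (R / (8 * real n)))
      (\<lambda>r. 2 * (R / 8) * (sinc (R / 8 * r))\<^sup>2 * sinc (R / 8 * r) ^ 2 * sinc (R / (8 * real n) * r) ^ (2 * n))"
    by (rule bandlimited_mult_sinc_power[OF 1]) (use R n in auto)
  then have "bandlimited R (\<lambda>r. 2 * (R / 8) * (sinc (R / 8 * r))\<^sup>2 * sinc (R / 8 * r) ^ 2 * sinc (R / (8 * real n) * r) ^ (2 * n))"
    by (rule bandlimited_mono) (use R n in \<open>simp add: field_simps\<close>)
  also have "(\<lambda>r. 2 * (R / 8) * (sinc (R / 8 * r))\<^sup>2 * sinc (R / 8 * r) ^ 2 * sinc (R / (8 * real n) * r) ^ (2 * n)) = cutoff_kernel R n"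
    by (rule ext) (simp add: cutoff_kernel_def power_add[symmetric] mult.assoc flip: power_add)
  finally show ?thesis .
qed

lemma cutoff_kernel_nonneg: "R > 0 \<Longrightarrow> cutoff_kernel R n v \<ge> 0"
  unfolding cutoff_kernel_def by (intro mult_nonneg_nonneg) (auto simp: zero_le_even_power)

text \<open>
  The kernel has mass at least \<open>1 / 8\<close> on \<open>{0..1 / R}\<close>, independently of \<open>n\<close>. Together with its
  non-negativity this replaces a normalisation of its integral.
\<close>

lemma cutoff_kernel_ge:
  assumes R: "R > 0" and n: "n \<ge> 1" and v: "0 \<le> v" "v \<le> 1 / R"
  shows "cutoff_kernel R n v \<ge> R / 8"
proof -
  have Rv: "0 \<le> R * v" "R * v \<le> 1" using R v by (auto simp: field_simps)
  have s: "sinc x ^ k \<ge> 1 - real k * x\<^sup>2 / 2" if "0 \<le> x" "x \<le> 1" for x k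
  proof -
    have x2: "x\<^sup>2 \<le> 1" using that by (simp add: power_le_one)
    have "1 - real k * x\<^sup>2 / 2 = 1 + real k * (- x\<^sup>2 / 2)" by simp
    also have "\<dots> \<le> (1 + (- x\<^sup>2 / 2)) ^ k"
      by (rule Bernoulli_inequality) (use x2 in simp)
    also have "\<dots> \<le> sinc x ^ k"
      by (rule power_mono) (use sinc_ge[OF that(1)] x2 in simp_all)
    finally show ?thesis .
  qed
  have "(R * v / 8)\<^sup>2 \<le> (1/8)\<^sup>2" using Rv by (intro power_mono) auto
  moreover have "0 \<le> R * v / 8" "R * v / 8 \<le> 1" using Rv by auto
  ultimately have 1: "sinc (R * v / 8) ^ 4 \<ge> 3 / 4"
    using s[of "R * v / 8" 4] unfolding power2_eq_square[of "1/8"] by linarith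
  have x: "R * v / (8 * real n) \<le> 1 / (8 * real n)" using Rv n by (intro divide_right_mono) auto
  have "(R * v / (8 * real n))\<^sup>2 \<le> (1 / (8 * real n))\<^sup>2" using Rv x by (intro power_mono) auto
  then have "real (2 * n) * (R * v / (8 * real n))\<^sup>2 / 2 \<le> real (2 * n) * (1 / (8 * real n))\<^sup>2 / 2"
    by (intro divide_right_mono mult_left_mono) auto
  also have "\<dots> \<le> 1 / 4"
    using n by (simp add: power2_eq_square field_simps)
  finally have q: "real (2 * n) * (R * v / (8 * real n))\<^sup>2 / 2 \<le> 1 / 4" .
  have 2: "sinc (R * v / (8 * real n)) ^ (2 * n) \<ge> 3 / 4"
  proof -
    have "1 / (8 * real n) \<le> 1" using n by simp
    with x have "R * v / (8 * real n) \<le> 1" by linarith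
    moreover have "0 \<le> R * v / (8 * real n)" using Rv by (intro divide_nonneg_nonneg) auto
    ultimately show ?thesis using s[of "R * v / (8 * real n)" "2 * n"] q by linarith
  qed
  have "R / 4 * (3/4) * (3/4) \<le> cutoff_kernel R n v"
    unfolding cutoff_kernel_def using R 1 2 by (intro mult_mono mult_nonneg_nonneg) auto
  then show ?thesis using R by simp
qed

text \<open>
  With \<open>a = R v / (8 n)\<close> one has \<open>\<bar>sinc a\<bar> \<le> 1\<close> and \<open>\<bar>a\<bar> \<bar>sinc a\<bar> \<le> 1\<close>, hence
  \<open>\<bar>sinc a\<bar> (1 + \<bar>v\<bar> / \<tau>) \<le> 1 + 8 n / (R \<tau>)\<close> whatever the size of \<open>v\<close>. Taking \<open>n\<close>-th powers,
  \<open>n\<close> of the sinc factors absorb the polynomial at the cost of a factor that is bounded as long as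
  \<open>n\<^sup>2\<close> is at most of order \<open>R \<tau>\<close>.
\<close>

lemma cutoff_kernel_moment:
  assumes R: "R > 0" and n: "n \<ge> 1" and \<tau>: "\<tau> > 0"
  shows "cutoff_kernel R n v * (\<bar>v\<bar> * (1 + \<bar>v\<bar> / \<tau>) ^ n)
           \<le> exp (8 * (real n)\<^sup>2 / (R * \<tau>)) * (256 / (1 + R\<^sup>2 * v\<^sup>2))"
proof -
  define a where "a = R * v / (8 * real n)"
  define x where "x = R * \<bar>v\<bar>"
  have n0: "real n > 0" using n by simp
  have v: "\<bar>v\<bar> = \<bar>a\<bar> * (8 * real n / R)" using R n0 by (simp add: a_def abs_mult abs_divide)
  have 1: "\<bar>sinc a\<bar> * (1 + \<bar>v\<bar> / \<tau>) \<le> 1 + 8 * real n / (R * \<tau>)"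
  proof -
    have "\<bar>sinc a\<bar> * (1 + \<bar>v\<bar> / \<tau>) = \<bar>sinc a\<bar> + (\<bar>a\<bar> * \<bar>sinc a\<bar>) * (8 * real n / (R * \<tau>))"
      unfolding v by (simp add: field_simps)
    also have "\<dots> \<le> 1 + 1 * (8 * real n / (R * \<tau>))"
      by (intro add_mono mult_right_mono abs_sinc_le_1 abs_sinc_le_inverse) (use R \<tau> in simp)
    finally show ?thesis by simp
  qed
  have "sinc a ^ (2 * n) * (1 + \<bar>v\<bar> / \<tau>) ^ n \<le> \<bar>sinc a\<bar> ^ n * (1 + \<bar>v\<bar> / \<tau>) ^ n"
  proof (rule mult_right_mono)
    have "sinc a ^ (2 * n) = \<bar>sinc a\<bar> ^ n * \<bar>sinc a\<bar> ^ n"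
      by (metis mult_2 power_add power_even_abs even_mult_iff even_numeral)
    also have "\<dots> \<le> \<bar>sinc a\<bar> ^ n * 1"
      by (intro mult_left_mono power_le_one abs_sinc_le_1) auto
    finally show "sinc a ^ (2 * n) \<le> \<bar>sinc a\<bar> ^ n" by simp
  qed (use \<tau> in simp)
  also have "\<dots> = (\<bar>sinc a\<bar> * (1 + \<bar>v\<bar> / \<tau>)) ^ n" by (simp add: power_mult_distrib)
  also have "\<dots> \<le> (1 + 8 * real n / (R * \<tau>)) ^ n"
    by (rule power_mono[OF 1]) (use \<tau> in simp)
  also have "\<dots> \<le> exp (8 * real n / (R * \<tau>)) ^ n"
    by (rule power_mono[OF exp_ge_add_one_self]) (use R \<tau> in simp)
  also have "\<dots> = exp (8 * (real n)\<^sup>2 / (R * \<tau>))"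
    by (simp add: exp_of_nat_mult[symmetric] power2_eq_square mult_ac)
  finally have A: "sinc a ^ (2 * n) * (1 + \<bar>v\<bar> / \<tau>) ^ n \<le> exp (8 * (real n)\<^sup>2 / (R * \<tau>))" .
  have x0: "x \<ge> 0" using R by (simp add: x_def)
  have sx: "sinc (R * v / 8) ^ 4 = \<bar>sinc (R * v / 8)\<bar> ^ 4" by (simp add: power_even_abs)
  have B: "x * sinc (R * v / 8) ^ 4 \<le> 1024 / (1 + x\<^sup>2)"
  proof (cases "x \<le> 8")
    case True
    have "x * sinc (R * v / 8) ^ 4 \<le> x * 1"
      unfolding sx using x0 abs_sinc_le_1 by (intro mult_left_mono power_le_one) auto
    also have "x * 1 \<le> 1024 / (1 + x\<^sup>2)"
    proof -
      have "x\<^sup>2 \<le> 8\<^sup>2" using True x0 by (intro power_mono) auto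
      then have "x * (1 + x\<^sup>2) \<le> 8 * 65" using True x0 by (intro mult_mono) auto
      moreover have "1 + x\<^sup>2 > 0" by (smt (verit) zero_le_power2)
      ultimately show ?thesis by (simp add: pos_le_divide_eq)
    qed
    finally show ?thesis .
  next
    case False
    have "\<bar>R * v / 8\<bar> * \<bar>sinc (R * v / 8)\<bar> \<le> 1" by (rule abs_sinc_le_inverse)
    then have "x / 8 * \<bar>sinc (R * v / 8)\<bar> \<le> 1" using R by (simp add: x_def abs_mult)
    then have "\<bar>sinc (R * v / 8)\<bar> \<le> 8 / x" using False by (simp add: field_simps)
    then have "x * sinc (R * v / 8) ^ 4 \<le> x * (8 / x) ^ 4"
      unfolding sx using x0 by (intro mult_left_mono power_mono) auto
    also have "\<dots> \<le> 1024 / (1 + x\<^sup>2)"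
    proof -
      have "8 * x\<^sup>2 \<le> x * x\<^sup>2" using False by (intro mult_right_mono) auto
      moreover have "x\<^sup>2 \<ge> 8\<^sup>2" using False by (intro power_mono) auto
      ultimately have PQ: "4096 * (1 + x\<^sup>2) \<le> 1024 * (x * x\<^sup>2)" by simp
      have Q: "1 + x\<^sup>2 > 0" by (smt (verit) zero_le_power2)
      have P: "x * x\<^sup>2 > 0" using False by simp
      have "x * (8 / x) ^ 4 = 4096 / (x * x\<^sup>2)"
        using False by (simp add: power_divide power2_eq_square numeral_eq_Suc)
      also have "\<dots> \<le> 1024 / (1 + x\<^sup>2)"
      proof (rule mult_imp_div_pos_le[OF P])
        show "4096 \<le> 1024 / (1 + x\<^sup>2) * (x * x\<^sup>2)"
          using PQ by (simp only: times_divide_eq_left pos_le_divide_eq[OF Q])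
      qed
      finally show ?thesis .
    qed
    finally show ?thesis .
  qed
  have "cutoff_kernel R n v * (\<bar>v\<bar> * (1 + \<bar>v\<bar> / \<tau>) ^ n)
      = (sinc a ^ (2 * n) * (1 + \<bar>v\<bar> / \<tau>) ^ n) * (x * sinc (R * v / 8) ^ 4 / 4)"
    unfolding cutoff_kernel_def a_def x_def by simp
  also have "\<dots> \<le> exp (8 * (real n)\<^sup>2 / (R * \<tau>)) * (1024 / (1 + x\<^sup>2) / 4)"
    by (intro mult_mono A divide_right_mono B) (use x0 in \<open>auto simp: zero_le_even_power\<close>)
  also have "1024 / (1 + x\<^sup>2) / 4 = 256 / (1 + R\<^sup>2 * v\<^sup>2)"
  proof -
    have "1024 / q / 4 = 256 / q" for q :: real by simp
    then show ?thesis by (simp only: x_def power_mult_distrib power2_abs)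
  qed
  finally show ?thesis .
qed

section \<open>Bounded semigroups and powers of their resolvents\<close>

locale bounded_semigroup =
  fixes T :: "real \<Rightarrow> 'a::complex_hilbert_space \<Rightarrow> 'a" and D :: "'a set" and A :: "'a \<Rightarrow> 'a" and K :: real
  assumes T_clinear: "t \<ge> 0 \<Longrightarrow> bounded_clinear (T t)"
    and T_0: "T 0 x = x"
    and T_add: "s \<ge> 0 \<Longrightarrow> t \<ge> 0 \<Longrightarrow> T (s + t) x = T s (T t x)"
    and T_tendsto_0: "((\<lambda>t. T t x) \<longlongrightarrow> x) (at_right 0)"
    and generator: "is_generator T D A"
    and K_ge_1: "K \<ge> 1"
    and norm_T_le: "t \<ge> 0 \<Longrightarrow> norm (T t x) \<le> K * norm x"
begin

lemma T_bounded_linear: "t \<ge> 0 \<Longrightarrow> bounded_linear (T t)"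
  using T_clinear unfolding bounded_clinear_def by blast

lemma T_scaleC: "t \<ge> 0 \<Longrightarrow> T t (a *\<^sub>C x) = a *\<^sub>C T t x"
  using T_clinear unfolding bounded_clinear_def by blast

lemma T_plus: "t \<ge> 0 \<Longrightarrow> T t (x + y) = T t x + T t y"
  by (rule linear_add[OF bounded_linear.linear[OF T_bounded_linear]])

lemma T_diff: "t \<ge> 0 \<Longrightarrow> T t (x - y) = T t x - T t y"
  by (rule linear_diff[OF bounded_linear.linear[OF T_bounded_linear]])

lemma T_scaleR: "t \<ge> 0 \<Longrightarrow> T t (a *\<^sub>R x) = a *\<^sub>R T t x"
  by (rule linear_scale[OF bounded_linear.linear[OF T_bounded_linear]])

lemma K_pos: "K > 0" using K_ge_1 by simp

lemma norm_T_diff_le: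
  assumes "0 \<le> r" "r \<le> r'"
  shows "norm (T r' x - T r x) \<le> K * norm (T (r' - r) x - x)"
proof -
  have "T r' x - T r x = T r (T (r' - r) x - x)"
    using T_add[of r "r' - r" x] assms by (simp add: T_diff)
  then show ?thesis using norm_T_le[OF assms(1)] by simp
qed

lemma T_near_0:
  assumes "e > 0"
  obtains d where "d > 0" "\<And>h. 0 \<le> h \<Longrightarrow> h < d \<Longrightarrow> norm (T h x - x) \<le> e"
proof -
  have "eventually (\<lambda>h. dist (T h x) x < e) (at_right 0)"
    using T_tendsto_0[of x] assms by (rule tendstoD)
  then obtain d where d: "d > 0" "\<And>h. 0 < h \<Longrightarrow> h < d \<Longrightarrow> dist (T h x) x < e"
    unfolding eventually_at_right_field by auto
  show thesis
  proof (rule that[OF d(1)])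
    fix h :: real assume h: "0 \<le> h" "h < d"
    show "norm (T h x - x) \<le> e"
      using d(2)[of h] h assms by (cases "h = 0") (auto simp: T_0 dist_norm)
  qed
qed

lemma T_continuous: "continuous_on {0..} (\<lambda>r. T r x)"
  unfolding continuous_on_iff
proof (intro ballI allI impI)
  fix r e :: real assume r: "r \<in> {0..}" and e: "e > 0"
  have "e / (2 * K) > 0" using e K_pos by simp
  then obtain d where d: "d > 0" "\<And>h. 0 \<le> h \<Longrightarrow> h < d \<Longrightarrow> norm (T h x - x) \<le> e / (2 * K)"
    by (rule T_near_0[where x = x]) blast
  have "dist (T r' x) (T r x) < e" if r': "r' \<in> {0..}" "dist r' r < d" for r'
  proof -
    have "norm (T r' x - T r x) \<le> K * norm (T \<bar>r' - r\<bar> x - x)"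
      using norm_T_diff_le[of r r' x] norm_T_diff_le[of r' r x] r r'
      by (cases "r \<le> r'") (auto simp: norm_minus_commute)
    also have "\<dots> \<le> K * (e / (2 * K))"
      using d(2)[of "\<bar>r' - r\<bar>"] r' K_pos by (intro mult_left_mono) (auto simp: dist_real_def)
    also have "\<dots> < e" using K_pos e by simp
    finally show ?thesis by (simp add: dist_norm)
  qed
  with d(1) show "\<exists>d>0. \<forall>r'\<in>{0..}. dist r' r < d \<longrightarrow> dist (T r' x) (T r x) < e" by blast
qed

lemma T_continuous_compose:
  "continuous_on S (\<lambda>u. T (p u) x)" if "continuous_on S p" "\<And>u. u \<in> S \<Longrightarrow> p u \<ge> 0"
  using continuous_on_compose2[OF T_continuous that(1)] that(2) by auto

lemma in_domainI:
  assumes "((\<lambda>h. (T h x - x) /\<^sub>R h) \<longlongrightarrow> y) (at_right 0)"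
  shows "x \<in> D" "A x = y"
proof -
  show "x \<in> D" using generator assms unfolding is_generator_def by blast
  then have "((\<lambda>h. (T h x - x) /\<^sub>R h) \<longlongrightarrow> A x) (at_right 0)"
    using generator unfolding is_generator_def by blast
  then show "A x = y" using assms by (rule tendsto_unique[OF trivial_limit_at_right_real])
qed

lemma domain_tendsto:
  "x \<in> D \<Longrightarrow> ((\<lambda>h. (T h x - x) /\<^sub>R h) \<longlongrightarrow> A x) (at_right 0)"
  using generator unfolding is_generator_def by blast

lemma eventually_at_right_0_pos: "eventually (\<lambda>h::real. h > 0) (at_right 0)"
  by (simp add: eventually_at_right_less)

lemma domain_plus:
  assumes "x \<in> D" "y \<in> D" shows "x + y \<in> D" "A (x + y) = A x + A y"
proof -
  have "((\<lambda>h. (T h x - x) /\<^sub>R h + (T h y - y) /\<^sub>R h) \<longlongrightarrow> A x + A y) (at_right 0)"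
    by (intro tendsto_add domain_tendsto assms)
  moreover have "eventually (\<lambda>h. (T h x - x) /\<^sub>R h + (T h y - y) /\<^sub>R h = (T h (x + y) - (x + y)) /\<^sub>R h) (at_right 0)"
    using eventually_at_right_0_pos by eventually_elim (simp add: T_plus algebra_simps)
  ultimately have "((\<lambda>h. (T h (x + y) - (x + y)) /\<^sub>R h) \<longlongrightarrow> A x + A y) (at_right 0)"
    by (rule Lim_transform_eventually)
  from in_domainI[OF this] show "x + y \<in> D" "A (x + y) = A x + A y" by auto
qed

lemma domain_scaleC:
  assumes "x \<in> D" shows "a *\<^sub>C x \<in> D" "A (a *\<^sub>C x) = a *\<^sub>C A x"
proof -
  have "((\<lambda>h. a *\<^sub>C ((T h x - x) /\<^sub>R h)) \<longlongrightarrow> a *\<^sub>C A x) (at_right 0)"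
    by (intro scaleC.tendsto tendsto_const domain_tendsto assms)
  moreover have "eventually (\<lambda>h. a *\<^sub>C ((T h x - x) /\<^sub>R h) = (T h (a *\<^sub>C x) - a *\<^sub>C x) /\<^sub>R h) (at_right 0)"
    using eventually_at_right_0_pos
    by eventually_elim (simp add: T_scaleC scaleC.diff_right scaleC.scaleR_right scaleR_diff_right)
  ultimately have "((\<lambda>h. (T h (a *\<^sub>C x) - a *\<^sub>C x) /\<^sub>R h) \<longlongrightarrow> a *\<^sub>C A x) (at_right 0)"
    by (rule Lim_transform_eventually)
  from in_domainI[OF this] show "a *\<^sub>C x \<in> D" "A (a *\<^sub>C x) = a *\<^sub>C A x" by auto
qed

text \<open>
  The generator only provides a right derivative at \<open>0\<close>. For \<open>r' < r\<close> the difference quotient is the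
  image under \<open>T r'\<close> of one at \<open>0\<close>, and the operators \<open>T r'\<close> are uniformly bounded, so the left
  derivative exists as well.
\<close>

lemma T_has_vector_derivative:
  assumes y: "y \<in> D" and r: "r \<ge> 0"
  shows "((\<lambda>r. T r y) has_vector_derivative T r (A y)) (at r within {0..})"
  unfolding has_vector_derivative_def has_derivative_within_alt
proof (intro conjI allI impI)
  show "bounded_linear (\<lambda>x. x *\<^sub>R T r (A y))" by (rule bounded_linear_scaleR_left)
  fix e :: real assume e: "e > 0"
  define e' where "e' = e / (2 * K)"
  have e': "e' > 0" using e K_pos by (simp add: e'_def)
  have "eventually (\<lambda>h. dist ((T h y - y) /\<^sub>R h) (A y) < e') (at_right 0)"
    using domain_tendsto[OF y] e' by (rule tendstoD)
  then obtain d1 where d1: "d1 > 0" "\<And>h. 0 < h \<Longrightarrow> h < d1 \<Longrightarrow> dist ((T h y - y) /\<^sub>R h) (A y) < e'"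
    unfolding eventually_at_right_field by auto
  have q: "norm (T h y - y - h *\<^sub>R A y) \<le> e' * h" if h: "0 < h" "h < d1" for h
  proof -
    have "T h y - y - h *\<^sub>R A y = h *\<^sub>R ((T h y - y) /\<^sub>R h - A y)"
      using h by (simp add: scaleR_diff_right)
    then have "norm (T h y - y - h *\<^sub>R A y) = h * norm ((T h y - y) /\<^sub>R h - A y)"
      using h by simp
    also have "\<dots> \<le> h * e'" using d1(2)[OF h] h by (intro mult_left_mono) (auto simp: dist_norm)
    finally show ?thesis by (simp add: mult.commute)
  qed
  from e' obtain d2 where d2: "d2 > 0" "\<And>h. 0 \<le> h \<Longrightarrow> h < d2 \<Longrightarrow> norm (T h (A y) - A y) \<le> e'"
    by (rule T_near_0[where x = "A y"]) blast
  have Ke: "K * e' = e / 2" using K_pos by (simp add: e'_def)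
  have "norm (T r' y - T r y - (r' - r) *\<^sub>R T r (A y)) \<le> e * norm (r' - r)"
    if r': "r' \<in> {0..}" "norm (r' - r) < min d1 d2" for r'
  proof (cases "r' = r")
    case False
    show ?thesis
    proof (cases "r < r'")
      case True
      have "T r' y - T r y - (r' - r) *\<^sub>R T r (A y) = T r (T (r' - r) y - y - (r' - r) *\<^sub>R A y)"
        using T_add[of r "r' - r" y] r True by (simp add: T_diff T_scaleR)
      then have "norm (T r' y - T r y - (r' - r) *\<^sub>R T r (A y)) \<le> K * (e' * (r' - r))"
        using norm_T_le[OF r] mult_left_mono[OF q[of "r' - r"], of K] K_pos True r'
        by (smt (verit) real_norm_def)
      also have "\<dots> = e / 2 * (r' - r)" by (simp only: mult.assoc[symmetric] Ke)
      also have "\<dots> \<le> e * norm (r' - r)" using True e by simp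
      finally show ?thesis .
    next
      case f: False
      define h where "h = r - r'"
      have h: "0 < h" "h < d1" "h < d2" using False f r' by (auto simp: h_def)
      have r'0: "r' \<ge> 0" using r' by simp
      have "T r' y - T r y - (r' - r) *\<^sub>R T r (A y)
         = h *\<^sub>R (T r (A y) - T r' (A y)) - T r' (T h y - y - h *\<^sub>R A y)"
      proof -
        have "T r' (T h y - y - h *\<^sub>R A y) = T r y - T r' y - h *\<^sub>R T r' (A y)"
          using T_add[of r' h y] r'0 h by (simp add: h_def T_diff T_scaleR)
        moreover have "r' - r = - h" by (simp add: h_def)
        ultimately show ?thesis by (simp add: scaleR_diff_right)
      qed
      also have "norm \<dots> \<le> h * (K * e') + K * (e' * h)"
      proof (rule order_trans[OF norm_triangle_ineq4], rule add_mono)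
        have "norm (T r (A y) - T r' (A y)) \<le> K * norm (T h (A y) - A y)"
          using norm_T_diff_le[of r' r "A y"] r'0 h by (simp add: h_def)
        also have "\<dots> \<le> K * e'" using d2(2)[of h] h K_pos by (intro mult_left_mono) auto
        finally show "norm (h *\<^sub>R (T r (A y) - T r' (A y))) \<le> h * (K * e')"
          using h by (simp add: mult_left_mono)
        show "norm (T r' (T h y - y - h *\<^sub>R A y)) \<le> K * (e' * h)"
          using norm_T_le[OF r'0] mult_left_mono[OF q[OF h(1,2)], of K] K_pos by (smt (verit))
      qed
      also have "\<dots> = e * norm (r' - r)"
        using h Ke by (simp add: h_def[symmetric] mult.assoc[symmetric]) (simp add: h_def)
      finally show ?thesis .
    qed
  qed (simp add: T_0)
  moreover have "min d1 d2 > 0" using d1 d2 by simp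
  ultimately show "\<exists>d>0. \<forall>r'\<in>{0..}. norm (r' - r) < d \<longrightarrow>
      norm (T r' y - T r y - (r' - r) *\<^sub>R T r (A y)) \<le> e * norm (r' - r)" by blast
qed

definition expT :: "complex \<Rightarrow> 'a \<Rightarrow> real \<Rightarrow> 'a" where
  "expT z x r = exp (- (z * of_real r)) *\<^sub>C T r x"

lemma norm_expT_le: "r \<ge> 0 \<Longrightarrow> norm (expT z x r) \<le> exp (- (Re z * r)) * (K * norm x)"
  unfolding expT_def norm_scaleC by (intro mult_mono norm_T_le) auto

lemma expT_continuous:
  "continuous_on S (\<lambda>u. expT (f u) x (p u))" if "continuous_on S f" "continuous_on S p" "\<And>u. u \<in> S \<Longrightarrow> p u \<ge> 0"
  unfolding expT_def by (intro scaleC.continuous_on continuous_intros T_continuous_compose that)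

lemma expT_add: "r \<ge> 0 \<Longrightarrow> h \<ge> 0 \<Longrightarrow> expT z (expT z x r) h = expT z x (h + r)"
  by (simp add: expT_def T_scaleC scaleC_scaleC T_add exp_add[symmetric] algebra_simps)

lemma exp_has_vector_derivative:
  "((\<lambda>r. exp (z * complex_of_real r)) has_vector_derivative z * exp (z * of_real r)) (at r within S)"
  using exp_scaleR_has_vector_derivative_right[of z r S]
  by (simp only: scaleR_conv_of_real mult.commute[of _ z])

text \<open>
  The functions \<open>expT z u\<close> are the orbits of the semigroup generated by \<open>A - z\<close>.
\<close>

lemma expT_has_vector_derivative:
  assumes "u \<in> D" "r \<ge> 0"
  shows "((\<lambda>r. expT z u r) has_vector_derivative - expT z (z *\<^sub>C u - A u) r) (at r within {0..})"
proof -
  have "((\<lambda>r. expT z u r) has_vector_derivative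
      (exp (- (z * of_real r)) *\<^sub>C T r (A u) + (- z * exp (- (z * of_real r))) *\<^sub>C T r u)) (at r within {0..})"
    unfolding expT_def
    by (rule scaleC.has_vector_derivative[OF _ T_has_vector_derivative[OF assms]])
       (use exp_has_vector_derivative[of "-z" r "{0..}"] in simp)
  also have "exp (- (z * of_real r)) *\<^sub>C T r (A u) + (- z * exp (- (z * of_real r))) *\<^sub>C T r u = - expT z (z *\<^sub>C u - A u) r"
    using assms(2)
    by (simp add: expT_def T_diff T_scaleC scaleC.diff_right scaleC_scaleC scaleC.minus_left mult.commute)
  finally show ?thesis .
qed

definition Laplace :: "complex \<Rightarrow> 'a \<Rightarrow> real \<Rightarrow> 'a" where
  "Laplace z x L = integral {0..L} (expT z x)"

text \<open>
  The resolvent in the open right half-plane, as a Laplace transform. That it inverts \<open>z - A\<close> is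
  the content of \<open>Res_in_domain\<close> and \<open>Res_eqI\<close>.
\<close>

definition Res :: "complex \<Rightarrow> 'a \<Rightarrow> 'a" where
  "Res z x = lim (\<lambda>n. Laplace z x (real n))"

lemma expT_continuous_on: "0 \<le> a \<Longrightarrow> continuous_on {a..b} (expT z x)"
  using expT_continuous[of "{a..b}" "\<lambda>_. z" "\<lambda>r. r" x] by (auto intro: continuous_intros)

lemma expT_integrable: "0 \<le> a \<Longrightarrow> expT z x integrable_on {a..b}"
  by (intro integrable_continuous_interval expT_continuous_on)

lemma Laplace_diff_le:
  assumes z: "Re z > 0" and L: "0 \<le> L" "L \<le> L'"
  shows "norm (Laplace z x L' - Laplace z x L) \<le> K * norm x * exp (- (Re z * L)) / Re z"
proof -
  have "Laplace z x L + integral {L..L'} (expT z x) = Laplace z x L'"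
    unfolding Laplace_def
    by (rule Henstock_Kurzweil_Integration.integral_combine) (use L in \<open>auto intro!: expT_integrable\<close>)
  then have "Laplace z x L' - Laplace z x L = integral {L..L'} (expT z x)" by (simp add: algebra_simps)
  also have "norm \<dots> \<le> integral {L..L'} (\<lambda>r. exp (- (Re z * r)) * (K * norm x))"
    by (rule integral_norm_bound_integral)
       (use L norm_expT_le in \<open>auto intro!: expT_continuous_on integrable_continuous_interval continuous_intros\<close>)
  also have "\<dots> = (- exp (- (Re z * L')) / Re z * (K * norm x)) - (- exp (- (Re z * L)) / Re z * (K * norm x))"
  proof (rule integral_unique, rule fundamental_theorem_of_calculus[OF L(2)])
    fix r
    have "((\<lambda>r. - exp (- (Re z * r)) / Re z * (K * norm x)) has_real_derivative exp (- (Re z * r)) * (K * norm x)) (at r within {L..L'})"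
      by (rule derivative_eq_intros refl)+ (use z in auto)
    then show "((\<lambda>r. - exp (- (Re z * r)) / Re z * (K * norm x)) has_vector_derivative exp (- (Re z * r)) * (K * norm x)) (at r within {L..L'})"
      by (simp add: has_real_derivative_iff_has_vector_derivative)
  qed
  also have "\<dots> \<le> K * norm x * exp (- (Re z * L)) / Re z"
    using z K_pos by (simp add: field_simps)
  finally show ?thesis .
qed

lemma exp_decay: "\<alpha> > 0 \<Longrightarrow> ((\<lambda>L::real. c * exp (- (\<alpha> * L)) / d) \<longlongrightarrow> 0) at_top"
proof -
  assume a: "\<alpha> > 0"
  have "((\<lambda>L::real. exp (- (\<alpha> * L))) \<longlongrightarrow> 0) at_top"
    by (rule filterlim_compose[OF exp_at_bot])
       (use a in \<open>simp add: filterlim_uminus_at_top[symmetric] filterlim_uminus_at_bot filterlim_tendsto_pos_mult_at_top[OF tendsto_const _ filterlim_ident]\<close>)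
  then have "((\<lambda>L::real. c * exp (- (\<alpha> * L)) / d) \<longlongrightarrow> c * 0 / d) at_top"
    unfolding divide_inverse by (intro tendsto_mult_left tendsto_mult_right)
  then show ?thesis by simp
qed

lemma Laplace_LIMSEQ:
  assumes z: "Re z > 0"
  shows "(\<lambda>n. Laplace z x (real n)) \<longlonglongrightarrow> Res z x"
proof -
  have "Cauchy (\<lambda>n. Laplace z x (real n))"
    unfolding Cauchy_altdef2
  proof (intro allI impI)
    fix e :: real assume e: "e > 0"
    have "((\<lambda>n. K * norm x * exp (- (Re z * real n)) / Re z)) \<longlonglongrightarrow> 0"
      by (rule filterlim_compose[OF exp_decay[OF z] filterlim_real_sequentially])
    then have "eventually (\<lambda>n. K * norm x * exp (- (Re z * real n)) / Re z < e) sequentially"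
      using e by (rule order_tendstoD(2))
    then obtain N where N: "K * norm x * exp (- (Re z * real N)) / Re z < e"
      unfolding eventually_sequentially by blast
    show "\<exists>N. \<forall>n\<ge>N. dist (Laplace z x (real n)) (Laplace z x (real N)) < e"
    proof (intro exI allI impI)
      fix n assume "n \<ge> N"
      then show "dist (Laplace z x (real n)) (Laplace z x (real N)) < e"
        using Laplace_diff_le[OF z, of "real N" "real n" x] N by (simp add: dist_norm)
    qed
  qed
  then show ?thesis unfolding Res_def by (simp add: Cauchy_convergent_iff convergent_LIMSEQ_iff)
qed

lemma Res_Laplace_le:
  assumes z: "Re z > 0" and L: "0 \<le> L"
  shows "norm (Res z x - Laplace z x L) \<le> K * norm x * exp (- (Re z * L)) / Re z"
proof (rule tendsto_upperbound)
  show "(\<lambda>n. norm (Laplace z x (real n) - Laplace z x L)) \<longlonglongrightarrow> norm (Res z x - Laplace z x L)"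
    by (intro tendsto_intros Laplace_LIMSEQ z)
  show "eventually (\<lambda>n. norm (Laplace z x (real n) - Laplace z x L) \<le> K * norm x * exp (- (Re z * L)) / Re z) sequentially"
    using eventually_ge_at_top[of "nat \<lceil>L\<rceil>"]
    by eventually_elim (use L in \<open>auto intro!: Laplace_diff_le z simp: nat_le_iff ceiling_le_iff\<close>)
qed simp

lemma Laplace_tendsto:
  assumes z: "Re z > 0"
  shows "((\<lambda>L. Laplace z x L) \<longlongrightarrow> Res z x) at_top"
proof (rule Lim_transform2[OF tendsto_const])
  show "((\<lambda>L. Res z x - Laplace z x L) \<longlongrightarrow> 0) at_top"
  proof (rule Lim_null_comparison)
    show "((\<lambda>L. K * norm x * exp (- (Re z * L)) / Re z) \<longlongrightarrow> 0) at_top" by (rule exp_decay[OF z])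
    show "eventually (\<lambda>L. norm (Res z x - Laplace z x L) \<le> K * norm x * exp (- (Re z * L)) / Re z) at_top"
      using eventually_ge_at_top[of 0] by eventually_elim (rule Res_Laplace_le[OF z])
  qed
qed

lemma norm_Res_le: "Re z > 0 \<Longrightarrow> norm (Res z x) \<le> K / Re z * norm x"
  using Res_Laplace_le[of z 0 x] by (simp add: Laplace_def)

text \<open>
  Translating the Laplace integral by \<open>h\<close> removes its part over \<open>{0..h}\<close>. Differentiating the result
  at \<open>h = 0\<close> shows that the Laplace transform belongs to the domain of the generator.
\<close>

lemma T_Res:
  assumes z: "Re z > 0" and h: "h \<ge> 0"
  shows "T h (Res z x) = exp (z * of_real h) *\<^sub>C (Res z x - Laplace z x h)"
proof -
  have bl: "bounded_linear (\<lambda>y. expT z y h)"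
    unfolding expT_def
    by (rule bounded_linear_compose[OF scaleC.bounded_linear_right T_bounded_linear[OF h]])
  have 1: "expT z (Laplace z x L) h = Laplace z x (L + h) - Laplace z x h" if L: "L \<ge> 0" for L
  proof -
    have "expT z (Laplace z x L) h = integral {0..L} (\<lambda>r. expT z (expT z x r) h)"
      unfolding Laplace_def by (rule integral_bounded_linear[OF bl expT_integrable]) simp
    also have "\<dots> = integral {0..L} (\<lambda>r. expT z x (r + h))"
      by (rule integral_cong) (use h in \<open>auto simp: expT_add add.commute\<close>)
    also have "\<dots> = integral {h..L+h} (expT z x)"
      using integral_shift_real_ivl[of h h "L + h" "expT z x"] by simp
    also have "\<dots> = Laplace z x (L + h) - Laplace z x h"
      unfolding Laplace_def
      using Henstock_Kurzweil_Integration.integral_combine[of 0 h "L + h" "expT z x"] h L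
      by (simp add: expT_integrable algebra_simps)
    finally show ?thesis .
  qed
  have "((\<lambda>L. expT z (Laplace z x L) h) \<longlongrightarrow> expT z (Res z x) h) at_top"
    by (rule bounded_linear.tendsto[OF bl Laplace_tendsto[OF z]])
  moreover have "eventually (\<lambda>L. expT z (Laplace z x L) h = Laplace z x (L + h) - Laplace z x h) at_top"
    using eventually_ge_at_top[of 0] by eventually_elim (rule 1)
  ultimately have "((\<lambda>L. Laplace z x (L + h) - Laplace z x h) \<longlongrightarrow> expT z (Res z x) h) at_top"
    by (rule Lim_transform_eventually)
  moreover have "((\<lambda>L. Laplace z x (L + h) - Laplace z x h) \<longlongrightarrow> Res z x - Laplace z x h) at_top"
  proof (intro tendsto_diff tendsto_const filterlim_compose[OF Laplace_tendsto[OF z]])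
    show "filterlim (\<lambda>L. L + h) at_top at_top"
      using filterlim_tendsto_add_at_top[OF tendsto_const filterlim_ident, of h] by (simp add: add.commute)
  qed
  ultimately have "expT z (Res z x) h = Res z x - Laplace z x h"
    by (rule tendsto_unique[OF trivial_limit_at_top_linorder])
  then have "exp (z * of_real h) *\<^sub>C expT z (Res z x) h = exp (z * of_real h) *\<^sub>C (Res z x - Laplace z x h)"
    by simp
  then show ?thesis by (simp add: expT_def scaleC_scaleC exp_add[symmetric])
qed

lemma Res_in_domain:
  assumes z: "Re z > 0"
  shows "Res z x \<in> D" "A (Res z x) = z *\<^sub>C Res z x - x"
proof -
  define J where "J h = exp (z * of_real h) *\<^sub>C (Res z x - Laplace z x h)" for h :: real
  have "(Laplace z x has_vector_derivative expT z x 0) (at 0 within {0..1})"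
    unfolding Laplace_def
    by (rule integral_has_vector_derivative)
       (auto intro!: expT_continuous_on)
  then have "((\<lambda>h. Res z x - Laplace z x h) has_vector_derivative (0 - expT z x 0)) (at 0 within {0..1})"
    by (intro has_vector_derivative_diff has_vector_derivative_const)
  from scaleC.has_vector_derivative[OF exp_has_vector_derivative[of z] this]
  have "(J has_vector_derivative (z *\<^sub>C Res z x - x)) (at 0 within {0..1})"
    unfolding J_def by (simp add: expT_def T_0 Laplace_def)
  then have "((\<lambda>h. (1 / norm (h - 0)) *\<^sub>R (J h - (J 0 + (h - 0) *\<^sub>R (z *\<^sub>C Res z x - x)))) \<longlongrightarrow> 0) (at 0 within {0..1})"
    unfolding has_vector_derivative_def has_derivative_within by simp
  then have l: "((\<lambda>h. (1 / norm (h - 0)) *\<^sub>R (J h - (J 0 + (h - 0) *\<^sub>R (z *\<^sub>C Res z x - x)))) \<longlongrightarrow> 0) (at_right 0)"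
    by (simp add: at_within_Icc_at_right)
  have "((\<lambda>h. (T h (Res z x) - Res z x) /\<^sub>R h - (z *\<^sub>C Res z x - x)) \<longlongrightarrow> 0) (at_right 0)"
  proof (rule Lim_transform_eventually[OF l])
    show "eventually (\<lambda>h. (1 / norm (h - 0)) *\<^sub>R (J h - (J 0 + (h - 0) *\<^sub>R (z *\<^sub>C Res z x - x))) =
        (T h (Res z x) - Res z x) /\<^sub>R h - (z *\<^sub>C Res z x - x)) (at_right 0)"
      using eventually_at_right_0_pos
    proof eventually_elim
      case (elim h)
      have "J h = T h (Res z x)" using T_Res[OF z, of h x] elim by (simp add: J_def)
      moreover have "J 0 = Res z x" by (simp add: J_def Laplace_def)
      ultimately show ?case using elim by (simp add: algebra_simps divide_inverse_commute)
    qed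
  qed
  then have "((\<lambda>h. (T h (Res z x) - Res z x) /\<^sub>R h) \<longlongrightarrow> z *\<^sub>C Res z x - x) (at_right 0)"
    by (simp add: LIM_zero_iff)
  from in_domainI[OF this] show "Res z x \<in> D" "A (Res z x) = z *\<^sub>C Res z x - x" by auto
qed

text \<open>
  The integrand of the Laplace transform of \<open>z u - A u\<close> is the derivative of \<open>- expT z u\<close>.
\<close>

lemma Res_eqI:
  assumes z: "Re z > 0" and u: "u \<in> D"
  shows "Res z (z *\<^sub>C u - A u) = u"
proof -
  have 1: "Laplace z (z *\<^sub>C u - A u) L = u - expT z u L" if L: "L \<ge> 0" for L
  proof -
    have "((\<lambda>r. - expT z (z *\<^sub>C u - A u) r) has_integral (expT z u L - expT z u 0)) {0..L}"
      by (rule fundamental_theorem_of_calculus[OF L])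
         (auto intro!: has_vector_derivative_within_subset[OF expT_has_vector_derivative[OF u]])
    from has_integral_neg[OF this]
    show ?thesis unfolding Laplace_def by (simp add: integral_unique) (simp add: expT_def T_0)
  qed
  have "((\<lambda>L. expT z u L) \<longlongrightarrow> 0) at_top"
  proof (rule Lim_null_comparison)
    show "((\<lambda>L. (K * norm u) * exp (- (Re z * L)) / 1) \<longlongrightarrow> 0) at_top" by (rule exp_decay[OF z])
    show "eventually (\<lambda>L. norm (expT z u L) \<le> (K * norm u) * exp (- (Re z * L)) / 1) at_top"
      using eventually_ge_at_top[of 0] by eventually_elim (use norm_expT_le in \<open>simp add: mult.commute\<close>)
  qed
  then have "((\<lambda>L. u - expT z u L) \<longlongrightarrow> u - 0) at_top" by (intro tendsto_intros)
  moreover have "eventually (\<lambda>L. u - expT z u L = Laplace z (z *\<^sub>C u - A u) L) at_top"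
    using eventually_ge_at_top[of 0] by eventually_elim (simp add: 1)
  ultimately have "((\<lambda>L. Laplace z (z *\<^sub>C u - A u) L) \<longlongrightarrow> u - 0) at_top"
    by (rule Lim_transform_eventually)
  from tendsto_unique[OF trivial_limit_at_top_linorder Laplace_tendsto[OF z] this]
  show ?thesis by simp
qed

lemma Res_plus: "Re z > 0 \<Longrightarrow> Res z (x + y) = Res z x + Res z y"
  using Res_eqI[of z "Res z x + Res z y"] domain_plus[OF Res_in_domain(1) Res_in_domain(1), of z z x y]
  by (simp add: Res_in_domain scaleC_add_right add.commute)

lemma Res_scaleC: "Re z > 0 \<Longrightarrow> Res z (a *\<^sub>C x) = a *\<^sub>C Res z x"
  using Res_eqI[of z "a *\<^sub>C Res z x"] domain_scaleC[OF Res_in_domain(1), of z a x]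
  by (simp add: Res_in_domain scaleC.diff_right scaleC_scaleC mult.commute)

lemma Res_diff: "Re z > 0 \<Longrightarrow> Res z (x - y) = Res z x - Res z y"
  using Res_plus[of z x "(-1) *\<^sub>C y"] Res_scaleC[of z "-1" y] by (simp add: scaleC.minus_left)

lemma resolvent_identity:
  assumes "Re z > 0" "Re w > 0"
  shows "Res w x = (z - w) *\<^sub>C Res z (Res w x) + Res z x"
proof -
  have "z *\<^sub>C Res w x - A (Res w x) = (z - w) *\<^sub>C Res w x + x"
    by (simp add: Res_in_domain assms scaleC.diff_left)
  then have "Res w x = Res z ((z - w) *\<^sub>C Res w x + x)"
    using Res_eqI[OF assms(1) Res_in_domain(1)[OF assms(2)]] by metis
  then show ?thesis by (simp add: Res_plus Res_scaleC assms)
qed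

lemma Res_continuous:
  assumes \<alpha>: "\<alpha> > 0" and f: "continuous_on S f"
  shows "continuous_on S (\<lambda>s. Res (Complex \<alpha> s) (f s))"
  unfolding continuous_on_def
proof
  fix s0 assume s0: "s0 \<in> S"
  have f0: "(f \<longlongrightarrow> f s0) (at s0 within S)" using f s0 by (simp add: continuous_on_def)
  define g where "g s = K / \<alpha> * norm (f s - f s0) + \<bar>s - s0\<bar> * (K / \<alpha> * norm (Res (Complex \<alpha> s0) (f s0)))" for s
  have "((\<lambda>s. Res (Complex \<alpha> s) (f s) - Res (Complex \<alpha> s0) (f s0)) \<longlongrightarrow> 0) (at s0 within S)"
  proof (rule Lim_null_comparison)
    have "(g \<longlongrightarrow> K / \<alpha> * norm (f s0 - f s0) + \<bar>s0 - s0\<bar> * (K / \<alpha> * norm (Res (Complex \<alpha> s0) (f s0)))) (at s0 within S)"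
      unfolding g_def by (intro tendsto_intros f0)
    then show "(g \<longlongrightarrow> 0) (at s0 within S)" by simp
    have "norm (Res (Complex \<alpha> s) (f s) - Res (Complex \<alpha> s0) (f s0)) \<le> g s" for s
    proof -
      let ?z = "Complex \<alpha> s" and ?w = "Complex \<alpha> s0"
      have zw: "Re ?z > 0" "Re ?w > 0" using \<alpha> by auto
      have "Res ?z (f s) - Res ?w (f s0) = Res ?z (f s - f s0) - (?z - ?w) *\<^sub>C Res ?z (Res ?w (f s0))"
      proof -
        have "Res ?z (f s0) = Res ?w (f s0) - (?z - ?w) *\<^sub>C Res ?z (Res ?w (f s0))"
          using resolvent_identity[OF zw, of "f s0"] by (metis add_diff_cancel_left')
        then show ?thesis unfolding Res_diff[OF zw(1)] by simp
      qed
      also have "norm \<dots> \<le> K / \<alpha> * norm (f s - f s0) + \<bar>s - s0\<bar> * (K / \<alpha> * norm (Res ?w (f s0)))"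
      proof (rule order_trans[OF norm_triangle_ineq4], rule add_mono)
        show "norm (Res ?z (f s - f s0)) \<le> K / \<alpha> * norm (f s - f s0)"
          using norm_Res_le[OF zw(1)] by simp
        have "cmod (?z - ?w) = \<bar>s - s0\<bar>" by (simp add: cmod_def)
        then show "norm ((?z - ?w) *\<^sub>C Res ?z (Res ?w (f s0))) \<le> \<bar>s - s0\<bar> * (K / \<alpha> * norm (Res ?w (f s0)))"
          unfolding norm_scaleC using norm_Res_le[OF zw(1), of "Res ?w (f s0)"]
          by (simp only: complex.sel) (rule mult_left_mono, auto)
      qed
      finally show ?thesis by (simp add: g_def)
    qed
    then show "eventually (\<lambda>s. norm (Res (Complex \<alpha> s) (f s) - Res (Complex \<alpha> s0) (f s0)) \<le> g s) (at s0 within S)"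
      by simp
  qed
  then show "((\<lambda>s. Res (Complex \<alpha> s) (f s)) \<longlongrightarrow> Res (Complex \<alpha> s0) (f s0)) (at s0 within S)"
    by (simp add: LIM_zero_iff)
qed

lemma Res_power_continuous:
  assumes "\<alpha> > 0" "continuous_on S f"
  shows "continuous_on S (\<lambda>s. (Res (Complex \<alpha> s) ^^ n) (f s))"
  by (induction n) (use assms in \<open>auto intro: Res_continuous\<close>)

text \<open>
  The integral of \<open>r ^ n / fact n *\<^sub>R expT z x r\<close> over the half-line beyond \<open>L\<close> is \<open>tail z n x L\<close>. It is
  given by the formula that integration by parts produces, in which only resolvents of \<open>x\<close> occur, so
  that the following identities are consequences of the fundamental theorem of calculus.
\<close>

primrec tail :: "complex \<Rightarrow> nat \<Rightarrow> 'a \<Rightarrow> real \<Rightarrow> 'a" where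
  "tail z 0 x r = expT z (Res z x) r"
| "tail z (Suc n) x r = tail z n (Res z x) r + (r ^ Suc n / fact (Suc n)) *\<^sub>R expT z (Res z x) r"

lemma tail_0: "tail z n x 0 = (Res z ^^ Suc n) x"
  by (induction n arbitrary: x) (auto simp: expT_def T_0 funpow_swap1)

lemma tail_has_vector_derivative:
  assumes z: "Re z > 0" and r: "r \<ge> 0"
  shows "(tail z n x has_vector_derivative - ((r ^ n / fact n) *\<^sub>R expT z x r)) (at r within {0..})"
proof (induction n arbitrary: x)
  case 0
  show ?case
    using expT_has_vector_derivative[OF Res_in_domain(1)[OF z, of x] r, of z]
    by (simp add: Res_in_domain[OF z])
next
  case (Suc n)
  have e: "((\<lambda>r. expT z (Res z x) r) has_vector_derivative - expT z x r) (at r within {0..})"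
    using expT_has_vector_derivative[OF Res_in_domain(1)[OF z, of x] r, of z]
    by (simp add: Res_in_domain[OF z])
  have p: "((\<lambda>r. r ^ Suc n / fact (Suc n)) has_real_derivative (r ^ n / fact n)) (at r within {0..})"
  proof -
    have "((\<lambda>r. r ^ Suc n / fact (Suc n)) has_real_derivative (real (Suc n) * r ^ (Suc n - Suc 0)) / fact (Suc n)) (at r within {0..})"
      by (intro DERIV_cdivide DERIV_pow)
    also have "(real (Suc n) * r ^ (Suc n - Suc 0)) / fact (Suc n) = r ^ n / fact n"
      by (simp del: of_nat_Suc)
    finally show ?thesis .
  qed
  have "((\<lambda>r. tail z n (Res z x) r + (r ^ Suc n / fact (Suc n)) *\<^sub>R expT z (Res z x) r) has_vector_derivative
      (- ((r ^ n / fact n) *\<^sub>R expT z (Res z x) r) +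
       ((r ^ Suc n / fact (Suc n)) *\<^sub>R (- expT z x r) + (r ^ n / fact n) *\<^sub>R expT z (Res z x) r))) (at r within {0..})"
    by (intro has_vector_derivative_add Suc has_vector_derivative_scaleR p e)
  then show ?case by simp
qed

text \<open>
  The bound has to be uniform along the line \<open>Re z = \<alpha>\<close>, because the tail is integrated over the
  frequencies later.
\<close>

lemma tail_decay:
  assumes \<alpha>: "\<alpha> > 0"
  shows "\<exists>g. (g \<longlongrightarrow> 0) at_top \<and> (\<forall>z x r. Re z = \<alpha> \<longrightarrow> r \<ge> 0 \<longrightarrow> norm (tail z n x r) \<le> g r * norm x)"
proof (induction n)
  case 0
  have "norm (tail z 0 x r) \<le> (K * (K / \<alpha>) * exp (- (\<alpha> * r)) / 1) * norm x" if "Re z = \<alpha>" "r \<ge> 0" for z x r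
  proof -
    have "norm (tail z 0 x r) \<le> exp (- (\<alpha> * r)) * (K * norm (Res z x))"
      using norm_expT_le[of r z "Res z x"] that by simp
    also have "\<dots> \<le> exp (- (\<alpha> * r)) * (K * (K / \<alpha> * norm x))"
      using norm_Res_le[of z x] that \<alpha> K_pos by (intro mult_left_mono) auto
    finally show ?thesis by (simp add: mult_ac)
  qed
  then show ?case using exp_decay[OF \<alpha>] by blast
next
  case (Suc n)
  then obtain g where g: "(g \<longlongrightarrow> 0) at_top"
    and gb: "\<And>z x r. Re z = \<alpha> \<Longrightarrow> r \<ge> 0 \<Longrightarrow> norm (tail z n x r) \<le> g r * norm x" by blast
  define h where "h r = max 0 (g r) * (K / \<alpha>) + (K * K / \<alpha> / fact (Suc n)) * (r ^ Suc n / exp (\<alpha> * r))" for r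
  have p: "((\<lambda>r. r ^ Suc n / exp (\<alpha> * r)) \<longlongrightarrow> 0) at_top"
  proof -
    have "((\<lambda>r. (1 / \<alpha> ^ Suc n) * ((\<alpha> * r) ^ Suc n / exp (\<alpha> * r))) \<longlongrightarrow> (1 / \<alpha> ^ Suc n) * 0) at_top"
      by (intro tendsto_mult_left filterlim_compose[OF tendsto_power_div_exp_0]
           filterlim_tendsto_pos_mult_at_top[OF tendsto_const \<alpha> filterlim_ident])
    then show ?thesis using \<alpha> by (simp add: power_mult_distrib)
  qed
  have "(h \<longlongrightarrow> max 0 0 * (K / \<alpha>) + (K * K / \<alpha> / fact (Suc n)) * 0) at_top"
    unfolding h_def by (intro tendsto_intros g p)
  then have "(h \<longlongrightarrow> 0) at_top" by simp
  moreover have "norm (tail z (Suc n) x r) \<le> h r * norm x" if z: "Re z = \<alpha>" "r \<ge> 0" for z x r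
  proof -
    have Rb: "norm (Res z x) \<le> K / \<alpha> * norm x" using norm_Res_le[of z x] z \<alpha> by simp
    have "norm (tail z (Suc n) x r) \<le> norm (tail z n (Res z x) r) + norm ((r ^ Suc n / fact (Suc n)) *\<^sub>R expT z (Res z x) r)"
      unfolding tail.simps by (rule norm_triangle_ineq)
    also have "\<dots> \<le> max 0 (g r) * (K / \<alpha> * norm x) + (r ^ Suc n / fact (Suc n)) * (exp (- (\<alpha> * r)) * (K * (K / \<alpha> * norm x)))"
    proof (rule add_mono)
      have "norm (tail z n (Res z x) r) \<le> max 0 (g r) * norm (Res z x)"
        using gb[OF z, of "Res z x"] by (smt (verit) mult_right_mono norm_ge_zero)
      also have "\<dots> \<le> max 0 (g r) * (K / \<alpha> * norm x)" using Rb by (intro mult_left_mono) auto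
      finally show "norm (tail z n (Res z x) r) \<le> max 0 (g r) * (K / \<alpha> * norm x)" .
      have "norm (expT z (Res z x) r) \<le> exp (- (\<alpha> * r)) * (K * norm (Res z x))"
        using norm_expT_le[OF z(2), of z "Res z x"] z(1) by simp
      also have "\<dots> \<le> exp (- (\<alpha> * r)) * (K * (K / \<alpha> * norm x))"
        using Rb K_pos by (intro mult_left_mono) auto
      finally have "norm (expT z (Res z x) r) \<le> exp (- (\<alpha> * r)) * (K * (K / \<alpha> * norm x))" .
      moreover have c0: "0 \<le> r ^ Suc n / fact (Suc n)" using z(2) by (simp del: power_Suc fact_Suc)
      ultimately show "norm ((r ^ Suc n / fact (Suc n)) *\<^sub>R expT z (Res z x) r) \<le> (r ^ Suc n / fact (Suc n)) * (exp (- (\<alpha> * r)) * (K * (K / \<alpha> * norm x)))"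
        unfolding norm_scaleR abs_of_nonneg[OF c0] by (rule mult_left_mono)
    qed
    also have "\<dots> = h r * norm x"
      by (simp add: h_def exp_minus divide_inverse algebra_simps del: power_Suc fact_Suc)
    finally show ?thesis .
  qed
  ultimately show ?case by blast
qed

text \<open>
  Up to the tail, powers of the resolvent are Laplace transforms of polynomially weighted orbits.
\<close>

lemma Res_power_integral:
  assumes z: "Re z > 0" and L: "L \<ge> 0"
  shows "integral {0..L} (\<lambda>r. (r ^ n / fact n) *\<^sub>R expT z x r) = (Res z ^^ Suc n) x - tail z n x L"
proof -
  have "((\<lambda>r. - ((r ^ n / fact n) *\<^sub>R expT z x r)) has_integral (tail z n x L - tail z n x 0)) {0..L}"
    by (rule fundamental_theorem_of_calculus[OF L])
       (auto intro!: has_vector_derivative_within_subset[OF tail_has_vector_derivative[OF z]])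
  from has_integral_neg[OF this] show ?thesis
    by (simp add: integral_unique tail_0 del: funpow.simps)
qed

end

section \<open>Frequency localisation of weighted orbits\<close>

locale invertible_semigroup = bounded_semigroup +
  fixes B :: "'a \<Rightarrow> 'a"
  assumes B_in_domain: "B x \<in> D"
    and A_B: "A (B x) = x"
    and B_A: "u \<in> D \<Longrightarrow> B (A u) = u"
begin

text \<open>
  With \<open>u = Res z x\<close>, the vector \<open>z B u - u\<close> is mapped to \<open>x\<close> by \<open>A\<close>, so it equals \<open>B x\<close>.
\<close>

lemma Res_B: "Re z > 0 \<Longrightarrow> Res z (B x) = B (Res z x)"
proof -
  assume z: "Re z > 0"
  define u where "u = Res z x"
  have u: "u \<in> D" "x = z *\<^sub>C u - A u" using Res_in_domain[OF z, of x] by (auto simp: u_def)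
  define v where "v = z *\<^sub>C B u + (-1) *\<^sub>C u"
  have "v \<in> D" unfolding v_def by (intro domain_plus domain_scaleC B_in_domain u)
  moreover have "A v = z *\<^sub>C A (B u) + (-1) *\<^sub>C A u"
    unfolding v_def by (simp add: domain_plus domain_scaleC B_in_domain u)
  then have "A v = x" by (simp add: A_B u(2) scaleC.minus_left)
  ultimately have "B x = v" using B_A by metis
  then have "B x = z *\<^sub>C B u - A (B u)" by (simp add: v_def A_B scaleC.minus_left)
  then show ?thesis using Res_eqI[OF z B_in_domain, of u] by (simp add: u_def)
qed

text \<open>
  Orbits that start in the range of \<open>B\<close> are smooth: this is the source of the factor \<open>1 / R\<close> in the
  high-frequency estimate.
\<close>

lemma T_B_lipschitz:
  assumes "0 \<le> r" "0 \<le> r'"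
  shows "norm (T r' (B x) - T r (B x)) \<le> K * norm x * \<bar>r' - r\<bar>"
proof -
  have *: "norm (T r' (B x) - T r (B x)) \<le> K * norm x * (r' - r)" if "0 \<le> r" "r \<le> r'" for r r'
  proof -
    have "((\<lambda>u. T u (A (B x))) has_integral (T r' (B x) - T r (B x))) {r..r'}"
      by (rule fundamental_theorem_of_calculus[OF that(2)])
         (use that in \<open>auto intro!: has_vector_derivative_within_subset[OF T_has_vector_derivative[OF B_in_domain]]\<close>)
    then have "norm (T r' (B x) - T r (B x)) \<le> K * norm x * measure lborel (cbox r r')"
      using that K_pos by (intro has_integral_bound[of _ "\<lambda>u. T u (A (B x))"]) (auto simp: A_B intro!: norm_T_le)
    then show ?thesis using that by simp
  qed
  show ?thesis
    using *[of r r'] *[of r' r] assms by (cases "r \<le> r'") (auto simp: norm_minus_commute)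
qed

definition weight :: "real \<Rightarrow> nat \<Rightarrow> real \<Rightarrow> real" where
  "weight \<alpha> n r = r ^ n / fact n * exp (- (\<alpha> * r))"

lemma weight_lipschitz:
  assumes \<alpha>: "\<alpha> \<ge> 0" and \<tau>: "\<tau> > 0" and r: "r \<ge> 0" and n: "n \<ge> 1"
  shows "\<bar>weight \<alpha> n r - weight \<alpha> n \<tau>\<bar>
    \<le> \<bar>r - \<tau>\<bar> * ((1 + \<bar>r - \<tau>\<bar> / \<tau>) ^ n * (\<tau> ^ n / fact n) * (real n / \<tau> + \<alpha>))"
proof -
  define q where "q = \<tau> + \<bar>r - \<tau>\<bar>"
  have q: "q \<ge> \<tau>" "q \<ge> r" "q > 0" using \<tau> by (auto simp: q_def)
  define w' where "w' u = (real n * u ^ (n - 1) / fact n - \<alpha> * (u ^ n / fact n)) * exp (- (\<alpha> * u))" for u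
  have d: "(weight \<alpha> n has_real_derivative w' u) (at u)" for u
  proof -
    have 1: "((\<lambda>u. u ^ n / fact n) has_real_derivative real n * u ^ (n - Suc 0) / fact n) (at u)"
      by (intro DERIV_cdivide DERIV_pow)
    have 2: "((\<lambda>u. exp (- (\<alpha> * u))) has_real_derivative - \<alpha> * exp (- (\<alpha> * u))) (at u)"
      by (auto intro!: derivative_eq_intros)
    show ?thesis
      using DERIV_mult[OF 1 2] unfolding weight_def w'_def by (simp add: algebra_simps)
  qed
  have w'b: "\<bar>w' u\<bar> \<le> q ^ n / fact n * (real n / \<tau> + \<alpha>)" if u: "0 \<le> u" "u \<le> q" for u
  proof -
    have "\<bar>w' u\<bar> \<le> \<bar>real n * u ^ (n - 1) / fact n - \<alpha> * (u ^ n / fact n)\<bar> * 1"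
      unfolding w'_def abs_mult using u \<alpha> by (intro mult_left_mono) auto
    also have "\<dots> \<le> real n * u ^ (n - 1) / fact n + \<alpha> * (u ^ n / fact n)"
      using u \<alpha> by (simp add: abs_le_iff)
    also have "\<dots> \<le> real n * q ^ (n - 1) / fact n + \<alpha> * (q ^ n / fact n)"
      using u \<alpha> by (intro add_mono divide_right_mono mult_left_mono power_mono) auto
    also have "real n * q ^ (n - 1) = real n / q * q ^ n"
      using q n by (cases n) auto
    also have "real n / q * q ^ n / fact n \<le> real n / \<tau> * q ^ n / fact n"
      using q \<tau> by (intro divide_right_mono mult_right_mono divide_left_mono) auto
    also have "real n / \<tau> * q ^ n / fact n + \<alpha> * (q ^ n / fact n) = q ^ n / fact n * (real n / \<tau> + \<alpha>)"
      by (simp add: algebra_simps add_divide_distrib)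
    finally show ?thesis by simp
  qed
  have "\<bar>weight \<alpha> n r - weight \<alpha> n \<tau>\<bar> \<le> \<bar>r - \<tau>\<bar> * (q ^ n / fact n * (real n / \<tau> + \<alpha>))"
  proof (cases r \<tau> rule: linorder_cases)
    case less
    obtain u where "r < u" "u < \<tau>" "weight \<alpha> n \<tau> - weight \<alpha> n r = (\<tau> - r) * w' u"
      using MVT2[OF less d] by blast
    then have "\<bar>weight \<alpha> n r - weight \<alpha> n \<tau>\<bar> = \<bar>r - \<tau>\<bar> * \<bar>w' u\<bar>"
      by (simp add: abs_mult abs_minus_commute[of "weight \<alpha> n r"] abs_minus_commute[of r])
    with mult_left_mono[OF w'b[of u], of "\<bar>r - \<tau>\<bar>"] show ?thesis
      using r q \<open>r < u\<close> \<open>u < \<tau>\<close> by simp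
  next
    case greater
    obtain u where "\<tau> < u" "u < r" "weight \<alpha> n r - weight \<alpha> n \<tau> = (r - \<tau>) * w' u"
      using MVT2[OF greater d] by blast
    then have "\<bar>weight \<alpha> n r - weight \<alpha> n \<tau>\<bar> = \<bar>r - \<tau>\<bar> * \<bar>w' u\<bar>"
      by (simp add: abs_mult)
    with mult_left_mono[OF w'b[of u], of "\<bar>r - \<tau>\<bar>"] show ?thesis
      using \<tau> q \<open>\<tau> < u\<close> \<open>u < r\<close> by simp
  qed simp
  also have "q ^ n = (1 + \<bar>r - \<tau>\<bar> / \<tau>) ^ n * \<tau> ^ n"
    using \<tau> by (simp add: q_def power_mult_distrib[symmetric] field_simps)
  finally show ?thesis by (simp add: mult_ac)
qed

text \<open>
  The constant is relative to the size \<open>\<tau> ^ n / fact n\<close> of the weight at \<open>\<tau>\<close>; the factor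
  \<open>(1 + \<bar>r - \<tau>\<bar> / \<tau>) ^ n\<close> accounts for the growth of the weight beyond \<open>\<tau>\<close> and is matched by
  \<open>cutoff_kernel_moment\<close>.
\<close>

lemma weighted_orbit_lipschitz:
  assumes \<alpha>: "\<alpha> \<ge> 0" and \<tau>: "\<tau> > 0" and r: "r \<ge> 0" and n: "n \<ge> 1"
  shows "norm (weight \<alpha> n r *\<^sub>R T r (B x) - weight \<alpha> n \<tau> *\<^sub>R T \<tau> (B x))
    \<le> \<bar>r - \<tau>\<bar> * (1 + \<bar>r - \<tau>\<bar> / \<tau>) ^ n * (\<tau> ^ n / fact n * K * (norm x + (real n / \<tau> + \<alpha>) * norm (B x)))"
proof -
  define Q where "Q = (1 + \<bar>r - \<tau>\<bar> / \<tau>) ^ n * (\<tau> ^ n / fact n)"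
  have wr: "0 \<le> weight \<alpha> n r" using r by (simp add: weight_def)
  have "weight \<alpha> n r \<le> Q"
  proof -
    have "weight \<alpha> n r \<le> r ^ n / fact n * 1"
      unfolding weight_def using r \<alpha> by (intro mult_left_mono) auto
    also have "r ^ n \<le> ((1 + \<bar>r - \<tau>\<bar> / \<tau>) * \<tau>) ^ n"
      using r \<tau> by (intro power_mono) (auto simp: distrib_right)
    finally show ?thesis by (simp add: Q_def power_mult_distrib divide_right_mono)
  qed
  have "weight \<alpha> n r *\<^sub>R T r (B x) - weight \<alpha> n \<tau> *\<^sub>R T \<tau> (B x)
     = weight \<alpha> n r *\<^sub>R (T r (B x) - T \<tau> (B x)) + (weight \<alpha> n r - weight \<alpha> n \<tau>) *\<^sub>R T \<tau> (B x)"
    by (simp add: algebra_simps)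
  also have "norm \<dots> \<le> Q * (K * norm x * \<bar>r - \<tau>\<bar>) + (\<bar>r - \<tau>\<bar> * (Q * (real n / \<tau> + \<alpha>))) * (K * norm (B x))"
  proof (rule order_trans[OF norm_triangle_ineq], rule add_mono)
    show "norm (weight \<alpha> n r *\<^sub>R (T r (B x) - T \<tau> (B x))) \<le> Q * (K * norm x * \<bar>r - \<tau>\<bar>)"
      unfolding norm_scaleR using wr \<open>weight \<alpha> n r \<le> Q\<close> T_B_lipschitz[of \<tau> r x] r \<tau>
      by (intro mult_mono) auto
    show "norm ((weight \<alpha> n r - weight \<alpha> n \<tau>) *\<^sub>R T \<tau> (B x)) \<le> (\<bar>r - \<tau>\<bar> * (Q * (real n / \<tau> + \<alpha>))) * (K * norm (B x))"
      unfolding norm_scaleR Q_def using \<tau> \<alpha>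
      by (intro mult_mono weight_lipschitz assms norm_T_le mult_nonneg_nonneg) auto
  qed
  also have "\<dots> = \<bar>r - \<tau>\<bar> * (1 + \<bar>r - \<tau>\<bar> / \<tau>) ^ n * (\<tau> ^ n / fact n * K * (norm x + (real n / \<tau> + \<alpha>) * norm (B x)))"
  proof -
    have "P * F * (K * nx * d) + d * (P * F * k) * (K * y) = d * P * (F * K * (nx + k * y))"
      for P F nx d k y :: real by (simp add: algebra_simps)
    then show ?thesis unfolding Q_def .
  qed
  finally show ?thesis .
qed

lemma expT_Complex: "expT (Complex \<alpha> s) y r = (of_real (exp (- (\<alpha> * r))) * cis (- (r * s))) *\<^sub>C T r y"
proof -
  have "exp (- (Complex \<alpha> s * of_real r)) = of_real (exp (- (\<alpha> * r))) * cis (- (r * s))"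
    unfolding exp_eq_polar by (simp add: mult.commute)
  then show ?thesis by (simp add: expT_def)
qed

lemma Laplace_continuous: "continuous_on S (\<lambda>s. Laplace (Complex \<alpha> s) y L)"
  unfolding Laplace_def
  by (rule continuous_on_integral_param)
     (auto simp: case_prod_unfold Complex_eq intro!: expT_continuous continuous_intros)

text \<open>
  On \<open>{0..L}\<close> this is the Plancherel inequality for the damped orbit, whose square integral is at most
  \<open>(K \<parallel>x\<parallel>)\<^sup>2 / (2 \<alpha>)\<close>. The truncated Laplace transforms converge uniformly in \<open>s\<close> as \<open>L\<close> grows.
\<close>

lemma Res_square_integral_le:
  assumes \<alpha>: "\<alpha> > 0" and R: "R > 0"
  shows "integral {-R..R} (\<lambda>s. (norm (Res (Complex \<alpha> s) x))\<^sup>2) \<le> 22 * pi * ((K * norm x)\<^sup>2 / (2 * \<alpha>))"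
proof -
  define c where "c = 22 * pi * ((K * norm x)\<^sup>2 / (2 * \<alpha>))"
  have Re: "Re (Complex \<alpha> s) > 0" for s using \<alpha> by simp
  have L: "integral {-R..R} (\<lambda>s. (norm (Laplace (Complex \<alpha> s) x L))\<^sup>2) \<le> c" if "L \<ge> 0" for L
  proof -
    have 1: "Laplace (Complex \<alpha> s) x L = integral {0..L} (\<lambda>r. cis (- (r * s)) *\<^sub>C (exp (- (\<alpha> * r)) *\<^sub>R T r x))" for s
      unfolding Laplace_def
      by (rule integral_cong) (simp add: expT_Complex scaleC_of_real[symmetric] scaleC_scaleC mult.commute)
    have cont: "continuous_on {0..L} (\<lambda>r. exp (- (\<alpha> * r)) *\<^sub>R T r x)"
      by (intro continuous_intros T_continuous_compose) auto
    have "integral {-R..R} (\<lambda>s. (norm (Laplace (Complex \<alpha> s) x L))\<^sup>2)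
       \<le> 22 * pi * integral {0..L} (\<lambda>r. (norm (exp (- (\<alpha> * r)) *\<^sub>R T r x))\<^sup>2)"
      unfolding 1 by (rule plancherel_bound_conj[OF cont R])
    also have "integral {0..L} (\<lambda>r. (norm (exp (- (\<alpha> * r)) *\<^sub>R T r x))\<^sup>2)
       \<le> integral {0..L} (\<lambda>r. exp (- (2 * \<alpha> * r)) * (K * norm x)\<^sup>2)"
    proof (rule integral_le)
      show "(\<lambda>r. (norm (exp (- (\<alpha> * r)) *\<^sub>R T r x))\<^sup>2) integrable_on {0..L}"
        by (intro integrable_continuous_interval continuous_intros cont)
      fix r assume r: "r \<in> {0..L}"
      have "(norm (exp (- (\<alpha> * r)) *\<^sub>R T r x))\<^sup>2 = exp (- (2 * \<alpha> * r)) * (norm (T r x))\<^sup>2"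
        by (simp add: power_mult_distrib exp_double[symmetric] mult_ac)
      also have "\<dots> \<le> exp (- (2 * \<alpha> * r)) * (K * norm x)\<^sup>2"
        using r norm_T_le[of r x] by (intro mult_left_mono power_mono) auto
      finally show "(norm (exp (- (\<alpha> * r)) *\<^sub>R T r x))\<^sup>2 \<le> exp (- (2 * \<alpha> * r)) * (K * norm x)\<^sup>2" .
    qed (intro integrable_continuous_interval continuous_intros)
    also have "\<dots> = (- exp (- (2 * \<alpha> * L)) / (2 * \<alpha>) * (K * norm x)\<^sup>2) - (- exp (- (2 * \<alpha> * 0)) / (2 * \<alpha>) * (K * norm x)\<^sup>2)"
    proof (rule integral_unique, rule fundamental_theorem_of_calculus[OF that])
      fix r
      have "((\<lambda>r. - exp (- (2 * \<alpha> * r)) / (2 * \<alpha>) * (K * norm x)\<^sup>2) has_real_derivative exp (- (2 * \<alpha> * r)) * (K * norm x)\<^sup>2) (at r within {0..L})"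
        by (rule derivative_eq_intros refl)+ (use \<alpha> in auto)
      then show "((\<lambda>r. - exp (- (2 * \<alpha> * r)) / (2 * \<alpha>) * (K * norm x)\<^sup>2) has_vector_derivative exp (- (2 * \<alpha> * r)) * (K * norm x)\<^sup>2) (at r within {0..L})"
        by (simp add: has_real_derivative_iff_has_vector_derivative)
    qed
    also have "\<dots> \<le> (K * norm x)\<^sup>2 / (2 * \<alpha>)" using \<alpha> by (simp add: field_simps)
    finally show ?thesis by (simp add: c_def)
  qed
  define e where "e L = K * norm x * exp (- (\<alpha> * L)) / \<alpha>" for L
  let ?r = "\<lambda>s. (norm (Res (Complex \<alpha> s) x))\<^sup>2" and ?l = "\<lambda>L s. (norm (Laplace (Complex \<alpha> s) x L))\<^sup>2"
  have "integral {-R..R} ?r \<le> c + 2 * R * (2 * e 0 * e L)" if "L \<ge> 0" for L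
  proof -
    have "integral {-R..R} ?r
       \<le> integral {-R..R} (\<lambda>s. ?l L s + 2 * e 0 * e L)"
    proof (rule integral_le)
      show "?r integrable_on {- R..R}"
        by (intro integrable_continuous_interval continuous_intros Res_continuous \<alpha>)
      show "(\<lambda>s. ?l L s + 2 * e 0 * e L) integrable_on {- R..R}"
        by (intro integrable_continuous_interval continuous_intros Laplace_continuous)
      fix s
      let ?z = "Complex \<alpha> s"
      define a l where "a = norm (Res ?z x)" and "l = norm (Laplace ?z x L)"
      have "norm (Res ?z x - Laplace ?z x L) \<le> e L"
        using Res_Laplace_le[OF Re that, of s x] by (simp add: e_def)
      then have al: "a - l \<le> e L"
        using norm_triangle_ineq2[of "Res ?z x" "Laplace ?z x L"] by (simp add: a_def l_def)
      have a0: "a \<le> e 0" "a \<ge> 0" "l \<ge> 0"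
        using norm_Res_le[OF Re, of s x] by (auto simp: e_def a_def l_def)
      have eL: "e L \<ge> 0" using \<alpha> K_pos by (simp add: e_def)
      have "a\<^sup>2 \<le> l\<^sup>2 + 2 * e 0 * e L"
      proof (cases "a \<le> l")
        case True
        then have "a\<^sup>2 \<le> l\<^sup>2" using a0 by (intro power_mono)
        then show ?thesis using a0 eL by (smt (verit) mult_nonneg_nonneg)
      next
        case False
        have "a\<^sup>2 - l\<^sup>2 = (a - l) * (a + l)" by (simp add: power2_eq_square algebra_simps)
        also have "\<dots> \<le> e L * (2 * e 0)"
          using False al a0 eL by (intro mult_mono) auto
        finally show ?thesis by (simp add: mult_ac)
      qed
      then show "(norm (Res ?z x))\<^sup>2 \<le> (norm (Laplace ?z x L))\<^sup>2 + 2 * e 0 * e L"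
        by (simp add: a_def l_def)
    qed
    also have "\<dots> = integral {-R..R} (?l L) + integral {-R..R} (\<lambda>s. 2 * e 0 * e L)"
      by (intro integral_add integrable_continuous_interval continuous_intros Laplace_continuous)
    also have "\<dots> \<le> c + 2 * R * (2 * e 0 * e L)"
      using L[OF that] R by simp
    finally show ?thesis .
  qed
  moreover have "((\<lambda>L. c + 2 * R * (2 * e 0 * e L)) \<longlongrightarrow> c + 2 * R * (2 * e 0 * 0)) at_top"
    unfolding e_def by (intro tendsto_intros exp_decay \<alpha>)
  ultimately have "integral {-R..R} ?r \<le> c + 2 * R * (2 * e 0 * 0)"
    by (intro tendsto_lowerbound[where f = "\<lambda>L. c + 2 * R * (2 * e 0 * e L)" and F = at_top])
       (auto simp: eventually_at_top_linorder)
  then show ?thesis by (simp add: c_def)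
qed

text \<open>
  The smoothed weighted orbit, given on the frequency side, where the integral runs over a compact
  interval. That it is a convolution in time is the content of \<open>filtered_as_convolution\<close>.
\<close>

definition filtered :: "(real \<Rightarrow> real) \<Rightarrow> real \<Rightarrow> real \<Rightarrow> nat \<Rightarrow> 'a \<Rightarrow> real \<Rightarrow> 'a" where
  "filtered \<psi> R \<alpha> n y \<tau> =
     integral {-R..R} (\<lambda>s. (of_real (\<psi> s) * cis (s * \<tau>)) *\<^sub>C (Res (Complex \<alpha> s) ^^ Suc n) y)"

text \<open>
  Of the \<open>n + 1\<close> resolvents, \<open>n\<close> are combined with \<open>B\<close> and estimated in operator norm; the remaining
  one is applied to \<open>x\<close> and estimated in square mean.
\<close>

lemma filtered_square_integral_le:
  assumes \<alpha>: "\<alpha> > 0" and R: "R > 0" and t: "t > 0" and m: "m \<ge> 0"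
    and \<psi>: "continuous_on UNIV \<psi>" "\<And>s. \<bar>\<psi> s\<bar> \<le> 1"
    and bound: "\<And>s v. \<bar>s\<bar> \<le> R \<Longrightarrow> norm ((Res (Complex \<alpha> s) ^^ n) (B v)) \<le> m * norm v"
  shows "integral {-t..t} (\<lambda>\<tau>. (norm (filtered \<psi> R \<alpha> n (B x) \<tau>))\<^sup>2)
      \<le> (22 * pi * m * K * norm x)\<^sup>2 / (2 * \<alpha>)"
proof -
  define F where "F s = \<psi> s *\<^sub>R (Res (Complex \<alpha> s) ^^ Suc n) (B x)" for s
  have \<psi>c: "continuous_on S \<psi>" for S using \<psi>(1) by (rule continuous_on_subset) simp
  have Fc: "continuous_on {-R..R} F"
    unfolding F_def by (intro continuous_intros \<psi>c Res_power_continuous \<alpha>)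
  have "filtered \<psi> R \<alpha> n (B x) \<tau> = integral {-R..R} (\<lambda>s. cis (s * \<tau>) *\<^sub>C F s)" for \<tau>
    unfolding filtered_def F_def
    by (rule integral_cong) (simp add: scaleC_of_real[symmetric] scaleC_scaleC mult.commute del: funpow.simps)
  then have "integral {-t..t} (\<lambda>\<tau>. (norm (filtered \<psi> R \<alpha> n (B x) \<tau>))\<^sup>2) \<le> 22 * pi * integral {-R..R} (\<lambda>s. (norm (F s))\<^sup>2)"
    using plancherel_bound[OF Fc t] by simp
  also have "integral {-R..R} (\<lambda>s. (norm (F s))\<^sup>2) \<le> integral {-R..R} (\<lambda>s. m\<^sup>2 * (norm (Res (Complex \<alpha> s) x))\<^sup>2)"
  proof (rule integral_le)
    show "(\<lambda>s. (norm (F s))\<^sup>2) integrable_on {- R..R}"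
      by (intro integrable_continuous_interval continuous_intros Fc)
    show "(\<lambda>s. m\<^sup>2 * (norm (Res (Complex \<alpha> s) x))\<^sup>2) integrable_on {- R..R}"
      by (intro integrable_continuous_interval continuous_intros Res_continuous \<alpha>)
    fix s assume s: "s \<in> {-R..R}"
    have "(Res (Complex \<alpha> s) ^^ Suc n) (B x) = (Res (Complex \<alpha> s) ^^ n) (B (Res (Complex \<alpha> s) x))"
      using \<alpha> by (simp add: funpow_swap1 Res_B)
    then have "norm (F s) \<le> 1 * (m * norm (Res (Complex \<alpha> s) x))"
      unfolding F_def norm_scaleR using bound[of s "Res (Complex \<alpha> s) x"] s \<psi>(2)[of s]
      by (intro mult_mono) auto
    then have "(norm (F s))\<^sup>2 \<le> (m * norm (Res (Complex \<alpha> s) x))\<^sup>2"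
      by (intro power_mono) auto
    then show "(norm (F s))\<^sup>2 \<le> m\<^sup>2 * (norm (Res (Complex \<alpha> s) x))\<^sup>2" by (simp add: power_mult_distrib)
  qed
  also have "\<dots> = m\<^sup>2 * integral {-R..R} (\<lambda>s. (norm (Res (Complex \<alpha> s) x))\<^sup>2)" by simp
  also have "\<dots> \<le> m\<^sup>2 * (22 * pi * ((K * norm x)\<^sup>2 / (2 * \<alpha>)))"
    by (intro mult_left_mono Res_square_integral_le \<alpha> R) simp
  also have "22 * pi * (m\<^sup>2 * (22 * pi * ((K * norm x)\<^sup>2 / (2 * \<alpha>)))) = (22 * pi * m * K * norm x)\<^sup>2 / (2 * \<alpha>)"
    by (simp add: power2_eq_square)
  finally show ?thesis by simp
qed

text \<open>
  The resolvent power is replaced by its Laplace integral over \<open>{0..L}\<close>, and the two integrals are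
  exchanged; the integral over the frequencies then produces the kernel \<open>\<phi>\<close>.
\<close>

lemma filtered_as_convolution:
  assumes \<alpha>: "\<alpha> > 0" and R: "R > 0" and L: "L \<ge> 0"
    and \<psi>: "continuous_on UNIV \<psi>" "\<And>s. \<bar>\<psi> s\<bar> \<le> 1"
    and \<phi>: "\<And>v. integral {-R..R} (\<lambda>s. of_real (\<psi> s) * cis (s * v)) = complex_of_real (\<phi> v)"
    and tail: "\<And>z. Re z = \<alpha> \<Longrightarrow> norm (tail z n y L) \<le> d"
  shows "norm (filtered \<psi> R \<alpha> n y \<tau> - integral {0..L} (\<lambda>r. \<phi> (\<tau> - r) *\<^sub>R weight \<alpha> n r *\<^sub>R T r y)) \<le> 2 * R * d"
proof -
  have Re: "Re (Complex \<alpha> s) > 0" for s using \<alpha> by simp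
  have \<psi>c: "continuous_on S (\<lambda>u. \<psi> (p u))" if "continuous_on S p" for S :: "'z::topological_space set" and p
    using continuous_on_compose2[OF \<psi>(1) that] by simp
  let ?e = "\<lambda>s. of_real (\<psi> s) * cis (s * \<tau>) :: complex"
  let ?G = "\<lambda>r. weight \<alpha> n r *\<^sub>R T r y"
  let ?P = "\<lambda>s. (Res (Complex \<alpha> s) ^^ Suc n) y" and ?S = "\<lambda>s. tail (Complex \<alpha> s) n y L"
  have ce: "continuous_on S ?e" for S by (intro continuous_intros \<psi>c)
  have I: "integral {0..L} (\<lambda>r. \<phi> (\<tau> - r) *\<^sub>R ?G r)
     = integral {-R..R} (\<lambda>s. ?e s *\<^sub>C (?P s - ?S s))"
  proof -
    have "integral {0..L} (\<lambda>r. \<phi> (\<tau> - r) *\<^sub>R ?G r)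
      = integral {0..L} (\<lambda>r. integral {-R..R} (\<lambda>s. (of_real (\<psi> s) * cis (s * (\<tau> - r))) *\<^sub>C ?G r))"
    proof (rule integral_cong)
      fix r
      have "\<phi> (\<tau> - r) *\<^sub>R ?G r = complex_of_real (\<phi> (\<tau> - r)) *\<^sub>C ?G r"
        by (simp add: scaleC_of_real)
      also have "\<dots> = integral {-R..R} (\<lambda>s. (of_real (\<psi> s) * cis (s * (\<tau> - r))) *\<^sub>C ?G r)"
        unfolding \<phi>[symmetric]
        by (rule integral_bounded_linear[OF scaleC.bounded_linear_left])
           (intro integrable_continuous_interval continuous_intros \<psi>c)
      finally show "\<phi> (\<tau> - r) *\<^sub>R ?G r = \<dots>" .
    qed
    also have "\<dots> = integral {-R..R} (\<lambda>s. integral {0..L} (\<lambda>r. (of_real (\<psi> s) * cis (s * (\<tau> - r))) *\<^sub>C ?G r))"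
      unfolding weight_def
      by (rule integral_swap_real)
         (auto simp: case_prod_unfold intro!: continuous_intros scaleC.continuous_on \<psi>c T_continuous_compose)
    also have "\<dots> = integral {-R..R} (\<lambda>s. ?e s *\<^sub>C (?P s - ?S s))"
    proof (rule integral_cong)
      fix s
      have "integral {0..L} (\<lambda>r. (of_real (\<psi> s) * cis (s * (\<tau> - r))) *\<^sub>C ?G r)
         = integral {0..L} (\<lambda>r. ?e s *\<^sub>C ((r ^ n / fact n) *\<^sub>R expT (Complex \<alpha> s) y r))"
      proof (rule integral_cong)
        fix r
        have "cis (s * (\<tau> - r)) = cis (s * \<tau>) * cis (- (r * s))"
          by (simp add: cis_mult algebra_simps)
        then show "(of_real (\<psi> s) * cis (s * (\<tau> - r))) *\<^sub>C ?G r = ?e s *\<^sub>C ((r ^ n / fact n) *\<^sub>R expT (Complex \<alpha> s) y r)"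
          by (simp only: weight_def expT_Complex scaleC_of_real[symmetric] scaleC_scaleC of_real_mult mult_ac)
      qed
      also have "\<dots> = ?e s *\<^sub>C integral {0..L} (\<lambda>r. (r ^ n / fact n) *\<^sub>R expT (Complex \<alpha> s) y r)"
        by (rule integral_bounded_linear[OF scaleC.bounded_linear_right, symmetric])
           (intro integrable_continuous_interval continuous_intros expT_continuous_on, auto)
      finally show "integral {0..L} (\<lambda>r. (of_real (\<psi> s) * cis (s * (\<tau> - r))) *\<^sub>C ?G r)
         = ?e s *\<^sub>C (?P s - ?S s)"
        by (simp only: Res_power_integral[OF Re L])
    qed
    finally show ?thesis .
  qed
  have tail_eq: "?S s = ?P s - integral {0..L} (\<lambda>r. (r ^ n / fact n) *\<^sub>R expT (Complex \<alpha> s) y r)" for s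
    using Res_power_integral[OF Re[of s] L, of n y] by simp
  have tc: "continuous_on {-R..R} (\<lambda>s. ?S s)"
    unfolding tail_eq
    by (intro continuous_intros Res_power_continuous \<alpha> continuous_on_integral_param)
       (auto simp: case_prod_unfold Complex_eq intro!: continuous_intros expT_continuous)
  have "filtered \<psi> R \<alpha> n y \<tau> - integral {0..L} (\<lambda>r. \<phi> (\<tau> - r) *\<^sub>R ?G r)
     = integral {-R..R} (\<lambda>s. ?e s *\<^sub>C ?P s - ?e s *\<^sub>C (?P s - ?S s))"
    unfolding I filtered_def
    by (intro integral_diff[symmetric] integrable_continuous_interval scaleC.continuous_on ce continuous_on_diff Res_power_continuous \<alpha> continuous_on_const tc)
  also have "\<dots> = integral {-R..R} (\<lambda>s. ?e s *\<^sub>C ?S s)"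
    by (simp only: scaleC.diff_right[symmetric]) simp
  also have "norm \<dots> \<le> integral {-R..R} (\<lambda>s. d)"
  proof (rule integral_norm_bound_integral)
    show "(\<lambda>s. ?e s *\<^sub>C ?S s) integrable_on {-R..R}"
      by (intro integrable_continuous_interval scaleC.continuous_on ce tc)
    fix s
    have "norm (?e s *\<^sub>C ?S s) = \<bar>\<psi> s\<bar> * norm (?S s)"
      by (simp add: norm_scaleC norm_mult)
    also have "\<dots> \<le> 1 * d" using \<psi>(2) tail[of "Complex \<alpha> s"] by (intro mult_mono) auto
    finally show "norm (?e s *\<^sub>C ?S s) \<le> d" by simp
  qed (intro integrable_continuous_interval continuous_on_const)
  also have "\<dots> = 2 * R * d" using R by simp
  finally show ?thesis .
qed

text \<open>
  The high-frequency estimate. In the convolution, the orbit at time \<open>r\<close> is replaced by the orbit at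
  time \<open>\<tau>\<close>; the error is controlled by the Lipschitz bound and the moment of the kernel, and the main
  term carries the mass of the kernel, which is at least \<open>1 / 8\<close>. The truncation at \<open>L\<close> disappears in
  the limit.
\<close>

lemma norm_orbit_le_filtered:
  assumes \<alpha>: "\<alpha> > 0" and R: "R > 0" and n: "n \<ge> 1" and \<tau>: "\<tau> \<ge> 1 / R"
    and \<psi>: "continuous_on UNIV \<psi>" "\<And>s. \<bar>\<psi> s\<bar> \<le> 1"
    and \<phi>: "\<And>v. integral {-R..R} (\<lambda>s. of_real (\<psi> s) * cis (s * v)) = complex_of_real (cutoff_kernel R n v)"
  shows "norm (weight \<alpha> n \<tau> *\<^sub>R T \<tau> (B x)) / 8 \<le> norm (filtered \<psi> R \<alpha> n (B x) \<tau>)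
    + 256 * pi / R * exp (8 * (real n)\<^sup>2 / (R * \<tau>)) * (\<tau> ^ n / fact n * K * (norm x + (real n / \<tau> + \<alpha>) * norm (B x)))"
proof -
  have \<tau>0: "\<tau> > 0" using R \<tau> by (smt (verit) divide_pos_pos)
  define y where "y = B x"
  define E where "E = \<tau> ^ n / fact n * K * (norm x + (real n / \<tau> + \<alpha>) * norm (B x))"
  have E0: "E \<ge> 0" unfolding E_def using \<tau>0 \<alpha> K_pos by (intro mult_nonneg_nonneg add_nonneg_nonneg) auto
  define q where "q = exp (8 * (real n)\<^sup>2 / (R * \<tau>))"
  define G where "G r = weight \<alpha> n r *\<^sub>R T r y" for r
  define \<phi>' where "\<phi>' v = cutoff_kernel R n v" for v
  have Gc: "continuous_on {a..b} G" if "a \<ge> 0" for a b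
    unfolding G_def weight_def using that
    by (intro continuous_intros T_continuous_compose) auto
  have \<psi>c: "continuous_on S (\<lambda>u. \<psi> (p u))" if "continuous_on S p" for S :: "'z::topological_space set" and p
    using continuous_on_compose2[OF \<psi>(1) that] by simp
  have "continuous_on UNIV (\<lambda>v. Re (integral {-R..R} (\<lambda>s. of_real (\<psi> s) * cis (s * v))))"
    by (intro continuous_intros continuous_on_integral_param)
       (auto simp: case_prod_unfold intro!: continuous_intros \<psi>c)
  then have \<phi>c0: "continuous_on UNIV \<phi>'" by (simp add: \<phi> \<phi>'_def)
  have \<phi>c: "continuous_on S (\<lambda>r. \<phi>' (\<tau> - r))" for S
    by (rule continuous_on_compose2[OF \<phi>c0]) (auto intro!: continuous_intros)
  obtain g where g: "(g \<longlongrightarrow> 0) at_top"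
    and gb: "\<And>z x r. Re z = \<alpha> \<Longrightarrow> r \<ge> 0 \<Longrightarrow> norm (tail z n x r) \<le> g r * norm x"
    using tail_decay[OF \<alpha>] by blast
  have main: "norm (G \<tau>) / 8 \<le> norm (filtered \<psi> R \<alpha> n y \<tau>) + 256 * pi / R * q * E + 2 * R * (g L * norm y)"
    if L: "L \<ge> \<tau>" for L
  proof -
    have L0: "L \<ge> 0" using L \<tau>0 by simp
    define c where "c = integral {0..L} (\<lambda>r. \<phi>' (\<tau> - r))"
    have "1 / 8 \<le> c"
    proof -
      have "integral {\<tau> - 1 / R..\<tau>} (\<lambda>r. R / 8) \<le> integral {\<tau> - 1 / R..\<tau>} (\<lambda>r. \<phi>' (\<tau> - r))"
      proof (rule integral_le)
        show "R / 8 \<le> \<phi>' (\<tau> - r)" if "r \<in> {\<tau> - 1 / R..\<tau>}" for r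
          unfolding \<phi>'_def by (rule cutoff_kernel_ge[OF R n]) (use that in auto)
      qed (intro integrable_continuous_interval \<phi>c continuous_on_const)+
      also have "\<dots> \<le> c"
        unfolding c_def
      proof (rule integral_subset_le)
        show "{\<tau> - 1 / R..\<tau>} \<subseteq> {0..L}" using \<tau> L by auto
        show "\<forall>r\<in>{0..L}. 0 \<le> \<phi>' (\<tau> - r)" by (simp add: \<phi>'_def cutoff_kernel_nonneg R)
      qed (intro integrable_continuous_interval \<phi>c)+
      finally show ?thesis using R by simp
    qed
    have e1: "norm (filtered \<psi> R \<alpha> n y \<tau> - integral {0..L} (\<lambda>r. \<phi>' (\<tau> - r) *\<^sub>R G r)) \<le> 2 * R * (g L * norm y)"
      unfolding G_def \<phi>'_def
      by (rule filtered_as_convolution[OF \<alpha> R L0 \<psi> \<phi>]) (use gb L0 in blast)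
    have e2: "norm (integral {0..L} (\<lambda>r. \<phi>' (\<tau> - r) *\<^sub>R G r) - c *\<^sub>R G \<tau>) \<le> 256 * pi / R * q * E"
    proof -
      have "c *\<^sub>R G \<tau> = integral {0..L} (\<lambda>r. \<phi>' (\<tau> - r) *\<^sub>R G \<tau>)"
        unfolding c_def
        by (rule integral_bounded_linear[OF bounded_linear_scaleR_left])
           (intro integrable_continuous_interval \<phi>c)
      then have eq: "integral {0..L} (\<lambda>r. \<phi>' (\<tau> - r) *\<^sub>R G r) - c *\<^sub>R G \<tau>
         = integral {0..L} (\<lambda>r. \<phi>' (\<tau> - r) *\<^sub>R G r - \<phi>' (\<tau> - r) *\<^sub>R G \<tau>)"
        using Gc[of 0 L] by (simp add: integral_diff integrable_continuous_interval continuous_on_scaleR \<phi>c)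
      have "norm (integral {0..L} (\<lambda>r. \<phi>' (\<tau> - r) *\<^sub>R G r) - c *\<^sub>R G \<tau>)
         \<le> integral {0..L} (\<lambda>r. R / (1 + R\<^sup>2 * (r - \<tau>)\<^sup>2) * (256 / R * q * E))"
        unfolding eq
      proof (rule integral_norm_bound_integral)
        show "(\<lambda>r. \<phi>' (\<tau> - r) *\<^sub>R G r - \<phi>' (\<tau> - r) *\<^sub>R G \<tau>) integrable_on {0..L}"
          using Gc[of 0 L] by (intro integrable_continuous_interval continuous_intros \<phi>c) auto
        have "1 + R\<^sup>2 * (r - \<tau>)\<^sup>2 \<noteq> 0" for r
          by (smt (verit) mult_nonneg_nonneg zero_le_power2)
        then show "(\<lambda>r. R / (1 + R\<^sup>2 * (r - \<tau>)\<^sup>2) * (256 / R * q * E)) integrable_on {0..L}"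
          by (intro integrable_continuous_interval continuous_intros) auto
        fix r assume r: "r \<in> {0..L}"
        have "norm (\<phi>' (\<tau> - r) *\<^sub>R G r - \<phi>' (\<tau> - r) *\<^sub>R G \<tau>) = \<phi>' (\<tau> - r) * norm (G r - G \<tau>)"
          using cutoff_kernel_nonneg[OF R] by (simp add: scaleR_diff_right[symmetric] \<phi>'_def)
        also have "\<dots> \<le> \<phi>' (\<tau> - r) * (\<bar>r - \<tau>\<bar> * (1 + \<bar>r - \<tau>\<bar> / \<tau>) ^ n * E)"
          unfolding G_def E_def y_def \<phi>'_def
          using r \<alpha> by (intro mult_left_mono weighted_orbit_lipschitz cutoff_kernel_nonneg R n \<tau>0) auto
        also have "\<dots> = cutoff_kernel R n (\<tau> - r) * (\<bar>\<tau> - r\<bar> * (1 + \<bar>\<tau> - r\<bar> / \<tau>) ^ n) * E"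
          by (simp add: \<phi>'_def abs_minus_commute)
        also have "\<dots> \<le> exp (8 * (real n)\<^sup>2 / (R * \<tau>)) * (256 / (1 + R\<^sup>2 * (\<tau> - r)\<^sup>2)) * E"
          by (intro mult_right_mono cutoff_kernel_moment R n \<tau>0 E0)
        also have "\<dots> = R / (1 + R\<^sup>2 * (r - \<tau>)\<^sup>2) * (256 / R * q * E)"
          using R by (simp add: q_def power2_commute)
        finally show "norm (\<phi>' (\<tau> - r) *\<^sub>R G r - \<phi>' (\<tau> - r) *\<^sub>R G \<tau>) \<le> R / (1 + R\<^sup>2 * (r - \<tau>)\<^sup>2) * (256 / R * q * E)" .
      qed
      also have "\<dots> \<le> pi * (256 / R * q * E)"
        unfolding integral_mult_left
        by (intro mult_right_mono integral_rational_le R mult_nonneg_nonneg E0) (use R in \<open>auto simp: q_def\<close>)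
      finally show ?thesis by (simp add: mult_ac)
    qed
    have "norm (G \<tau>) / 8 \<le> c * norm (G \<tau>)" using mult_right_mono[OF \<open>1 / 8 \<le> c\<close>, of "norm (G \<tau>)"] by simp
    also have "\<dots> = norm (c *\<^sub>R G \<tau>)" using \<open>1 / 8 \<le> c\<close> by simp
    also have "\<dots> \<le> norm (filtered \<psi> R \<alpha> n y \<tau>)
        + norm (filtered \<psi> R \<alpha> n y \<tau> - integral {0..L} (\<lambda>r. \<phi>' (\<tau> - r) *\<^sub>R G r))
        + norm (integral {0..L} (\<lambda>r. \<phi>' (\<tau> - r) *\<^sub>R G r) - c *\<^sub>R G \<tau>)"
      by (smt (verit) norm_triangle_sub norm_minus_commute)
    finally show ?thesis using e1 e2 by linarith
  qed
  have "((\<lambda>L. norm (filtered \<psi> R \<alpha> n y \<tau>) + 256 * pi / R * q * E + 2 * R * (g L * norm y))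
      \<longlongrightarrow> norm (filtered \<psi> R \<alpha> n y \<tau>) + 256 * pi / R * q * E + 2 * R * (0 * norm y)) at_top"
    by (intro tendsto_intros g)
  then have "norm (G \<tau>) / 8 \<le> norm (filtered \<psi> R \<alpha> n y \<tau>) + 256 * pi / R * q * E + 2 * R * (0 * norm y)"
    by (rule tendsto_lowerbound) (use main in \<open>auto simp: eventually_at_top_linorder\<close>)
  then show ?thesis by (simp add: G_def y_def q_def E_def)
qed

text \<open>
  The pointwise bound at \<open>t\<close> is obtained from the square mean over \<open>{t - t / (2 n)..t}\<close>. On this
  interval the weight is comparable with its value at \<open>t\<close>, and \<open>\<parallel>T t y\<parallel> \<le> K \<parallel>T \<tau> y\<parallel>\<close> for each \<open>\<tau>\<close> in it.
  Its length, shorter than \<open>t\<close> by a factor of order \<open>n\<close>, is responsible for the factor \<open>\<surd>n\<close>. The first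
  summand is free of this factor because it is estimated pointwise.
\<close>

lemma orbit_estimate:
  assumes \<alpha>: "\<alpha> > 0" and R: "R > 0" and n: "n \<ge> 1" and t: "t \<ge> 2 / R" and m: "m \<ge> 0"
    and bound: "\<And>s v. \<bar>s\<bar> \<le> R \<Longrightarrow> norm ((Res (Complex \<alpha> s) ^^ n) (B v)) \<le> m * norm v"
  shows "t ^ n / fact n * exp (- (\<alpha> * t)) * norm (T t (B x)) / (16 * K)
    \<le> 256 * pi / R * exp (16 * (real n)\<^sup>2 / (R * t)) * (t ^ n / fact n * K * (norm x + (2 * real n / t + \<alpha>) * norm (B x)))
      + 22 * pi * m * K * norm x * sqrt (real n / (\<alpha> * t))"
proof -
  have t0: "t > 0" using R t by (smt (verit) divide_pos_pos)
  have n0: "real n \<ge> 1" using n by simp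
  obtain \<psi> where \<psi>: "continuous_on UNIV \<psi>" "\<And>s. \<bar>\<psi> s\<bar> \<le> 1"
    and \<phi>: "\<And>v. integral {-R..R} (\<lambda>s. of_real (\<psi> s) * cis (s * v)) = complex_of_real (cutoff_kernel R n v)"
    using bandlimited_cutoff_kernel[OF R n] unfolding bandlimited_def by blast
  define Z where "Z \<tau> = norm (filtered \<psi> R \<alpha> n (B x) \<tau>)" for \<tau>
  define E where "E = 256 * pi / R * exp (16 * (real n)\<^sup>2 / (R * t)) * (t ^ n / fact n * K * (norm x + (2 * real n / t + \<alpha>) * norm (B x)))"
  define P where "P = t ^ n / fact n * exp (- (\<alpha> * t)) * norm (T t (B x)) / (16 * K) - E"
  define a where "a = t - t / (2 * real n)"
  have a: "t / 2 \<le> a" "a \<le> t" using t0 n0 by (auto simp: a_def field_simps)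
  have low: "P \<le> Z \<tau>" if \<tau>: "\<tau> \<in> {a..t}" for \<tau>
  proof -
    have \<tau>': "t / 2 \<le> \<tau>" "\<tau> \<le> t" "\<tau> > 0" using \<tau> a t0 by auto
    have \<tau>R: "\<tau> \<ge> 1 / R" using t \<tau>' by simp
    have "t ^ n / 2 \<le> \<tau> ^ n"
    proof -
      have "1 / 2 = 1 + real n * (- (1 / (2 * real n)))" using n0 by simp
      also have "\<dots> \<le> (1 + - (1 / (2 * real n))) ^ n"
        by (rule Bernoulli_inequality) (use n0 in \<open>simp add: field_simps\<close>)
      finally have "t ^ n * (1 / 2) \<le> t ^ n * (1 + - (1 / (2 * real n))) ^ n"
        using t0 by (intro mult_left_mono) auto
      also have "\<dots> = a ^ n" unfolding power_mult_distrib[symmetric] a_def by (simp add: right_diff_distrib)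
      also have "\<dots> \<le> \<tau> ^ n" using \<tau> a t0 by (intro power_mono) auto
      finally show ?thesis by simp
    qed
    from divide_right_mono[OF this, of "fact n"]
    have "t ^ n / fact n / 2 \<le> \<tau> ^ n / fact n" by simp
    then have w: "t ^ n / fact n / 2 * exp (- (\<alpha> * t)) \<le> weight \<alpha> n \<tau>"
      unfolding weight_def using \<tau>' \<alpha> by (intro mult_mono) auto
    have "norm (T t (B x)) \<le> K * norm (T \<tau> (B x))"
      using T_add[of "t - \<tau>" \<tau> "B x"] norm_T_le[of "t - \<tau>" "T \<tau> (B x)"] \<tau>' by simp
    then have Tt: "norm (T t (B x)) / K \<le> norm (T \<tau> (B x))" using K_pos by (simp add: field_simps)
    let ?E = "256 * pi / R * exp (8 * (real n)\<^sup>2 / (R * \<tau>)) * (\<tau> ^ n / fact n * K * (norm x + (real n / \<tau> + \<alpha>) * norm (B x)))"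
    let ?e = "\<tau> ^ n / fact n * K * (norm x + (real n / \<tau> + \<alpha>) * norm (B x))"
    have "t ^ n / fact n * exp (- (\<alpha> * t)) * norm (T t (B x)) / (16 * K)
       = (t ^ n / fact n / 2 * exp (- (\<alpha> * t))) * (norm (T t (B x)) / K) / 8" by simp
    also have "\<dots> \<le> weight \<alpha> n \<tau> * norm (T \<tau> (B x)) / 8"
      using w Tt t0 K_pos \<tau>' by (intro divide_right_mono mult_mono) (auto simp: weight_def)
    also have "\<dots> = norm (weight \<alpha> n \<tau> *\<^sub>R T \<tau> (B x)) / 8"
      using \<tau>' by (simp add: weight_def)
    also have "\<dots> \<le> Z \<tau> + ?E"
      unfolding Z_def by (rule norm_orbit_le_filtered[OF \<alpha> R n \<tau>R \<psi> \<phi>])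
    also have "\<dots> \<le> Z \<tau> + E"
    proof -
      have i: "1 / \<tau> \<le> 2 / t" using \<tau>' t0 by (simp add: field_simps)
      have "8 * (real n)\<^sup>2 / R * (1 / \<tau>) \<le> 8 * (real n)\<^sup>2 / R * (2 / t)"
        using i R by (intro mult_left_mono) auto
      then have 1: "exp (8 * (real n)\<^sup>2 / (R * \<tau>)) \<le> exp (16 * (real n)\<^sup>2 / (R * t))" by simp
      have "real n * (1 / \<tau>) \<le> real n * (2 / t)" using i by (intro mult_left_mono) auto
      then have 2: "real n / \<tau> \<le> 2 * real n / t" by (simp add: mult.commute)
      have 3: "?e
        \<le> t ^ n / fact n * K * (norm x + (2 * real n / t + \<alpha>) * norm (B x))"
        using \<tau>' 2 \<alpha> K_pos
        by (intro mult_mono add_mono divide_right_mono power_mono mult_right_mono mult_nonneg_nonneg add_nonneg_nonneg) auto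
      have "?E \<le> E"
        unfolding E_def
      proof (rule mult_mono[OF mult_left_mono[OF 1] 3])
        show "0 \<le> ?e"
          using \<tau>' \<alpha> K_pos by simp
      qed (use R in auto)
      then show ?thesis by simp
    qed
    finally show ?thesis by (simp add: P_def)
  qed
  define S where "S = 22 * pi * m * K * norm x"
  have S0: "S \<ge> 0" unfolding S_def using m K_pos by simp
  have "P \<le> S * sqrt (real n / (\<alpha> * t))"
  proof (cases "P \<le> 0")
    case True
    also have "0 \<le> S * sqrt (real n / (\<alpha> * t))" using S0 \<alpha> t0 by simp
    finally show ?thesis .
  next
    case False
    have Zc: "continuous_on I (\<lambda>\<tau>. (Z \<tau>)\<^sup>2)" for I
    proof -
      have "continuous_on I (\<lambda>\<tau>. filtered \<psi> R \<alpha> n (B x) \<tau>)"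
        unfolding filtered_def
      proof (rule continuous_on_integral_param, unfold case_prod_unfold, intro scaleC.continuous_on continuous_intros)
        show "continuous_on (I \<times> {-R..R}) (\<lambda>x. \<psi> (snd x))"
          by (rule continuous_on_compose2[OF \<psi>(1)]) (auto intro: continuous_intros)
        show "continuous_on (I \<times> {-R..R}) (\<lambda>p. (Res (Complex \<alpha> (snd p)) ^^ Suc n) (B x))"
          by (rule continuous_on_compose2[OF Res_power_continuous[OF \<alpha> continuous_on_const, of UNIV]])
             (auto intro: continuous_intros)
      qed
      then show ?thesis unfolding Z_def by (intro continuous_intros)
    qed
    have "t / (2 * real n) * P\<^sup>2 = integral {a..t} (\<lambda>\<tau>. P\<^sup>2)"
      using a by (simp add: a_def)
    also have "\<dots> \<le> integral {a..t} (\<lambda>\<tau>. (Z \<tau>)\<^sup>2)"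
      by (rule integral_le) (use low False in \<open>auto intro!: integrable_continuous_interval Zc power_mono\<close>)
    also have "\<dots> \<le> integral {-t..t} (\<lambda>\<tau>. (Z \<tau>)\<^sup>2)"
      by (rule integral_subset_le) (use a t0 in \<open>auto intro!: integrable_continuous_interval Zc\<close>)
    also have "\<dots> \<le> S\<^sup>2 / (2 * \<alpha>)"
      unfolding Z_def S_def by (rule filtered_square_integral_le[OF \<alpha> R t0 m \<psi> bound])
    finally have "P\<^sup>2 \<le> S\<^sup>2 * (real n / (\<alpha> * t))"
      using t0 n0 \<alpha> by (simp add: field_simps)
    also have "\<dots> = (S * sqrt (real n / (\<alpha> * t)))\<^sup>2"
      using t0 \<alpha> by (simp add: power_mult_distrib)
    finally show ?thesis
      using S0 t0 \<alpha> by (intro power2_le_imp_le[of P]) auto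
  qed
  then show ?thesis by (simp add: P_def E_def S_def)
qed

end

section \<open>From growth of the resolvent to decay of orbits\<close>

text \<open>
  The bound for the resolvent on the imaginary axis is expressed as a lower bound for \<open>i s - A\<close>.
\<close>

locale resolvent_growth = invertible_semigroup +
  fixes M N :: "real \<Rightarrow> real" and c s0 :: real
  assumes axis: "u \<in> D \<Longrightarrow> norm u \<le> M \<bar>s\<bar> * norm (Complex 0 s *\<^sub>C u - A u)"
    and M_mono: "0 \<le> r \<Longrightarrow> r \<le> s \<Longrightarrow> M r \<le> M s"
    and M_pos: "s \<ge> 0 \<Longrightarrow> M s > 0"
    and N_mono: "0 \<le> r \<Longrightarrow> r \<le> s \<Longrightarrow> N r \<le> N s"
    and N_pos: "s \<ge> 0 \<Longrightarrow> N s > 0"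
    and qpi: "quasi_positive_increase M N c s0"
begin

text \<open>
  The damping \<open>\<alpha> = 1 / (2 C1 t)\<close> is small enough for \<open>\<alpha> M(R) \<le> 1 / (2 n)\<close>. Moving a resolvent from
  the imaginary axis to the line \<open>Re z = \<alpha>\<close> then costs a factor \<open>\<kappa>\<close> with \<open>\<kappa> ^ n \<le> 2\<close>, which does not
  spoil the \<open>n\<close>-th power of the bound. The hypotheses relating \<open>n\<close>, \<open>R\<close> and \<open>t\<close> keep \<open>n / t\<close>,
  \<open>n\<^sup>2 / (R t)\<close> and \<open>\<alpha>\<close> below constants that depend on \<open>C1\<close>, \<open>C2\<close> and \<open>M 0\<close> only.
\<close>

lemma decay_estimate:
  assumes C1: "C1 > 0" and C2: "C2 \<ge> 0"
  shows "\<exists>C. \<forall>n R t x. n \<ge> 1 \<longrightarrow> N R \<le> real n \<longrightarrow> R \<ge> max s0 (2 * C1 / M 0)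
     \<longrightarrow> real n * M R \<le> C1 * t \<longrightarrow> real n \<le> C2 * R \<longrightarrow>
     norm (T t (B x)) \<le> C / R * (1 + sqrt (real n) * fact n * (M R / (c * t)) ^ n) * norm x"
proof -
  define M0 where "M0 = M 0"
  have M0: "M0 > 0" unfolding M0_def by (rule M_pos) simp
  have c: "0 < c" "c \<le> 1" and s0: "s0 > 0"
    and incr: "\<And>\<mu> s. \<mu> \<ge> 1 \<Longrightarrow> s \<ge> s0 \<Longrightarrow> M (\<mu> * s) / M s \<ge> c * \<mu> powr (1 / N (\<mu> * s))"
    using qpi unfolding quasi_positive_increase_def by auto
  have B_le: "norm (B v) \<le> M0 * norm v" for v
    using axis[OF B_in_domain, of v 0] by (simp add: A_B M0_def scaleC.zero_left flip: zero_complex.code)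
  define Cm where "Cm = 4 + 2 * M0 * s0"
  define A1 where "A1 = 256 * pi * exp (16 * (C2 * (C1 / M0))) * (K * (1 + (2 * (C1 / M0) + 1 / (2 * M0)) * M0))"
  define A2 where "A2 = 22 * pi * Cm * K * sqrt (2 * C1)"
  define C where "C = 16 * K * exp (1 / (2 * C1)) * (A1 + A2)"
  have A12: "A1 \<ge> 0" "A2 \<ge> 0"
    unfolding A1_def A2_def Cm_def using K_pos M0 s0 C1 by (auto intro!: mult_nonneg_nonneg add_nonneg_nonneg)
  have "norm (T t (B x)) \<le> C / R * (1 + sqrt (real n) * fact n * (M R / (c * t)) ^ n) * norm x"
    if n: "n \<ge> 1" and nN: "N R \<le> real n" and R: "R \<ge> max s0 (2 * C1 / M 0)"
      and nM: "real n * M R \<le> C1 * t" and nR: "real n \<le> C2 * R" for n R t x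
  proof -
    let ?Y = "sqrt (real n) * fact n * (M R / (c * t)) ^ n"
    let ?b = "2 * (C1 / M0) + 1 / (2 * M0)"
    have n1: "real n \<ge> 1" using n by simp
    have R0: "R > 0" "R \<ge> s0" "2 * C1 / M0 \<le> R" using R s0 by (auto simp: M0_def)
    have MR: "M R > 0" "M0 \<le> M R" using R0 by (auto simp: M0_def intro!: M_pos M_mono)
    have "real n * M0 \<le> real n * M R" using MR by (intro mult_left_mono) auto
    then have nM0: "real n * M0 \<le> C1 * t" using nM by simp
    have t0: "t > 0"
    proof -
      have "real n * M0 > 0" using n1 M0 by simp
      then have "C1 * t > 0" using nM0 by simp
      then show ?thesis using C1 by (simp add: zero_less_mult_iff)
    qed
    have nt: "real n / t \<le> C1 / M0" using nM0 t0 M0 by (simp add: field_simps)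
    have "1 * M0 \<le> real n * M0" using n1 M0 by (intro mult_right_mono) auto
    with nM0 have M0t: "M0 \<le> C1 * t" by linarith
    have Rt: "t \<ge> 2 / R"
    proof -
      have "M0 / C1 \<le> t" using C1 M0t by (simp add: divide_le_eq mult.commute)
      moreover have "2 / R \<le> M0 / C1" using R0 M0 C1 by (simp add: field_simps)
      ultimately show ?thesis by simp
    qed
    define \<alpha> where "\<alpha> = 1 / (2 * C1 * t)"
    have \<alpha>: "\<alpha> > 0" using C1 t0 by (simp add: \<alpha>_def)
    have \<alpha>t: "\<alpha> * t = 1 / (2 * C1)" using t0 by (simp add: \<alpha>_def)
    have \<alpha>M: "\<alpha> * M r \<le> 1 / (2 * real n)" if "0 \<le> r" "r \<le> R" for r
    proof -
      have "real n * M r \<le> real n * M R" using M_mono[OF that] by (intro mult_left_mono) auto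
      then have "real n * M r \<le> C1 * t" using nM by simp
      then show ?thesis using C1 t0 n1 by (simp add: \<alpha>_def field_simps)
    qed
    have \<alpha>0: "\<alpha> \<le> 1 / (2 * M0)"
      unfolding \<alpha>_def using M0t M0 C1 t0 by (intro divide_left_mono) auto
    define \<kappa> where "\<kappa> = 1 / (1 - 1 / (2 * real n))"
    have n2: "1 - 1 / (2 * real n) \<ge> 1 / 2" using n1 by (simp add: field_simps)
    have \<kappa>1: "\<kappa> \<ge> 1" unfolding \<kappa>_def using n1 n2 by (subst le_divide_eq_1_pos) auto
    have \<kappa>n: "\<kappa> ^ n \<le> 2"
    proof -
      have "1 / 2 = 1 + real n * (- (1 / (2 * real n)))" using n1 by simp
      also have "\<dots> \<le> (1 + - (1 / (2 * real n))) ^ n"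
        by (rule Bernoulli_inequality) (use n1 in \<open>simp add: field_simps\<close>)
      finally have h: "1 / 2 \<le> (1 - 1 / (2 * real n)) ^ n" by simp
      have "\<kappa> ^ n = 1 / (1 - 1 / (2 * real n)) ^ n" by (simp add: \<kappa>_def power_one_over)
      also have "\<dots> \<le> 1 / (1 / 2)" using h by (intro divide_left_mono) auto
      finally show ?thesis by simp
    qed
    have Re: "Re (Complex \<alpha> s) > 0" for s using \<alpha> by simp
    have Res_le: "norm (Res (Complex \<alpha> s) v) \<le> \<kappa> * M \<bar>s\<bar> * norm v" if s: "\<bar>s\<bar> \<le> R" for s v
    proof -
      define u where "u = Res (Complex \<alpha> s) v"
      have Ms: "M \<bar>s\<bar> > 0" by (rule M_pos) simp
      have "Complex \<alpha> s *\<^sub>C u - A u = v" using Res_in_domain(2)[OF Re, of s v] by (simp add: u_def)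
      moreover have "Complex \<alpha> s *\<^sub>C u = \<alpha> *\<^sub>R u + Complex 0 s *\<^sub>C u"
      proof -
        have "Complex \<alpha> s = complex_of_real \<alpha> + Complex 0 s" by (simp add: complex_eq_iff)
        then show ?thesis by (simp only: scaleC_add_left scaleC_of_real)
      qed
      ultimately have "Complex 0 s *\<^sub>C u - A u = v - \<alpha> *\<^sub>R u" by (simp add: algebra_simps)
      then have "norm u \<le> M \<bar>s\<bar> * norm (v - \<alpha> *\<^sub>R u)"
        using axis[OF Res_in_domain(1)[OF Re, of s v], of s] by (simp add: u_def)
      also have "\<dots> \<le> M \<bar>s\<bar> * (norm v + \<alpha> * norm u)"
        using norm_triangle_ineq4[of v "\<alpha> *\<^sub>R u"] \<alpha> Ms by (intro mult_left_mono) auto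
      also have "\<dots> = M \<bar>s\<bar> * norm v + (\<alpha> * M \<bar>s\<bar>) * norm u" by (simp add: algebra_simps)
      also have "\<dots> \<le> M \<bar>s\<bar> * norm v + (1 / (2 * real n)) * norm u"
        by (intro add_left_mono mult_right_mono \<alpha>M) (use s in auto)
      finally have "(1 - 1 / (2 * real n)) * norm u \<le> M \<bar>s\<bar> * norm v" by (simp add: left_diff_distrib)
      then have "norm u \<le> M \<bar>s\<bar> * norm v / (1 - 1 / (2 * real n))"
        using n2 by (subst pos_le_divide_eq) (auto simp: mult.commute)
      then show ?thesis by (simp add: \<kappa>_def u_def)
    qed
    have Res_pow: "norm ((Res (Complex \<alpha> s) ^^ k) v) \<le> (\<kappa> * M \<bar>s\<bar>) ^ k * norm v" if s: "\<bar>s\<bar> \<le> R" for s v k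
    proof (induction k)
      case (Suc k)
      have "norm ((Res (Complex \<alpha> s) ^^ Suc k) v) \<le> \<kappa> * M \<bar>s\<bar> * norm ((Res (Complex \<alpha> s) ^^ k) v)"
        using Res_le[OF s] by simp
      also have "\<dots> \<le> \<kappa> * M \<bar>s\<bar> * ((\<kappa> * M \<bar>s\<bar>) ^ k * norm v)"
        using Suc \<kappa>1 M_pos[of "\<bar>s\<bar>"] by (intro mult_left_mono) auto
      finally show ?case by (simp add: mult_ac)
    qed simp
    \<comment> \<open>Quasi-positive increase is used at the point \<open>R\<close>. The exponent \<open>n / N R \<ge> 1\<close> leaves one full factor \<open>R / r\<close>.\<close>
    have growth: "M r ^ n \<le> (M R / c) ^ n * (r / R)" if r: "s0 \<le> r" "r \<le> R" for r
    proof -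
      have r0: "r > 0" "M r > 0" using r s0 by (auto intro: M_pos)
      have Rr: "R / r \<ge> 1" "R / r * r = R" using r r0 by auto
      have NR: "N R > 0" using R0 by (auto intro: N_pos)
      have "c * (R / r) powr (1 / N R) \<le> M R / M r"
        using incr[OF Rr(1) r(1)] unfolding Rr(2) .
      then have "(c * (R / r) powr (1 / N R)) ^ n \<le> (M R / M r) ^ n"
        using c by (intro power_mono) auto
      moreover have "((R / r) powr (1 / N R)) ^ n \<ge> R / r"
      proof -
        have "R / r = (R / r) powr 1" using r0 R0 by simp
        also have "\<dots> \<le> (R / r) powr (1 / N R * real n)"
          by (rule powr_mono) (use Rr NR nN in \<open>auto simp: field_simps\<close>)
        also have "\<dots> = ((R / r) powr (1 / N R)) ^ n"
          using powr_realpow[of "(R / r) powr (1 / N R)" n] r0 R0 by (simp add: powr_powr)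
        finally show ?thesis .
      qed
      then have "c ^ n * (R / r) \<le> c ^ n * ((R / r) powr (1 / N R)) ^ n"
        using c by (intro mult_left_mono) auto
      ultimately have "c ^ n * (R / r) \<le> (M R / M r) ^ n" by (simp add: power_mult_distrib)
      then show ?thesis
        using c r0 R0 by (simp add: power_divide field_simps)
    qed
    define m where "m = Cm * (M R / c) ^ n / R"
    have Cm0: "Cm \<ge> 0" using M0 s0 by (simp add: Cm_def)
    have m0: "m \<ge> 0" unfolding m_def using Cm0 MR c R0 by simp
    have bound: "norm ((Res (Complex \<alpha> s) ^^ n) (B v)) \<le> m * norm v" if s: "\<bar>s\<bar> \<le> R" for s v
    proof -
      have X0: "(M R / c) ^ n / R \<ge> 0" using MR c R0 by simp
      have Ms: "M \<bar>s\<bar> > 0" by (rule M_pos) simp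
      show ?thesis
      proof (cases "\<bar>s\<bar> < s0")
        case True
        have "norm ((Res (Complex \<alpha> s) ^^ n) (B v)) \<le> (\<kappa> * M \<bar>s\<bar>) ^ n * norm (B v)"
          by (rule Res_pow[OF s])
        also have "\<dots> \<le> (2 * ((M R / c) ^ n * (s0 / R))) * (M0 * norm v)"
        proof (rule mult_mono[OF _ B_le])
          have "M \<bar>s\<bar> ^ n \<le> M s0 ^ n" using M_mono[of "\<bar>s\<bar>" s0] True Ms by (intro power_mono) auto
          also have "\<dots> \<le> (M R / c) ^ n * (s0 / R)" using growth[of s0] R0 by simp
          finally show "(\<kappa> * M \<bar>s\<bar>) ^ n \<le> 2 * ((M R / c) ^ n * (s0 / R))"
            unfolding power_mult_distrib using \<kappa>n Ms \<kappa>1 by (intro mult_mono) auto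
        qed (use MR c s0 R0 in auto)
        also have "\<dots> = (2 * M0 * s0) * ((M R / c) ^ n / R) * norm v" by simp
        also have "\<dots> \<le> Cm * ((M R / c) ^ n / R) * norm v"
          by (intro mult_right_mono X0) (auto simp: Cm_def)
        finally show ?thesis by (simp add: m_def)
      next
        case False
        \<comment> \<open>The resolvent equation for \<open>z = \<alpha> + i s\<close> reads \<open>z B u = B v + u\<close>, which yields the factor \<open>1 / \<bar>s\<bar>\<close>.\<close>
        define u where "u = Res (Complex \<alpha> s) v"
        have s1: "\<bar>s\<bar> > 0" using False s0 by simp
        have "Res (Complex \<alpha> s) (B v) = B u" using Res_B[OF Re] by (simp add: u_def)
        then have "u = Complex \<alpha> s *\<^sub>C B u - B v"
          using Res_in_domain(2)[OF Re, of s "B v"] by (metis A_B)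
        then have "Complex \<alpha> s *\<^sub>C B u = B v + u" by (metis eq_diff_eq add.commute)
        then have "cmod (Complex \<alpha> s) * norm (B u) \<le> norm (B v) + norm u"
          by (metis norm_scaleC norm_triangle_ineq)
        also have "\<dots> \<le> \<kappa> * M \<bar>s\<bar> * norm v + \<kappa> * M \<bar>s\<bar> * norm v"
        proof (rule add_mono)
          have "M0 \<le> M \<bar>s\<bar>" unfolding M0_def by (rule M_mono) auto
          also have "\<dots> \<le> \<kappa> * M \<bar>s\<bar>" using \<kappa>1 Ms by simp
          finally show "norm (B v) \<le> \<kappa> * M \<bar>s\<bar> * norm v"
            using B_le[of v] by (meson mult_right_mono norm_ge_zero order_trans)
          show "norm u \<le> \<kappa> * M \<bar>s\<bar> * norm v" unfolding u_def by (rule Res_le[OF s])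
        qed
        finally have "cmod (Complex \<alpha> s) * norm (B u) \<le> 2 * (\<kappa> * M \<bar>s\<bar>) * norm v"
          by (simp add: mult_ac)
        moreover have "\<bar>s\<bar> * norm (B u) \<le> cmod (Complex \<alpha> s) * norm (B u)"
          using abs_Im_le_cmod[of "Complex \<alpha> s"] by (intro mult_right_mono) auto
        ultimately have Bu: "norm (B u) \<le> 2 * (\<kappa> * M \<bar>s\<bar>) * norm v / \<bar>s\<bar>"
          using s1 by (simp add: pos_le_divide_eq mult.commute)
        obtain k where k: "n = Suc k" using n by (cases n) auto
        have "(Res (Complex \<alpha> s) ^^ n) (B v) = (Res (Complex \<alpha> s) ^^ k) (B u)"
          unfolding k u_def using Res_B[OF Re] by (simp add: funpow_swap1)
        then have "norm ((Res (Complex \<alpha> s) ^^ n) (B v)) \<le> (\<kappa> * M \<bar>s\<bar>) ^ k * norm (B u)"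
          using Res_pow[OF s] by simp
        also have "\<dots> \<le> (\<kappa> * M \<bar>s\<bar>) ^ k * (2 * (\<kappa> * M \<bar>s\<bar>) * norm v / \<bar>s\<bar>)"
          using \<kappa>1 Ms by (intro mult_left_mono Bu) auto
        also have "\<dots> = 2 * (\<kappa> ^ n) * (M \<bar>s\<bar> ^ n / \<bar>s\<bar>) * norm v"
          by (simp add: k power_mult_distrib)
        also have "\<dots> \<le> 2 * 2 * ((M R / c) ^ n / R) * norm v"
        proof (intro mult_right_mono mult_mono)
          have "M \<bar>s\<bar> ^ n / \<bar>s\<bar> \<le> ((M R / c) ^ n * (\<bar>s\<bar> / R)) / \<bar>s\<bar>"
            using growth[of "\<bar>s\<bar>"] False s s1 by (intro divide_right_mono) auto
          also have "\<dots> = (M R / c) ^ n / R" using s1 by simp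
          finally show "M \<bar>s\<bar> ^ n / \<bar>s\<bar> \<le> (M R / c) ^ n / R" .
        qed (use \<kappa>n \<kappa>1 Ms s1 in auto)
        also have "\<dots> \<le> Cm * ((M R / c) ^ n / R) * norm v"
          by (intro mult_right_mono X0) (use M0 s0 in \<open>auto simp: Cm_def\<close>)
        finally show ?thesis by (simp add: m_def)
      qed
    qed
    define \<beta> where "\<beta> = t ^ n / fact n"
    have \<beta>: "\<beta> > 0" using t0 by (simp add: \<beta>_def)
    let ?E = "256 * pi / R * exp (16 * (real n)\<^sup>2 / (R * t)) * (\<beta> * K * (norm x + (2 * real n / t + \<alpha>) * norm (B x)))"
    have "\<beta> * exp (- (\<alpha> * t)) * norm (T t (B x)) / (16 * K)
      \<le> ?E
      + 22 * pi * m * K * norm x * sqrt (real n / (\<alpha> * t))"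
      unfolding \<beta>_def by (rule orbit_estimate[OF \<alpha> R0(1) n Rt m0 bound])
    also have "\<dots> \<le> \<beta> * (A1 / R * norm x) + \<beta> * (A2 / R * ?Y * norm x)"
    proof (rule add_mono)
      have "(real n)\<^sup>2 / (R * t) = (real n / R) * (real n / t)" by (simp add: power2_eq_square)
      also have "\<dots> \<le> C2 * (C1 / M0)"
        using nt nR R0 t0 C2 by (intro mult_mono) (auto simp: pos_divide_le_eq)
      finally have e: "exp (16 * (real n)\<^sup>2 / (R * t)) \<le> exp (16 * (C2 * (C1 / M0)))" by simp
      have "(2 * real n / t + \<alpha>) * norm (B x) \<le> ?b * (M0 * norm x)"
        using nt \<alpha>0 B_le[of x] C1 M0 by (intro mult_mono add_mono) auto
      moreover have "Z \<le> k * (M0 * y) \<Longrightarrow> y + Z \<le> (1 + k * M0) * y" for Z k y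
        by (simp add: algebra_simps)
      ultimately have "norm x + (2 * real n / t + \<alpha>) * norm (B x) \<le> (1 + ?b * M0) * norm x"
        by blast
      then have "?E
         \<le> 256 * pi / R * exp (16 * (C2 * (C1 / M0))) * (\<beta> * K * ((1 + ?b * M0) * norm x))"
        using e R0 \<beta> K_pos \<alpha> t0
        by (intro mult_mono mult_nonneg_nonneg add_nonneg_nonneg) auto
      also have "\<dots> = \<beta> * (A1 / R * norm x)" by (simp add: A1_def)
      finally show "?E
        \<le> \<beta> * (A1 / R * norm x)" .
      have "sqrt (real n / (\<alpha> * t)) = sqrt (2 * C1) * sqrt (real n)"
        unfolding \<alpha>t by (simp add: real_sqrt_mult[symmetric] mult_ac)
      moreover have "m = \<beta> * (Cm / R * (fact n * (M R / (c * t)) ^ n))"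
        unfolding m_def \<beta>_def using t0 by (simp add: power_divide power_mult_distrib)
      ultimately show "22 * pi * m * K * norm x * sqrt (real n / (\<alpha> * t))
        \<le> \<beta> * (A2 / R * ?Y * norm x)"
        by (simp add: A2_def mult_ac)
    qed
    also have "\<dots> = \<beta> * ((A1 / R + A2 / R * ?Y) * norm x)"
      by (simp add: algebra_simps)
    finally have "exp (- (\<alpha> * t)) * norm (T t (B x)) / (16 * K)
       \<le> (A1 / R + A2 / R * ?Y) * norm x"
      using \<beta> by (simp add: mult.assoc times_divide_eq_right[symmetric] del: times_divide_eq_right)
    then have "norm (T t (B x)) \<le> 16 * K * exp (1 / (2 * C1)) * ((A1 / R + A2 / R * ?Y) * norm x)"
      unfolding \<alpha>t using K_pos by (simp add: exp_minus field_simps)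
    also have "\<dots> \<le> 16 * K * exp (1 / (2 * C1)) * (((A1 + A2) / R * (1 + ?Y)) * norm x)"
    proof (intro mult_left_mono mult_right_mono)
      define Y where "Y = ?Y"
      have "Y \<ge> 0" unfolding Y_def using MR c t0 by simp
      then have "0 \<le> A2 / R + A1 / R * Y" using A12 R0 by simp
      then have "A1 / R + A2 / R * Y \<le> (A1 + A2) / R * (1 + Y)"
        by (simp add: add_divide_distrib distrib_left distrib_right)
      then show "A1 / R + A2 / R * ?Y
        \<le> (A1 + A2) / R * (1 + ?Y)" by (simp add: Y_def)
    qed (use K_pos in auto)
    also have "\<dots> = C / R * (1 + ?Y) * norm x"
      by (simp add: C_def)
    finally show ?thesis .
  qed
  then show ?thesis by blast
qed

end

section \<open>The optimal power of the resolvent\<close>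

text \<open>
  A weak form of Stirling's formula; the induction step is \<open>e \<le> (1 + 1 / n) ^ (n + 1)\<close>.
\<close>

lemma fact_le_exp_power: "fact n \<le> exp 1 * real n * (real n / exp 1) ^ n" if "n \<ge> 1"
  using that
proof (induction n rule: dec_induct)
  case (step n)
  have n: "real n \<ge> 1" using step by simp
  have e: "exp 1 \<le> (1 + 1 / real n) ^ Suc n"
  proof -
    have "ln (real n / (real n + 1)) \<le> real n / (real n + 1) - 1"
      by (rule ln_le_minus_one) (use n in simp)
    also have "real n / (real n + 1) - 1 = - (1 / (real n + 1))" using n by (simp add: field_simps)
    also have "ln (real n / (real n + 1)) = - ln (1 + 1 / real n)"
      using n by (simp add: ln_div[symmetric] field_simps flip: ln_inverse)
    finally have "1 \<le> real (Suc n) * ln (1 + 1 / real n)" using n by (simp add: field_simps)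
    then have "exp 1 \<le> exp (real (Suc n) * ln (1 + 1 / real n))" by simp
    also have "\<dots> = (1 + 1 / real n) ^ Suc n"
      unfolding exp_of_nat_mult using n by (simp add: add_pos_pos)
    finally show ?thesis .
  qed
  have n0: "real n > 0" using n by simp
  have "exp 1 * (real n * real n ^ n) \<le> (1 + 1 / real n) ^ Suc n * (real n * real n ^ n)"
    using e by (intro mult_right_mono) auto
  also have "\<dots> = ((1 + 1 / real n) * real n) ^ Suc n"
  proof -
    have "b * b ^ n * (x * x ^ n) = b * x * (b * x) ^ n" for b x :: real
      by (simp add: power_mult_distrib mult_ac)
    then show ?thesis unfolding power_Suc .
  qed
  also have "(1 + 1 / real n) * real n = real (Suc n)" using n0 by (simp add: field_simps)
  finally have k: "exp 1 * (real n * real n ^ n) \<le> real (Suc n) ^ Suc n" .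
  have "fact (Suc n) = real (Suc n) * fact n" by simp
  also have "\<dots> \<le> real (Suc n) * (exp 1 * real n * (real n / exp 1) ^ n)"
    using step.IH by (intro mult_left_mono) auto
  also have "\<dots> = real (Suc n) * (exp 1 * (real n * real n ^ n)) / exp 1 ^ n"
    by (simp add: power_divide)
  also have "\<dots> \<le> real (Suc n) * (real (Suc n) ^ Suc n) / exp 1 ^ n"
    by (intro divide_right_mono mult_left_mono k) auto
  also have "\<dots> = exp 1 * real (Suc n) * (real (Suc n) / exp 1) ^ Suc n"
    by (simp add: power_divide)
  finally show ?case .
qed simp

text \<open>
  Let \<open>k = v + 3/2 ln v\<close> be the number in the denominator. By Stirling's formula the left-hand side is
  at most \<open>e n\<^sup>3\<^sup>/\<^sup>2 (n / k)\<^sup>n\<close>. Since \<open>k - n\<close> is \<open>3/2 ln n\<close> up to a bounded error and small compared with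
  \<open>n\<close>, \<open>(n / k)\<^sup>n\<close> is of order \<open>exp (n - k)\<close>, that is \<open>n\<^sup>-\<^sup>3\<^sup>/\<^sup>2\<close>, and the powers of \<open>n\<close> cancel.
\<close>

lemma factorial_power_bound:
  assumes v: "v \<ge> (3::real)" and n: "v \<le> real n" "real n \<le> v + 1"
  shows "sqrt (real n) * fact n * (exp 1 / (v * (1 + 3 * ln v / (2 * v)))) ^ n \<le> exp 13"
proof -
  define k where "k = v + 3 / 2 * ln v"
  have k: "v * (1 + 3 * ln v / (2 * v)) = k" using v by (simp add: k_def field_simps)
  have n1: "n \<ge> 1" "real n > 0" using v n by (cases n; simp)+
  have ln1: "ln v \<ge> 1"
  proof -
    have "ln (exp 1) \<le> ln v" using v exp_le by (intro ln_mono) auto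
    then show ?thesis by simp
  qed
  have k0: "k > 0" using v ln1 by (simp add: k_def)
  have lnv: "ln v \<le> v / 2"
  proof -
    have "ln (v / 2) \<le> v / 2 - 1" using v by (intro ln_le_minus_one) auto
    moreover have "ln (v / 2) = ln v - ln 2" using v by (simp add: ln_div)
    moreover have "ln 2 \<le> (2::real) - 1" by (rule ln_le_minus_one) simp
    ultimately show ?thesis by simp
  qed
  have lnv2: "(ln v)\<^sup>2 \<le> 4 * v"
  proof -
    have "ln v = 2 * ln (sqrt v)" using v by (simp add: ln_sqrt)
    also have "\<dots> \<le> 2 * (sqrt v - 1)" using v ln_le_minus_one[of "sqrt v"] by simp
    finally have "ln v \<le> 2 * sqrt v" by simp
    then have "(ln v)\<^sup>2 \<le> (2 * sqrt v)\<^sup>2" using ln1 by (intro power_mono) auto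
    then show ?thesis using v by (simp add: power_mult_distrib)
  qed
  define w where "w = (k - real n) / real n"
  have kn: "k - real n \<ge> 3 / 2 * ln v - 1" "k - real n \<le> 3 / 2 * ln v" using n by (auto simp: k_def)
  have w0: "0 \<le> w" unfolding w_def using kn ln1 n1 by (intro divide_nonneg_pos) auto
  have w1: "w \<le> 1" unfolding w_def using kn lnv n n1 by (simp add: divide_le_eq)
  have nw: "real n * w = k - real n" using n1 by (simp add: w_def)
  have kw: "k / real n = 1 + w" using n1 by (simp add: w_def field_simps)
  have "real n * w\<^sup>2 = (k - real n)\<^sup>2 / real n" using n1 by (simp add: w_def power2_eq_square)
  also have "\<dots> \<le> (3 / 2 * ln v)\<^sup>2 / v"
    using kn ln1 v n by (intro frac_le power_mono) auto
  also have "\<dots> \<le> 9"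
    using lnv2 v by (simp add: power_mult_distrib power2_eq_square divide_le_eq)
  finally have nw2: "real n * w\<^sup>2 \<le> 9" .
  have "w - w\<^sup>2 \<le> ln (1 + w)" by (rule ln_one_plus_pos_lower_bound[OF w0 w1])
  then have "real n * (w - w\<^sup>2) \<le> real n * ln (1 + w)" by (intro mult_left_mono) auto
  then have l: "real n * ln (k / real n) \<ge> 3 / 2 * ln v - 10"
    unfolding kw using nw nw2 kn by (simp add: right_diff_distrib)
  have lnn: "ln (real n) \<le> 1 + ln v"
  proof -
    have "ln (real n) \<le> ln (2 * v)" using n v n1 by (intro ln_mono) auto
    also have "\<dots> = ln 2 + ln v" using v by (simp add: ln_mult)
    finally show ?thesis using ln_le_minus_one[of 2] by simp
  qed
  have "sqrt (real n) * fact n * (exp 1 / k) ^ n \<le> sqrt (real n) * (exp 1 * real n * (real n / exp 1) ^ n) * (exp 1 / k) ^ n"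
    using k0 by (intro mult_right_mono mult_left_mono fact_le_exp_power n1) auto
  also have "\<dots> = exp 1 * (sqrt (real n) * real n) * (real n / k) ^ n"
    by (simp add: power_divide)
  also have "sqrt (real n) * real n = exp (3 / 2 * ln (real n))"
  proof -
    have "sqrt (real n) = exp (ln (sqrt (real n)))" using n1 by simp
    also have "ln (sqrt (real n)) = ln (real n) / 2" using n1 by (simp add: ln_sqrt)
    finally have "sqrt (real n) * real n = exp (ln (real n) / 2) * exp (ln (real n))" using n1 by simp
    also have "\<dots> = exp (ln (real n) / 2 + ln (real n))" by (simp only: exp_add)
    finally show ?thesis by (simp add: field_simps)
  qed
  also have "(real n / k) ^ n = exp (- (real n * ln (k / real n)))"
  proof -
    have "exp (- (real n * ln (k / real n))) = exp (real n * ln (real n / k))"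
      using n1 k0 by (simp add: ln_div algebra_simps)
    also have "\<dots> = (real n / k) ^ n" unfolding exp_of_nat_mult using n1 k0 by simp
    finally show ?thesis by simp
  qed
  also have "exp 1 * exp (3 / 2 * ln (real n)) * exp (- (real n * ln (k / real n)))
     = exp (1 + 3 / 2 * ln (real n) + - (real n * ln (k / real n)))" by (simp only: exp_add)
  also have "\<dots> \<le> exp 13" using l lnn by simp
  finally show ?thesis by (simp only: k)
qed

lemma K_fun_ge_1: "K_fun N s \<ge> 1" if "N s \<ge> 1"
proof -
  have "K_fun N s = N s + 3 / 2 * ln (N s)" using that by (simp add: K_fun_def field_simps)
  then show ?thesis using that ln_ge_zero[OF that] by linarith
qed

text \<open>
  The sublevel set in the definition of the right inverse is closed and bounded, so it contains its
  supremum.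
\<close>

lemma right_inverse_props:
  assumes F: "continuous_on {a..} F" and lim: "filterlim F at_top at_top"
    and r: "r \<ge> a" "F r \<le> \<tau>"
  shows "r \<le> right_inverse a F \<tau>" "F (right_inverse a F \<tau>) \<le> \<tau>"
proof -
  define S where "S = {r. r \<ge> a \<and> F r \<le> \<tau>}"
  have rS: "r \<in> S" using r by (simp add: S_def)
  from lim have "eventually (\<lambda>r. F r \<ge> \<tau> + 1) at_top" by (simp add: filterlim_at_top)
  then obtain X where X: "\<And>r. r \<ge> X \<Longrightarrow> F r \<ge> \<tau> + 1" by (auto simp: eventually_at_top_linorder)
  have bdd: "bdd_above S"
  proof (rule bdd_aboveI)
    fix r assume "r \<in> S"
    then show "r \<le> X" using X[of r] by (force simp: S_def)
  qed
  have "closed ({a..} \<inter> F -` {..\<tau>})"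
    by (rule continuous_closed_preimage[OF F]) auto
  also have "{a..} \<inter> F -` {..\<tau>} = S" by (auto simp: S_def)
  finally have "closed S" .
  then have "Sup S \<in> S" using rS bdd by (intro closed_contains_Sup) auto
  then show "F (right_inverse a F \<tau>) \<le> \<tau>" by (simp add: right_inverse_def S_def)
  show "r \<le> right_inverse a F \<tau>"
    unfolding right_inverse_def S_def[symmetric] by (rule cSup_upper[OF rS bdd])
qed

lemma bigo_right_inverse:
  fixes f :: "real \<Rightarrow> real"
  assumes F: "continuous_on {a..} F" and lim: "filterlim F at_top at_top" and k: "k > 0"
    and f: "\<And>t. t \<ge> 0 \<Longrightarrow> f t \<ge> 0"
    and bound: "\<And>R t. R \<ge> R0 \<Longrightarrow> t \<ge> 0 \<Longrightarrow> F R \<le> k * t \<Longrightarrow> f t \<le> C / R"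
  shows "f \<in> O[at_top](\<lambda>t. 1 / right_inverse a F (k * t))"
proof (rule bigoI)
  define r where "r = max a (max R0 1)"
  show "eventually (\<lambda>t. norm (f t) \<le> C * norm (1 / right_inverse a F (k * t))) at_top"
    using eventually_ge_at_top[of "max 0 (F r / k)"]
  proof eventually_elim
    case (elim t)
    have "F r \<le> k * t" using elim k by (simp add: field_simps)
    from right_inverse_props[OF F lim _ this]
    have R: "r \<le> right_inverse a F (k * t)" "F (right_inverse a F (k * t)) \<le> k * t"
      by (auto simp: r_def)
    then have "f t \<le> C / right_inverse a F (k * t)"
      using elim by (intro bound) (auto simp: r_def)
    then show ?case using R f[of t] elim by (simp add: r_def)
  qed
qed

context resolvent_growth
begin

lemma growth_constants: "0 < c" "c \<le> 1" "s0 > 0"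
  using qpi unfolding quasi_positive_increase_def by auto

text \<open>
  With \<open>n\<close> fixed, \<open>M(R) / t\<close> only has to be bounded, by whatever constant.
\<close>

lemma decay_bounded_N:
  assumes Nb: "\<And>s. s \<ge> 0 \<Longrightarrow> N s \<le> Nb" and k: "k > 0"
  shows "\<exists>C\<ge>0. \<exists>R0. \<forall>R\<ge>R0. \<forall>t\<ge>0. M R \<le> k * t \<longrightarrow> (\<forall>x. norm (T t (B x)) \<le> C / R * norm x)"
proof -
  define n where "n = nat \<lceil>max 1 Nb\<rceil>"
  have n: "n \<ge> 1" "Nb \<le> real n" unfolding n_def by linarith+
  define C1 where "C1 = real n * k"
  have C1: "C1 > 0" using n k by (simp add: C1_def)
  obtain C where C: "\<forall>m R t x. m \<ge> 1 \<longrightarrow> N R \<le> real m \<longrightarrow> R \<ge> max s0 (2 * C1 / M 0)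
     \<longrightarrow> real m * M R \<le> C1 * t \<longrightarrow> real m \<le> real n * R \<longrightarrow>
     norm (T t (B x)) \<le> C / R * (1 + sqrt (real m) * fact m * (M R / (c * t)) ^ m) * norm x"
    using decay_estimate[OF C1 of_nat_0_le_iff[of n]] by blast
  define C' where "C' = \<bar>C\<bar> * (1 + sqrt (real n) * fact n * (k / c) ^ n)"
  define R0 where "R0 = max 1 (max s0 (2 * C1 / M 0))"
  have "norm (T t (B x)) \<le> C' / R * norm x" if R: "R \<ge> R0" and t: "t \<ge> 0" "M R \<le> k * t" for R t x
  proof -
    have R1: "R \<ge> 1" "R \<ge> max s0 (2 * C1 / M 0)" using R by (auto simp: R0_def)
    have MR: "M R > 0" using R1 by (intro M_pos) auto
    have t0: "t > 0" using t MR k by (cases "t = 0") auto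
    have "norm (T t (B x)) \<le> C / R * (1 + sqrt (real n) * fact n * (M R / (c * t)) ^ n) * norm x"
    proof (rule C[rule_format, OF n(1) _ R1(2)])
      show "N R \<le> real n" using Nb[of R] n R1 by simp
      show "real n * M R \<le> C1 * t" using mult_left_mono[OF t(2), of "real n"] by (simp add: C1_def mult.assoc)
      show "real n \<le> real n * R" using mult_left_mono[OF R1(1), of "real n"] by simp
    qed
    also have "\<dots> \<le> \<bar>C\<bar> / R * (1 + sqrt (real n) * fact n * (k / c) ^ n) * norm x"
    proof (intro mult_right_mono mult_mono add_left_mono mult_left_mono power_mono)
      show "M R / (c * t) \<le> k / c" using t0 growth_constants t by (simp add: field_simps)
      show "C / R \<le> \<bar>C\<bar> / R" using R1 by (intro divide_right_mono) auto
    qed (use R1 MR growth_constants t0 k in \<open>auto intro!: add_nonneg_nonneg mult_nonneg_nonneg\<close>)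
    finally show ?thesis by (simp add: C'_def)
  qed
  moreover have "C' \<ge> 0" unfolding C'_def using k growth_constants by (intro mult_nonneg_nonneg add_nonneg_nonneg) auto
  ultimately show ?thesis by blast
qed

text \<open>
  The power is the least integer \<open>n \<ge> N(R)\<close>. The growth condition on \<open>N\<close> ensures that \<open>n\<close> is at
  most of order \<open>R\<close>, as \<open>decay_estimate\<close> requires.
\<close>

lemma decay_unbounded_N:
  assumes N: "filterlim N at_top at_top" and NO: "N \<in> O[at_top](\<lambda>s. ln s)"
  shows "\<exists>C\<ge>0. \<exists>R0. \<forall>R\<ge>R0. \<forall>t\<ge>0. M_K M N R \<le> c * exp 1 * t \<longrightarrow> (\<forall>x. norm (T t (B x)) \<le> C / R * norm x)"
proof -
  from NO obtain c0 where c0: "eventually (\<lambda>s. norm (N s) \<le> c0 * norm (ln s)) at_top" "c0 > 0"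
    by (elim landau_o.bigE) auto
  have "eventually (\<lambda>s. N s \<le> c0 * s \<and> N s \<ge> 3) at_top"
  proof -
    have N3: "eventually (\<lambda>s. N s \<ge> 3) at_top" using N by (simp add: filterlim_at_top)
    show ?thesis using c0(1) N3 eventually_ge_at_top[of 1]
    proof eventually_elim
      case (elim s)
      have "ln s \<le> s" "ln s \<ge> 0" using elim ln_le_minus_one[of s] by auto
      then have "c0 * norm (ln s) \<le> c0 * s" using c0 by (intro mult_left_mono) auto
      then show ?case using elim by auto
    qed
  qed
  then obtain R1 where R1: "\<And>s. s \<ge> R1 \<Longrightarrow> N s \<le> c0 * s \<and> N s \<ge> 3"
    by (auto simp: eventually_at_top_linorder)
  define C1 where "C1 = 2 * (c * exp 1)"
  have C1: "C1 > 0" using growth_constants by (simp add: C1_def)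
  have c02: "2 * c0 \<ge> 0" using c0 by simp
  obtain C where C: "\<forall>m R t x. m \<ge> 1 \<longrightarrow> N R \<le> real m \<longrightarrow> R \<ge> max s0 (2 * C1 / M 0)
     \<longrightarrow> real m * M R \<le> C1 * t \<longrightarrow> real m \<le> 2 * c0 * R \<longrightarrow>
     norm (T t (B x)) \<le> C / R * (1 + sqrt (real m) * fact m * (M R / (c * t)) ^ m) * norm x"
    using decay_estimate[OF C1 c02] by blast
  define C' where "C' = \<bar>C\<bar> * (1 + exp 13)"
  define R0 where "R0 = max R1 (max s0 (2 * C1 / M 0))"
  have "norm (T t (B x)) \<le> C' / R * norm x" if R: "R \<ge> R0" and t: "t \<ge> 0" "M_K M N R \<le> c * exp 1 * t" for R t x
  proof -
    have R': "R \<ge> R1" "R \<ge> max s0 (2 * C1 / M 0)" "R > 0" using R growth_constants by (auto simp: R0_def)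
    define v where "v = N R"
    have v: "v \<ge> 3" "v \<le> c0 * R" using R1[OF R'(1)] by (auto simp: v_def)
    define n where "n = nat \<lceil>v\<rceil>"
    have n: "v \<le> real n" "real n \<le> v + 1" "n \<ge> 1" unfolding n_def using v by linarith+
    have MR: "M R > 0" using R' by (intro M_pos) auto
    define k where "k = v * (1 + 3 * ln v / (2 * v))"
    have k: "k \<ge> v" using v by (simp add: k_def field_simps)
    have Mk: "M R * k \<le> c * exp 1 * t" using t by (simp add: M_K_def K_fun_def k_def v_def)
    have k0: "k > 0" using k v by simp
    have ct: "c * t > 0"
    proof -
      have "0 < M R * k" using MR k0 by simp
      then have "0 < exp 1 * (c * t)" using Mk by (simp add: mult_ac)
      then show ?thesis by (simp add: zero_less_mult_iff)
    qed
    have "norm (T t (B x)) \<le> C / R * (1 + sqrt (real n) * fact n * (M R / (c * t)) ^ n) * norm x"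
    proof (rule C[rule_format, OF n(3) _ R'(2)])
      show "N R \<le> real n" using n by (simp add: v_def)
      have "real n * M R \<le> (2 * k) * M R" using n k v MR by (intro mult_right_mono) auto
      also have "\<dots> \<le> C1 * t" using Mk by (simp add: C1_def mult_ac)
      finally show "real n * M R \<le> C1 * t" .
      show "real n \<le> 2 * c0 * R" using n v by simp
    qed
    also have "\<dots> \<le> \<bar>C\<bar> / R * (1 + exp 13) * norm x"
    proof (intro mult_right_mono mult_mono add_left_mono)
      have "M R / (c * t) \<le> exp 1 / k" using Mk ct k0 by (simp add: field_simps)
      then have "sqrt (real n) * fact n * (M R / (c * t)) ^ n \<le> sqrt (real n) * fact n * (exp 1 / k) ^ n"
        using MR ct by (intro mult_left_mono power_mono) auto
      also have "\<dots> \<le> exp 13" unfolding k_def by (rule factorial_power_bound[OF v(1) n(1,2)])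
      finally show "sqrt (real n) * fact n * (M R / (c * t)) ^ n \<le> exp 13" .
      show "C / R \<le> \<bar>C\<bar> / R" using R' by (intro divide_right_mono) auto
    qed (use R' MR ct in \<open>auto intro!: add_nonneg_nonneg mult_nonneg_nonneg\<close>)
    finally show ?thesis by (simp add: C'_def)
  qed
  moreover have "C' \<ge> 0" unfolding C'_def by (intro mult_nonneg_nonneg add_nonneg_nonneg) auto
  ultimately show ?thesis by blast
qed

lemma N_cases:
  obtains (bounded) Nb where "\<And>s. s \<ge> 0 \<Longrightarrow> N s \<le> Nb" | (unbounded) "filterlim N at_top at_top"
proof (cases "\<exists>Nb. \<forall>s\<ge>0. N s \<le> Nb")
  case False
  have "filterlim N at_top at_top"
    unfolding filterlim_at_top
  proof
    fix Z
    obtain s where s: "s \<ge> 0" "N s > Z" using False by (meson not_le)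
    show "eventually (\<lambda>s. Z \<le> N s) at_top"
      using eventually_ge_at_top[of s] by eventually_elim (use s N_mono[of s] in \<open>meson less_imp_le order_trans\<close>)
  qed
  then show ?thesis by (rule unbounded)
qed (use bounded in blast)

text \<open>
  If \<open>N\<close> is bounded, \<open>M\<^sub>K \<ge> M\<close> wherever \<open>N \<ge> 1\<close>, which reduces the claim to \<open>decay_bounded_N\<close>.
\<close>

lemma decay_M_K:
  assumes NO: "N \<in> O[at_top](\<lambda>s. ln s)" and N1: "\<exists>r. \<forall>s\<ge>r. N s \<ge> 1"
  shows "\<exists>C\<ge>0. \<exists>R0. \<forall>R\<ge>R0. \<forall>t\<ge>0. M_K M N R \<le> c * exp 1 * t \<longrightarrow> (\<forall>x. norm (T t (B x)) \<le> C / R * norm x)"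
proof (rule N_cases)
  fix Nb assume "\<And>s. s \<ge> 0 \<Longrightarrow> N s \<le> Nb"
  from decay_bounded_N[OF this, of "c * exp 1"] growth_constants
  obtain C R0 where C: "C \<ge> 0" "\<forall>R\<ge>R0. \<forall>t\<ge>0. M R \<le> c * exp 1 * t \<longrightarrow> (\<forall>x. norm (T t (B x)) \<le> C / R * norm x)"
    by auto
  obtain r where r: "\<forall>s\<ge>r. N s \<ge> 1" using N1 by blast
  have "M R \<le> M_K M N R" if R: "R \<ge> max 0 r" for R
  proof -
    have N: "N R \<ge> 1" "M R > 0" using r R M_pos by auto
    then have "K_fun N R \<ge> 1" by (intro K_fun_ge_1)
    then show ?thesis using N by (simp add: M_K_def)
  qed
  then have "\<forall>R\<ge>max R0 (max 0 r). \<forall>t\<ge>0. M_K M N R \<le> c * exp 1 * t \<longrightarrow> (\<forall>x. norm (T t (B x)) \<le> C / R * norm x)"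
    using C by (meson max.boundedE order_trans)
  with C(1) show ?thesis by blast
qed (rule decay_unbounded_N[OF _ NO])

text \<open>
  If \<open>N\<close> is bounded, it lies between positive constants, so \<open>M\<^sub>N\<close> is comparable with \<open>M\<close>. Otherwise
  \<open>K \<le> (1 + \<epsilon>) N\<close> far out, and \<open>(1 + \<epsilon>) (1 - \<epsilon>) \<le> 1\<close>.
\<close>

lemma decay_M_N:
  assumes NO: "N \<in> O[at_top](\<lambda>s. ln s)" and \<epsilon>: "0 < \<epsilon>" "\<epsilon> < 1"
  shows "\<exists>C\<ge>0. \<exists>R0. \<forall>R\<ge>R0. \<forall>t\<ge>0. M_N M N R \<le> c * exp 1 * (1 - \<epsilon>) * t \<longrightarrow> (\<forall>x. norm (T t (B x)) \<le> C / R * norm x)"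
proof (rule N_cases)
  fix Nb assume Nb: "\<And>s. s \<ge> 0 \<Longrightarrow> N s \<le> Nb"
  define k where "k = c * exp 1 * (1 - \<epsilon>) / N 0"
  have N0: "N 0 > 0" by (rule N_pos) simp
  have k: "k > 0" using growth_constants \<epsilon> N0 by (simp add: k_def)
  from decay_bounded_N[OF Nb k]
  obtain C R0 where C: "C \<ge> 0" "\<forall>R\<ge>R0. \<forall>t\<ge>0. M R \<le> k * t \<longrightarrow> (\<forall>x. norm (T t (B x)) \<le> C / R * norm x)"
    by auto
  have "M R \<le> k * t" if R: "R \<ge> max 0 R0" "M_N M N R \<le> c * exp 1 * (1 - \<epsilon>) * t" for R t
  proof -
    have "M R * N 0 \<le> M R * N R" using R N_mono[of 0 R] M_pos[of R] by (intro mult_left_mono) auto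
    also have "\<dots> \<le> c * exp 1 * (1 - \<epsilon>) * t" using R by (simp add: M_N_def)
    finally show ?thesis using N0 by (simp add: k_def field_simps)
  qed
  then have "\<forall>R\<ge>max 0 R0. \<forall>t\<ge>0. M_N M N R \<le> c * exp 1 * (1 - \<epsilon>) * t \<longrightarrow> (\<forall>x. norm (T t (B x)) \<le> C / R * norm x)"
    using C by (meson max.boundedE)
  with C(1) show ?thesis by blast
next
  assume N: "filterlim N at_top at_top"
  from decay_unbounded_N[OF N NO]
  obtain C R0 where C: "C \<ge> 0" "\<forall>R\<ge>R0. \<forall>t\<ge>0. M_K M N R \<le> c * exp 1 * t \<longrightarrow> (\<forall>x. norm (T t (B x)) \<le> C / R * norm x)"
    by auto
  have "((\<lambda>v::real. ln v / v) \<longlongrightarrow> 0) at_top" by (rule ln_x_over_x_tendsto_0)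
  then have "eventually (\<lambda>v::real. ln v / v < 2 * \<epsilon> / 3) at_top"
    using \<epsilon> by (intro order_tendstoD(2)) auto
  then have "eventually (\<lambda>R. ln (N R) / N R < 2 * \<epsilon> / 3) at_top"
    using N by (rule eventually_compose_filterlim)
  then obtain R1 where R1: "\<And>R. R \<ge> R1 \<Longrightarrow> ln (N R) / N R < 2 * \<epsilon> / 3"
    by (auto simp: eventually_at_top_linorder)
  have "M_K M N R \<le> c * exp 1 * t"
    if R: "R \<ge> max R0 (max 0 R1)" "t \<ge> 0" "M_N M N R \<le> c * exp 1 * (1 - \<epsilon>) * t" for R t
  proof -
    have "ln (N R) / N R < 2 * \<epsilon> / 3" using R1[of R] R by simp
    moreover have "3 * ln (N R) / (2 * N R) = 3 / 2 * (ln (N R) / N R)" by simp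
    ultimately have "3 * ln (N R) / (2 * N R) \<le> \<epsilon>" by linarith
    then have "1 + 3 * ln (N R) / (2 * N R) \<le> 1 + \<epsilon>" by simp
    then have "M_N M N R * (1 + 3 * ln (N R) / (2 * N R)) \<le> M_N M N R * (1 + \<epsilon>)"
      using R M_pos[of R] N_pos[of R] by (intro mult_left_mono) (auto simp: M_N_def)
    also have "\<dots> \<le> c * exp 1 * (1 - \<epsilon>) * t * (1 + \<epsilon>)"
      using R \<epsilon> by (intro mult_right_mono) auto
    also have "\<dots> = c * exp 1 * t * (1 - \<epsilon>\<^sup>2)" by (simp add: power2_eq_square algebra_simps)
    also have "\<dots> \<le> c * exp 1 * t * 1" using growth_constants R by (intro mult_left_mono) auto
    finally show ?thesis by (simp add: M_K_def M_N_def K_fun_def mult.assoc)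
  qed
  then have "\<forall>R\<ge>max R0 (max 0 R1). \<forall>t\<ge>0. M_N M N R \<le> c * exp 1 * (1 - \<epsilon>) * t \<longrightarrow> (\<forall>x. norm (T t (B x)) \<le> C / R * norm x)"
    using C by (meson max.boundedE)
  with C(1) show ?thesis by blast
qed

text \<open>
  For given \<open>t\<close>, the best admissible frequency \<open>R\<close> is the right inverse of \<open>F\<close> at \<open>k t\<close>.
\<close>

lemma onorm_bigo_right_inverse:
  assumes F: "continuous_on {a..} F" and lim: "filterlim F at_top at_top" and k: "k > 0"
    and "\<exists>C\<ge>0. \<exists>R0. \<forall>R\<ge>R0. \<forall>t\<ge>0. F R \<le> k * t \<longrightarrow> (\<forall>x. norm (T t (B x)) \<le> C / R * norm x)"
  shows "(\<lambda>t. onorm (\<lambda>x. T t (B x))) \<in> O[at_top](\<lambda>t. 1 / right_inverse a F (k * t))"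
proof -
  obtain C R0 where C: "C \<ge> 0"
    "\<And>R t x. R \<ge> R0 \<Longrightarrow> t \<ge> 0 \<Longrightarrow> F R \<le> k * t \<Longrightarrow> norm (T t (B x)) \<le> C / R * norm x"
    using assms(4) by blast
  have B_le: "norm (B x) \<le> M 0 * norm x" for x
    using axis[OF B_in_domain, of x 0] by (simp add: A_B scaleC.zero_left flip: zero_complex.code)
  have TB: "norm (T t (B x)) \<le> norm x * (K * M 0)" if "t \<ge> 0" for t x
  proof -
    have "norm (T t (B x)) \<le> K * norm (B x)" by (rule norm_T_le[OF that])
    also have "\<dots> \<le> K * (M 0 * norm x)" using K_pos by (intro mult_left_mono B_le) auto
    finally show ?thesis by (simp add: mult_ac)
  qed
  show ?thesis
  proof (rule bigo_right_inverse[OF F lim k])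
    show "0 \<le> onorm (\<lambda>x. T t (B x))" if "t \<ge> 0" for t
    proof -
      have "norm (T t (B 0)) / norm (0::'a) \<le> onorm (\<lambda>x. T t (B x))"
        unfolding onorm_def
        by (rule cSUP_upper) (use TB[OF that] M_pos[of 0] K_pos in \<open>auto intro!: bdd_aboveI2[where M = "K * M 0"] simp: divide_le_eq mult_ac\<close>)
      then show ?thesis by simp
    qed
    show "onorm (\<lambda>x. T t (B x)) \<le> C / R" if "R \<ge> max R0 1" "t \<ge> 0" "F R \<le> k * t" for R t
      using C that by (intro onorm_bound) auto
  qed
qed

end

section \<open>The decay rate\<close>

theorem theorem4p1:
  fixes T :: "real \<Rightarrow> 'a::complex_hilbert_space \<Rightarrow> 'a"
    and D :: "'a set" and A :: "'a \<Rightarrow> 'a"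
    and M N :: "real \<Rightarrow> real" and c s0 :: real
  assumes "bounded_C0_semigroup T"
    and "is_generator T D A"
    and "spectrum D A \<inter> {z. Re z = 0} = {}"
    and "continuous_on {0..} M" and "mono_on {0..} M" and "\<And>s. s \<ge> 0 \<Longrightarrow> M s > 0"
    and "continuous_on {0..} N" and "mono_on {0..} N" and "\<And>s. s \<ge> 0 \<Longrightarrow> N s > 0"
    and "filterlim M at_top at_top"
    and "N \<in> O[at_top](\<lambda>s. ln s)"
    and "quasi_positive_increase M N c s0"
    and "\<And>s::real. onorm (resolvent D A (\<i> * complex_of_real s)) \<le> M \<bar>s\<bar>"
  shows "((\<exists>s\<ge>0. N s > 1) \<longrightarrow>
           (\<lambda>t. onorm (\<lambda>x. T t (op_inverse D A x)))
             \<in> O[at_top](\<lambda>t. 1 / right_inverse (Ninv1 N) (M_K M N) (c * exp 1 * t)))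
       \<and> (\<forall>\<epsilon>. 0 < \<epsilon> \<and> \<epsilon> < 1 \<longrightarrow>
           (\<lambda>t. onorm (\<lambda>x. T t (op_inverse D A x)))
             \<in> O[at_top](\<lambda>t. 1 / right_inverse 0 (M_N M N) (c * exp 1 * (1 - \<epsilon>) * t)))"
proof -
  have C0: "C0_semigroup T" and bdd: "bdd_above ((\<lambda>t. onorm (T t)) ` {0..})"
    using assms(1) unfolding bounded_C0_semigroup_def by auto
  obtain K0 where K0: "\<And>t. t \<ge> 0 \<Longrightarrow> onorm (T t) \<le> K0"
    using bdd unfolding bdd_above_def by auto
  define K where "K = max 1 K0"
  have bl: "bounded_linear (T t)" if "t \<ge> 0" for t
    using C0 that unfolding C0_semigroup_def bounded_clinear_def by blast
  have nT: "norm (T t x) \<le> K * norm x" if "t \<ge> 0" for t x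
  proof -
    have "norm (T t x) \<le> onorm (T t) * norm x" by (rule onorm[OF bl[OF that]])
    also have "\<dots> \<le> K * norm x" using K0[OF that] by (intro mult_right_mono) (auto simp: K_def)
    finally show ?thesis .
  qed
  have regular: "bij_betw (\<lambda>x. z *\<^sub>C x - A x) D UNIV \<and> bounded_clinear (resolvent D A z)"
    if "Re z = 0" for z
    using assms(3) that unfolding spectrum_def by blast
  have axis: "norm u \<le> M \<bar>s\<bar> * norm (Complex 0 s *\<^sub>C u - A u)" if u: "u \<in> D" for u s
  proof -
    define z where "z = Complex 0 s"
    have z: "z = \<i> * complex_of_real s" by (simp add: z_def complex_eq_iff)
    have r: "bij_betw (\<lambda>x. z *\<^sub>C x - A x) D UNIV" "bounded_clinear (resolvent D A z)"
      using regular[of z] by (auto simp: z_def)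
    have "resolvent D A z (z *\<^sub>C u - A u) = u"
      unfolding resolvent_def op_inverse_def
      by (rule inv_into_f_f[OF bij_betw_imp_inj_on[OF r(1)] u])
    then have "norm u = norm (resolvent D A z (z *\<^sub>C u - A u))" by simp
    also have "\<dots> \<le> onorm (resolvent D A z) * norm (z *\<^sub>C u - A u)"
      by (rule onorm) (use r(2) in \<open>simp add: bounded_clinear_def\<close>)
    also have "\<dots> \<le> M \<bar>s\<bar> * norm (z *\<^sub>C u - A u)"
      unfolding z by (intro mult_right_mono assms(13)) auto
    finally show ?thesis by (simp add: z_def)
  qed
  have bij0: "bij_betw (\<lambda>x. - A x) D UNIV"
    using regular[of 0] by (simp add: scaleC.zero_left)
  have injA: "inj_on A D" using bij0 by (auto simp: bij_betw_def inj_on_def)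
  have surjA: "x \<in> A ` D" for x
  proof -
    have "- x \<in> (\<lambda>x. - A x) ` D" using bij0 by (simp add: bij_betw_def)
    then show ?thesis by auto
  qed
  define B where "B = op_inverse D A"
  interpret resolvent_growth T D A K B M N c s0
  proof
    show "bounded_clinear (T t)" if "t \<ge> 0" for t
      using C0 that unfolding C0_semigroup_def by blast
    show "T 0 x = x" for x using C0 unfolding C0_semigroup_def by blast
    show "T (s + t) x = T s (T t x)" if "s \<ge> 0" "t \<ge> 0" for s t x
      using C0 that unfolding C0_semigroup_def by blast
    show "((\<lambda>t. T t x) \<longlongrightarrow> x) (at_right 0)" for x
      using C0 unfolding C0_semigroup_def by blast
    show "is_generator T D A" by (rule assms)
    show "K \<ge> 1" by (simp add: K_def)
    show "norm (T t x) \<le> K * norm x" if "t \<ge> 0" for t x by (rule nT[OF that])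
    show "B x \<in> D" for x unfolding B_def op_inverse_def by (rule inv_into_into[OF surjA])
    show "A (B x) = x" for x unfolding B_def op_inverse_def by (rule f_inv_into_f[OF surjA])
    show "B (A u) = u" if "u \<in> D" for u
      unfolding B_def op_inverse_def by (rule inv_into_f_f[OF injA that])
    show "norm u \<le> M \<bar>s\<bar> * norm (Complex 0 s *\<^sub>C u - A u)" if "u \<in> D" for u s by (rule axis[OF that])
    show "M r \<le> M s" if "0 \<le> r" "r \<le> s" for r s
      using assms(5) that by (auto simp: mono_on_def)
    show "N r \<le> N s" if "0 \<le> r" "r \<le> s" for r s
      using assms(8) that by (auto simp: mono_on_def)
    show "M s > 0" if "s \<ge> 0" for s by (rule assms(6)[OF that])
    show "N s > 0" if "s \<ge> 0" for s by (rule assms(9)[OF that])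
    show "quasi_positive_increase M N c s0" by (rule assms)
  qed
  have 1: "(\<lambda>t. onorm (\<lambda>x. T t (B x))) \<in> O[at_top](\<lambda>t. 1 / right_inverse (Ninv1 N) (M_K M N) (c * exp 1 * t))"
    if N1: "\<exists>s\<ge>0. N s > 1"
  proof -
    obtain s1 where s1: "s1 \<ge> 0" "N s1 > 1" using N1 by blast
    have N_ge: "N s \<ge> 1" if "s \<ge> s1" for s using N_mono[of s1 s] s1 that by simp
    have a: "Ninv1 N \<ge> 0"
    proof (cases "N 0 > 1")
      case False
      have "bdd_above {r. r \<ge> 0 \<and> N r \<le> 1}"
      proof (rule bdd_aboveI)
        fix r assume "r \<in> {r. r \<ge> 0 \<and> N r \<le> 1}"
        then show "r \<le> s1" using N_mono[of s1 r] s1 by (cases "r \<le> s1") auto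
      qed
      then have "0 \<le> Sup {r. r \<ge> 0 \<and> N r \<le> 1}" using False by (intro cSup_upper) auto
      then show ?thesis using False by (simp add: Ninv1_def right_inverse_def)
    qed (simp add: Ninv1_def)
    have cont: "continuous_on {Ninv1 N..} (M_K M N)"
    proof -
      have "continuous_on {0..} (M_K M N)"
        unfolding M_K_def K_fun_def
        by (intro continuous_intros assms(4,7)) (use N_pos in \<open>force+\<close>)
      then show ?thesis by (rule continuous_on_subset) (use a in auto)
    qed
    have lim: "filterlim (M_K M N) at_top at_top"
    proof (rule filterlim_at_top_mono[OF assms(10)])
      show "eventually (\<lambda>s. M s \<le> M_K M N s) at_top"
        using eventually_ge_at_top[of s1]
      proof eventually_elim
        case (elim s)
        have N: "N s \<ge> 1" "M s > 0" using N_ge elim M_pos s1 by auto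
        then have "K_fun N s \<ge> 1" by (intro K_fun_ge_1)
        then show ?case using N by (simp add: M_K_def)
      qed
    qed
    show ?thesis
      by (rule onorm_bigo_right_inverse[OF cont lim _ decay_M_K[OF assms(11)]]) (use growth_constants N_ge in auto)
  qed
  have 2: "(\<lambda>t. onorm (\<lambda>x. T t (B x))) \<in> O[at_top](\<lambda>t. 1 / right_inverse 0 (M_N M N) (c * exp 1 * (1 - \<epsilon>) * t))"
    if \<epsilon>: "0 < \<epsilon>" "\<epsilon> < 1" for \<epsilon>
  proof -
    have cont: "continuous_on {0..} (M_N M N)"
      unfolding M_N_def by (intro continuous_intros assms(4,7))
    have lim: "filterlim (M_N M N) at_top at_top"
    proof (rule filterlim_at_top_mono)
      show "filterlim (\<lambda>s. N 0 * M s) at_top at_top"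
        by (rule filterlim_tendsto_pos_mult_at_top[OF tendsto_const N_pos assms(10)]) simp
      show "eventually (\<lambda>s. N 0 * M s \<le> M_N M N s) at_top"
        using eventually_ge_at_top[of 0]
        by eventually_elim (use N_mono M_pos in \<open>simp add: M_N_def mult.commute less_imp_le\<close>)
    qed
    show ?thesis
      by (rule onorm_bigo_right_inverse[OF cont lim _ decay_M_N[OF assms(11) \<epsilon>]]) (use growth_constants \<epsilon> in auto)
  qed
  show ?thesis using 1 2 unfolding B_def by blast
qed

end
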